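(* Let $I$ be a non-empty set. Let $\mathbb{M}_I(\mathbb{C})$ be the Banach algebra of all $I\times I$-matrices $x=(x_{i,j})_{i,j\in I}$ over $\mathbb{C}$ with $\|x\|=\sum_{i,j\in I}|x_{i,j}|<\infty$, with matrix multiplication, regarded as a dual Banach algebra. Then $\mathbb{M}_I(\mathbb{C})$ is strong pseudo-Connes amenable if and only if $I$ is finite.
   Context: A Banach algebra $\mathcal{A}$ is a dual Banach algebra if there is a closed submodule $\mathcal{A}_*$ of the dual bimodule $\mathcal{A}^*$ with $\mathcal{A}=(\mathcal{A}_* )^*$; the $wk^*$-topology on $\mathcal{A}$ is $\sigma(\mathcal{A},\mathcal{A}_* )$. For $\mathbb{M}_I(\mathbb{C})$, which as a Banach space is $\ell^1(I\times I)$, the predual is $c_0(I\times I)$ with pairing $\langle x,f\rangle=\sum_{i,j}x_{i,j}f_{i,j}$. For a dual Banach algebra $\mathcal{A}$ and a Banach $\mathcal{A}$-bimodule $E$, $\sigma wc(E)$ is the closed submodule of all $x\in E$ such that the maps $\mathcal{A}\to E$, $a\mapsto a\cdot x$ and $a\mapsto x\cdot a$, are $wk^*$-$wk$-continuous. The projective tensor product $\mathcal{A}\hat\otimes\mathcal{A}$ is an $\mathcal{A}$-bimodule via $a\cdot(b\otimes c)=ab\otimes c$, $(b\otimes c)\cdot a=b\otimes ca$; duals carry the dual module actions. Write $\sigma wc(\mathcal{A}\hat\otimes\mathcal{A})^*$ for $\sigma wc((\mathcal{A}\hat\otimes\mathcal{A})^* )$. Let $\pi:\mathcal{A}\hat\otimes\mathcal{A}\to\mathcal{A}$,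 $\pi(a\otimes b)=ab$. Then $\pi^*$ maps $\mathcal{A}_*$ into $\sigma wc(\mathcal{A}\hat\otimes\mathcal{A})^*$, and $\pi_{\sigma wc}:(\sigma wc(\mathcal{A}\hat\otimes\mathcal{A})^* )^*\to\mathcal{A}$ denotes the adjoint of $\pi^*|_{\mathcal{A}_*}$; it is an $\mathcal{A}$-bimodule morphism. $\mathcal{A}$ is strong pseudo-Connes amenable if there is a (not necessarily bounded) net $(m_\alpha)$ in $(\sigma wc(\mathcal{A}\hat\otimes\mathcal{A})^* )^*$ such that for every $a\in\mathcal{A}$: (i) $a\cdot m_\alpha-m_\alpha\cdot a\to0$ in the $wk^*$-topology of $(\sigma wc(\mathcal{A}\hat\otimes\mathcal{A})^* )^*$; (ii) $a\,\pi_{\sigma wc}(m_\alpha)=\pi_{\sigma wc}(m_\alpha)\,a$ for all $\alpha$, and $a\,\pi_{\sigma wc}(m_\alpha)\to a$ in the $wk^*$-topology of $\mathcal{A}$. *)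

theory Defs
  imports "HOL-Analysis.Analysis" "HOL-Library.Function_Algebras"
begin

section \<open>Complex normed spaces on carrier sets\<close>

text \<open>The distribution has no type class of complex vector spaces.  All spaces below are given by
  a carrier, a subspace of a type of the following class; function types carry the pointwise
  operations.  Spaces such as a predual are subspaces which do not form types, hence the
  carriers.\<close>

class complex_vector = ab_group_add +
  fixes scaleC :: "complex \<Rightarrow> 'a \<Rightarrow> 'a"  (infixr "*\<^sub>C" 75)
  assumes scaleC_add_right: "c *\<^sub>C (x + y) = c *\<^sub>C x + c *\<^sub>C y"
    and scaleC_add_left: "(c + d) *\<^sub>C x = c *\<^sub>C x + d *\<^sub>C x"
    and scaleC_scaleC: "c *\<^sub>C (d *\<^sub>C x) = (c * d) *\<^sub>C x"
    and scaleC_one: "1 *\<^sub>C x = x"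

instantiation complex :: complex_vector
begin
definition scaleC_complex_def: "c *\<^sub>C (x :: complex) = c * x"
instance
  by standard (simp_all add: scaleC_complex_def algebra_simps)
end

instantiation "fun" :: (type, complex_vector) complex_vector
begin
definition scaleC_fun_def: "c *\<^sub>C f = (\<lambda>x. c *\<^sub>C f x)"
instance
  by standard (simp_all add: scaleC_fun_def fun_eq_iff
      scaleC_add_right scaleC_add_left scaleC_scaleC scaleC_one)
end

definition csubspace :: "'a::complex_vector set \<Rightarrow> bool" where
  "csubspace S \<longleftrightarrow>
     0 \<in> S \<and> (\<forall>x\<in>S. \<forall>y\<in>S. x + y \<in> S) \<and> (\<forall>c. \<forall>x\<in>S. c *\<^sub>C x \<in> S)"

record 'a nspace =
  carr :: "'a set"
  nrm :: "'a \<Rightarrow> real"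

locale cnormed_space =
  fixes X :: "('a::complex_vector, 'm) nspace_scheme"
  assumes csubspace_carr: "csubspace (carr X)"
    and nrm_nonneg: "x \<in> carr X \<Longrightarrow> 0 \<le> nrm X x"
    and nrm_eq_0_iff: "x \<in> carr X \<Longrightarrow> nrm X x = 0 \<longleftrightarrow> x = 0"
    and nrm_triangle: "x \<in> carr X \<Longrightarrow> y \<in> carr X \<Longrightarrow> nrm X (x + y) \<le> nrm X x + nrm X y"
    and nrm_scaleC: "x \<in> carr X \<Longrightarrow> nrm X (c *\<^sub>C x) = cmod c * nrm X x"

text \<open>The cut-off outside the carrier is needed because the metric spaces of the library ask for
  nonnegativity and symmetry of the distance on the whole type.\<close>

definition ndist :: "('a::complex_vector, 'm) nspace_scheme \<Rightarrow> 'a \<Rightarrow> 'a \<Rightarrow> real" where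
  "ndist X x y = (if x \<in> carr X \<and> y \<in> carr X then nrm X (x - y) else 0)"

definition norm_topology :: "('a::complex_vector, 'm) nspace_scheme \<Rightarrow> 'a topology" where
  "norm_topology X = Metric_space.mtopology (carr X) (ndist X)"

locale cbanach_space = cnormed_space +
  assumes complete: "Metric_space.mcomplete (carr X) (ndist X)"

definition complex_nspace :: "complex nspace" where
  "complex_nspace = \<lparr>carr = UNIV, nrm = cmod\<rparr>"

text \<open>Linear maps are only relevant on the carrier; they are normalised to vanish outside it, so
  that equality of maps is equality on the carrier and pointwise operations preserve the
  normalisation.\<close>

definition bounded_linear_maps ::
  "('a::complex_vector, 'm) nspace_scheme \<Rightarrow> ('b::complex_vector, 'n) nspace_scheme \<Rightarrow> ('a \<Rightarrow> 'b) set"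
where
  "bounded_linear_maps X Y = {u.
     (\<forall>x. x \<notin> carr X \<longrightarrow> u x = 0) \<and>
     (\<forall>x\<in>carr X. u x \<in> carr Y) \<and>
     (\<forall>x\<in>carr X. \<forall>y\<in>carr X. u (x + y) = u x + u y) \<and>
     (\<forall>c. \<forall>x\<in>carr X. u (c *\<^sub>C x) = c *\<^sub>C u x) \<and>
     (\<exists>K. \<forall>x\<in>carr X. nrm Y (u x) \<le> K * nrm X x)}"

type_synonym 'a functional = "'a \<Rightarrow> complex"

definition dual :: "('a::complex_vector, 'm) nspace_scheme \<Rightarrow> 'a functional nspace" where
  "dual X = \<lparr>carr = bounded_linear_maps X complex_nspace,
             nrm = (\<lambda>\<phi>. SUP x\<in>{x \<in> carr X. nrm X x \<le> 1}. cmod (\<phi> x))\<rparr>"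

text \<open>\<open>evaluation S x\<close> is evaluation at \<open>x\<close> of functionals from \<open>S\<close>.\<close>

definition evaluation :: "'a functional set \<Rightarrow> 'a \<Rightarrow> 'a functional functional" where
  "evaluation S x = (\<lambda>\<phi>. if \<phi> \<in> S then \<phi> x else 0)"

text \<open>The topology \<open>\<sigma>(S, \<Phi>)\<close>: the coarsest topology on \<open>S\<close> which makes every element of \<open>\<Phi>\<close>
  continuous.\<close>

definition sigma_topology :: "'a set \<Rightarrow> 'a functional set \<Rightarrow> 'a topology" where
  "sigma_topology S \<Phi> = topology_generated_by {{x \<in> S. \<phi> x \<in> U} | \<phi> U. \<phi> \<in> \<Phi> \<and> open U}"

definition weak_topology :: "('a::complex_vector, 'm) nspace_scheme \<Rightarrow> 'a topology" where
  "weak_topology X = sigma_topology (carr X) (carr (dual X))"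

definition weak_star_topology ::
  "('a::complex_vector, 'm) nspace_scheme \<Rightarrow> 'a functional topology" where
  "weak_star_topology X =
     sigma_topology (carr (dual X)) (evaluation (carr (dual X)) ` carr X)"

text \<open>The completion is realised as the closure of the canonical image in the bidual.\<close>

definition completion ::
  "('a::complex_vector, 'm) nspace_scheme \<Rightarrow> 'a functional functional nspace" where
  "completion X = (dual (dual X))
     \<lparr>carr := norm_topology (dual (dual X)) closure_of (evaluation (carr (dual X)) ` carr X)\<rparr>"


section \<open>The projective tensor product\<close>

definition bilinear_forms ::
  "('a::complex_vector, 'm) nspace_scheme \<Rightarrow> ('b::complex_vector, 'n) nspace_scheme \<Rightarrow>
   ('a \<Rightarrow> 'b \<Rightarrow> complex) set" where
  "bilinear_forms X Y = {B.
     (\<forall>x y. x \<notin> carr X \<or> y \<notin> carr Y \<longrightarrow> B x y = 0) \<and>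
     (\<forall>x\<in>carr X. \<forall>x'\<in>carr X. \<forall>y\<in>carr Y. B (x + x') y = B x y + B x' y) \<and>
     (\<forall>x\<in>carr X. \<forall>y\<in>carr Y. \<forall>y'\<in>carr Y. B x (y + y') = B x y + B x y') \<and>
     (\<forall>c. \<forall>x\<in>carr X. \<forall>y\<in>carr Y. B (c *\<^sub>C x) y = c * B x y \<and> B x (c *\<^sub>C y) = c * B x y)}"

text \<open>The algebraic tensor product is realised, as in Ryan's \<^emph>\<open>Introduction to Tensor Products of
  Banach Spaces\<close>, by letting \<open>x \<otimes> y\<close> be the functional \<open>B \<mapsto> B(x, y)\<close> on the space of all (not
  necessarily bounded) bilinear forms.  Its elements are the finite sums of elementary tensors;
  scalars are absorbed into a factor.\<close>

type_synonym ('a, 'b) atensor = "('a \<Rightarrow> 'b \<Rightarrow> complex) functional"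

definition elem_tensor ::
  "('a::complex_vector, 'm) nspace_scheme \<Rightarrow> ('b::complex_vector, 'n) nspace_scheme \<Rightarrow>
   'a \<Rightarrow> 'b \<Rightarrow> ('a, 'b) atensor" where
  "elem_tensor X Y x y = (\<lambda>B. if B \<in> bilinear_forms X Y then B x y else 0)"

definition tensor_reps ::
  "('a::complex_vector, 'm) nspace_scheme \<Rightarrow> ('b::complex_vector, 'n) nspace_scheme \<Rightarrow>
   ('a, 'b) atensor \<Rightarrow> ('a \<times> 'b) list set" where
  "tensor_reps X Y t = {ps. set ps \<subseteq> carr X \<times> carr Y \<and>
     t = (\<Sum>(x, y)\<leftarrow>ps. elem_tensor X Y x y)}"

definition alg_tensor ::
  "('a::complex_vector, 'm) nspace_scheme \<Rightarrow> ('b::complex_vector, 'n) nspace_scheme \<Rightarrow>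
   ('a, 'b) atensor nspace" where
  "alg_tensor X Y =
     \<lparr>carr = {t. tensor_reps X Y t \<noteq> {}},
      nrm = (\<lambda>t. INF ps\<in>tensor_reps X Y t. \<Sum>(x, y)\<leftarrow>ps. nrm X x * nrm Y y)\<rparr>"

type_synonym ('a, 'b) ptensor = "('a, 'b) atensor functional functional"

definition proj_tensor ::
  "('a::complex_vector, 'm) nspace_scheme \<Rightarrow> ('b::complex_vector, 'n) nspace_scheme \<Rightarrow>
   ('a, 'b) ptensor nspace" where
  "proj_tensor X Y = completion (alg_tensor X Y)"

definition ptensor ::
  "('a::complex_vector, 'm) nspace_scheme \<Rightarrow> ('b::complex_vector, 'n) nspace_scheme \<Rightarrow>
   'a \<Rightarrow> 'b \<Rightarrow> ('a, 'b) ptensor" where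
  "ptensor X Y x y = evaluation (carr (dual (alg_tensor X Y))) (elem_tensor X Y x y)"

text \<open>\<open>proj_lift X Y Z \<beta>\<close> is the bounded linear map on the projective tensor product with
  \<open>x \<otimes> y \<mapsto> \<beta> x y\<close>; it exists and is unique if \<open>\<beta>\<close> is a bounded bilinear map into a Banach
  space \<open>Z\<close>.\<close>

definition proj_lift ::
  "('a::complex_vector, 'm) nspace_scheme \<Rightarrow> ('b::complex_vector, 'n) nspace_scheme \<Rightarrow>
   ('c::complex_vector, 'k) nspace_scheme \<Rightarrow> ('a \<Rightarrow> 'b \<Rightarrow> 'c) \<Rightarrow> ('a, 'b) ptensor \<Rightarrow> 'c" where
  "proj_lift X Y Z \<beta> = (THE u. u \<in> bounded_linear_maps (proj_tensor X Y) Z \<and>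
     (\<forall>x\<in>carr X. \<forall>y\<in>carr Y. u (ptensor X Y x y) = \<beta> x y))"


section \<open>Banach algebras and bimodules\<close>

record 'a nalgebra = "'a nspace" +
  mult :: "'a \<Rightarrow> 'a \<Rightarrow> 'a"

locale cbanach_algebra = cbanach_space A
  for A :: "('a::complex_vector, 'm) nalgebra_scheme" +
  assumes mult_closed: "a \<in> carr A \<Longrightarrow> b \<in> carr A \<Longrightarrow> mult A a b \<in> carr A"
    and mult_assoc: "a \<in> carr A \<Longrightarrow> b \<in> carr A \<Longrightarrow> c \<in> carr A \<Longrightarrow>
      mult A (mult A a b) c = mult A a (mult A b c)"
    and mult_add_left: "a \<in> carr A \<Longrightarrow> b \<in> carr A \<Longrightarrow> c \<in> carr A \<Longrightarrow>
      mult A (a + b) c = mult A a c + mult A b c"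
    and mult_add_right: "a \<in> carr A \<Longrightarrow> b \<in> carr A \<Longrightarrow> c \<in> carr A \<Longrightarrow>
      mult A a (b + c) = mult A a b + mult A a c"
    and mult_scaleC_left: "a \<in> carr A \<Longrightarrow> b \<in> carr A \<Longrightarrow>
      mult A (z *\<^sub>C a) b = z *\<^sub>C mult A a b"
    and mult_scaleC_right: "a \<in> carr A \<Longrightarrow> b \<in> carr A \<Longrightarrow>
      mult A a (z *\<^sub>C b) = z *\<^sub>C mult A a b"
    and nrm_mult: "a \<in> carr A \<Longrightarrow> b \<in> carr A \<Longrightarrow> nrm A (mult A a b) \<le> nrm A a * nrm A b"

record ('a, 'e) bimodule = "'e nspace" +
  lact :: "'a \<Rightarrow> 'e \<Rightarrow> 'e"
  ract :: "'e \<Rightarrow> 'a \<Rightarrow> 'e"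

definition regular_bimodule ::
  "('a::complex_vector, 'm) nalgebra_scheme \<Rightarrow> ('a, 'a) bimodule" where
  "regular_bimodule A = \<lparr>carr = carr A, nrm = nrm A, lact = mult A, ract = mult A\<rparr>"

definition dual_bimodule ::
  "('a, 'e::complex_vector) bimodule \<Rightarrow> ('a, 'e functional) bimodule" where
  "dual_bimodule E = \<lparr>carr = carr (dual E), nrm = nrm (dual E),
     lact = (\<lambda>a \<phi> x. if x \<in> carr E then \<phi> (ract E x a) else 0),
     ract = (\<lambda>\<phi> a x. if x \<in> carr E then \<phi> (lact E a x) else 0)\<rparr>"

definition tensor_bimodule ::
  "('a::complex_vector, 'm) nalgebra_scheme \<Rightarrow> ('a, ('a, 'a) ptensor) bimodule" where
  "tensor_bimodule A = \<lparr>carr = carr (proj_tensor A A), nrm = nrm (proj_tensor A A),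
     lact = (\<lambda>a. proj_lift A A (proj_tensor A A) (\<lambda>b c. ptensor A A (mult A a b) c)),
     ract = (\<lambda>t a. proj_lift A A (proj_tensor A A) (\<lambda>b c. ptensor A A b (mult A c a)) t)\<rparr>"

definition closed_submodule ::
  "('a, 'm) nspace_scheme \<Rightarrow> ('a, 'e::complex_vector) bimodule \<Rightarrow> 'e set \<Rightarrow> bool" where
  "closed_submodule A E F \<longleftrightarrow>
     csubspace F \<and> closedin (norm_topology E) F \<and>
     (\<forall>a\<in>carr A. \<forall>x\<in>F. lact E a x \<in> F \<and> ract E x a \<in> F)"


section \<open>Dual Banach algebras\<close>

text \<open>A predual of \<open>A\<close> is given as a set \<open>P\<close> of functionals on \<open>A\<close>, and \<open>A = P\<^sup>*\<close> means that the
  canonical map from \<open>A\<close> to the dual of \<open>P\<close> is an isometric bijection.\<close>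

definition predual_space ::
  "('a::complex_vector, 'm) nspace_scheme \<Rightarrow> 'a functional set \<Rightarrow> 'a functional nspace" where
  "predual_space A P = (dual A)\<lparr>carr := P\<rparr>"

locale dual_banach_algebra = cbanach_algebra A
  for A :: "('a::complex_vector, 'm) nalgebra_scheme" +
  fixes P :: "'a functional set"
  assumes predual_submodule: "closed_submodule A (dual_bimodule (regular_bimodule A)) P"
    and predual_bij: "bij_betw (evaluation P) (carr A) (carr (dual (predual_space A P)))"
    and predual_isometry: "a \<in> carr A \<Longrightarrow> nrm (dual (predual_space A P)) (evaluation P a) = nrm A a"

definition sigma_wc ::
  "('a::complex_vector, 'm) nalgebra_scheme \<Rightarrow> 'a functional set \<Rightarrow>
   ('a, 'e::complex_vector) bimodule \<Rightarrow> ('a, 'e) bimodule" where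
  "sigma_wc A P E = E\<lparr>carr := {x \<in> carr E.
     continuous_map (sigma_topology (carr A) P) (weak_topology E) (\<lambda>a. lact E a x) \<and>
     continuous_map (sigma_topology (carr A) P) (weak_topology E) (\<lambda>a. ract E x a)}\<rparr>"

abbreviation sigma_wc_tensor ::
  "('a::complex_vector, 'm) nalgebra_scheme \<Rightarrow> 'a functional set \<Rightarrow>
   ('a, ('a, 'a) ptensor functional) bimodule" where
  "sigma_wc_tensor A P \<equiv> sigma_wc A P (dual_bimodule (tensor_bimodule A))"

definition pi_map :: "('a::complex_vector, 'm) nalgebra_scheme \<Rightarrow> ('a, 'a) ptensor \<Rightarrow> 'a" where
  "pi_map A = proj_lift A A A (mult A)"

definition pi_adjoint ::
  "('a::complex_vector, 'm) nalgebra_scheme \<Rightarrow> 'a functional \<Rightarrow> ('a, 'a) ptensor functional" where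
  "pi_adjoint A \<phi> = (\<lambda>t. if t \<in> carr (proj_tensor A A) then \<phi> (pi_map A t) else 0)"

text \<open>The adjoint of the restriction of \<open>\<pi>\<^sup>*\<close> to \<open>P\<close> sends \<open>m\<close> to an element of the dual of \<open>P\<close>,
  which is then identified with an element of \<open>A\<close>.\<close>

definition pi_sigma_wc ::
  "('a::complex_vector, 'm) nalgebra_scheme \<Rightarrow> 'a functional set \<Rightarrow>
   ('a, 'a) ptensor functional functional \<Rightarrow> 'a" where
  "pi_sigma_wc A P m =
     inv_into (carr A) (evaluation P) (\<lambda>\<phi>. if \<phi> \<in> P then m (pi_adjoint A \<phi>) else 0)"


section \<open>Strong pseudo-Connes amenability\<close>

definition directed_preorder :: "'d set \<Rightarrow> ('d \<Rightarrow> 'd \<Rightarrow> bool) \<Rightarrow> bool" where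
  "directed_preorder D le \<longleftrightarrow> D \<noteq> {} \<and> (\<forall>i\<in>D. le i i) \<and>
     (\<forall>i\<in>D. \<forall>j\<in>D. \<forall>k\<in>D. le i j \<longrightarrow> le j k \<longrightarrow> le i k) \<and>
     (\<forall>i\<in>D. \<forall>j\<in>D. \<exists>k\<in>D. le i k \<and> le j k)"

definition net_filter :: "'d set \<Rightarrow> ('d \<Rightarrow> 'd \<Rightarrow> bool) \<Rightarrow> 'd filter" where
  "net_filter D le = (INF i\<in>D. principal {j \<in> D. le i j})"

definition spca_net ::
  "('a::complex_vector, 'm) nalgebra_scheme \<Rightarrow> 'a functional set \<Rightarrow> 'd set \<Rightarrow>
   ('d \<Rightarrow> 'd \<Rightarrow> bool) \<Rightarrow> ('d \<Rightarrow> ('a, 'a) ptensor functional functional) \<Rightarrow> bool" where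
  "spca_net A P D le m \<longleftrightarrow>
     (let S = sigma_wc_tensor A P; S' = dual_bimodule S; \<pi> = pi_sigma_wc A P in
       directed_preorder D le \<and> (\<forall>\<alpha>\<in>D. m \<alpha> \<in> carr S') \<and>
       (\<forall>a\<in>carr A.
          limitin (weak_star_topology S) (\<lambda>\<alpha>. lact S' a (m \<alpha>) - ract S' (m \<alpha>) a) 0
            (net_filter D le) \<and>
          (\<forall>\<alpha>\<in>D. mult A a (\<pi> (m \<alpha>)) = mult A (\<pi> (m \<alpha>)) a) \<and>
          limitin (sigma_topology (carr A) P) (\<lambda>\<alpha>. mult A a (\<pi> (m \<alpha>))) a (net_filter D le)))"

text \<open>Higher-order logic cannot quantify over the type of the index set.  The type chosen here is
  large enough for nets over all index types, see \<open>strong_pseudo_Connes_amenableI\<close> below.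
  The definition is meant for \<open>dual_banach_algebra A P\<close>, which is proved for the matrix algebras at
  the end of this theory.\<close>

definition strong_pseudo_Connes_amenable ::
  "('a::complex_vector, 'm) nalgebra_scheme \<Rightarrow> 'a functional set \<Rightarrow> bool" where
  "strong_pseudo_Connes_amenable A P \<longleftrightarrow>
     (\<exists>(D :: (('a, 'a) ptensor functional functional \<times>
              ('a, 'a) ptensor functional functional set) set) le m. spca_net A P D le m)"

lemma directed_preorderD:
  assumes "directed_preorder D le"
  shows "D \<noteq> {}"
    and "i \<in> D \<Longrightarrow> le i i"
    and "i \<in> D \<Longrightarrow> j \<in> D \<Longrightarrow> k \<in> D \<Longrightarrow> le i j \<Longrightarrow> le j k \<Longrightarrow> le i k"
    and "i \<in> D \<Longrightarrow> j \<in> D \<Longrightarrow> \<exists>k\<in>D. le i k \<and> le j k"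
  using assms unfolding directed_preorder_def by metis+

lemma eventually_net_filter:
  assumes "directed_preorder D le"
  shows "eventually Q (net_filter D le) \<longleftrightarrow> (\<exists>i\<in>D. \<forall>j\<in>D. le i j \<longrightarrow> Q j)"
proof -
  note dir = directed_preorderD[OF assms]
  have "\<exists>k\<in>D. principal {l \<in> D. le k l} \<le> inf (principal {l \<in> D. le i l}) (principal {l \<in> D. le j l})"
    if ij: "i \<in> D" "j \<in> D" for i j
  proof -
    obtain k where k: "k \<in> D" "le i k" "le j k" using dir(4)[OF ij] by blast
    have "{l \<in> D. le k l} \<subseteq> {l \<in> D. le i l} \<inter> {l \<in> D. le j l}"
      using dir(3)[OF ij(1) k(1) _ k(2)] dir(3)[OF ij(2) k(1) _ k(3)] by blast
    then show ?thesis using k(1) by (intro bexI[of _ k]) simp_all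
  qed
  then have "eventually Q (net_filter D le) \<longleftrightarrow>
      (\<exists>i\<in>D. eventually Q (principal {j \<in> D. le i j}))"
    unfolding net_filter_def by (rule eventually_INF_base[OF dir(1)])
  then show ?thesis unfolding eventually_principal by blast
qed

lemma limitin_filtermap_le:
  assumes "filtermap g F \<le> filtermap h G" and "limitin T (\<lambda>i. f (h i)) l G"
  shows "limitin T (\<lambda>j. f (g j)) l F"
  unfolding limitin_def
proof (intro conjI allI impI)
  show "l \<in> topspace T" using assms(2) by (simp add: limitin_def)
  fix U assume "openin T U \<and> l \<in> U"
  then have "eventually (\<lambda>x. f x \<in> U) (filtermap h G)"
    using assms(2) by (simp add: limitin_def eventually_filtermap)
  then have "eventually (\<lambda>x. f x \<in> U) (filtermap g F)"
    using assms(1) by (rule filter_leD[rotated])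
  then show "eventually (\<lambda>j. f (g j) \<in> U) F" by (simp add: eventually_filtermap)
qed

lemma strong_pseudo_Connes_amenableI:
  fixes D :: "'d set"
  assumes net: "spca_net A P D le m"
  shows "strong_pseudo_Connes_amenable A P"
proof -
  have dir: "directed_preorder D le" using net by (simp add: spca_net_def Let_def)
  note ne = directed_preorderD(1)[OF dir] and refl = directed_preorderD(2)[OF dir]
    and trans = directed_preorderD(3)[OF dir] and ub = directed_preorderD(4)[OF dir]
  define D' where "D' = {(x, S). x \<in> S \<and> S \<subseteq> m ` D \<and> (\<exists>i\<in>D. \<forall>j\<in>D. le i j \<longrightarrow> m j \<in> S)}"
  define le' :: "(('a, 'a) ptensor functional functional \<times>
     ('a, 'a) ptensor functional functional set) \<Rightarrow> (('a, 'a) ptensor functional functional \<times>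
     ('a, 'a) ptensor functional functional set) \<Rightarrow> bool"
    where "le' p q \<longleftrightarrow> snd q \<subseteq> snd p" for p q
  have dir': "directed_preorder D' le'"
    unfolding directed_preorder_def
  proof (intro conjI ballI impI)
    obtain i where "i \<in> D" using ne by blast
    then have "(m i, m ` D) \<in> D'" by (auto simp: D'_def)
    then show "D' \<noteq> {}" by blast
  next
    fix p q assume "p \<in> D'" "q \<in> D'"
    then obtain x S y T i j where p: "p = (x, S)" and q: "q = (y, T)" and S: "S \<subseteq> m ` D"
      and i: "i \<in> D" "\<And>k. k \<in> D \<Longrightarrow> le i k \<Longrightarrow> m k \<in> S"
      and j: "j \<in> D" "\<And>k. k \<in> D \<Longrightarrow> le j k \<Longrightarrow> m k \<in> T"
      by (auto simp: D'_def)
    obtain k where k: "k \<in> D" "le i k" "le j k" using ub i j by blast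
    have "m l \<in> S \<inter> T" if "l \<in> D" "le k l" for l
      using i(2)[OF that(1) trans[OF i(1) k(1) that(1) k(2) that(2)]]
        j(2)[OF that(1) trans[OF j(1) k(1) that(1) k(3) that(2)]] by blast
    then have "(m k, S \<inter> T) \<in> D'" using S k refl unfolding D'_def by blast
    then show "\<exists>r\<in>D'. le' p r \<and> le' q r" by (intro bexI[of _ "(m k, S \<inter> T)"]) (auto simp: le'_def p q)
  qed (auto simp: le'_def)
  have ev: "eventually (\<lambda>p. Q (fst p)) (net_filter D' le')"
    if evm: "eventually (\<lambda>i. Q (m i)) (net_filter D le)" for Q
  proof -
    obtain i where i: "i \<in> D" "\<And>j. j \<in> D \<Longrightarrow> le i j \<Longrightarrow> Q (m j)"
      using evm unfolding eventually_net_filter[OF dir] by blast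
    have "(m i, m ` {j \<in> D. le i j}) \<in> D'" using i(1) refl unfolding D'_def by blast
    moreover have "Q (fst q)" if "q \<in> D'" "le' (m i, m ` {j \<in> D. le i j}) q" for q
    proof -
      have "fst q \<in> m ` {j \<in> D. le i j}" using that unfolding D'_def le'_def by auto
      then show ?thesis using i(2) by auto
    qed
    ultimately show ?thesis unfolding eventually_net_filter[OF dir'] by blast
  qed
  have le: "filtermap fst (net_filter D' le') \<le> filtermap m (net_filter D le)"
    by (rule filter_leI) (simp add: eventually_filtermap ev)
  note lim = limitin_filtermap_le[OF le]
  have fst: "\<exists>i\<in>D. fst p = m i" if "p \<in> D'" for p
    using that unfolding D'_def by force
  have "spca_net A P D' le' fst"
    unfolding spca_net_def Let_def
  proof (intro conjI ballI)
    let ?S = "sigma_wc_tensor A P"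
    have m: "m i \<in> carr (dual_bimodule ?S)" if "i \<in> D" for i
      using net that by (simp add: spca_net_def Let_def)
    fix p assume "p \<in> D'"
    then show "fst p \<in> carr (dual_bimodule ?S)" using fst m by metis
  next
    fix a assume a: "a \<in> carr A"
    let ?S = "sigma_wc_tensor A P"
    show "limitin (weak_star_topology ?S) (\<lambda>p. lact (dual_bimodule ?S) a (fst p)
        - ract (dual_bimodule ?S) (fst p) a) 0 (net_filter D' le')"
      by (rule lim[where f = "\<lambda>x. lact (dual_bimodule ?S) a x - ract (dual_bimodule ?S) x a"])
        (use net a in \<open>simp add: spca_net_def Let_def\<close>)
    show "limitin (sigma_topology (carr A) P) (\<lambda>p. mult A a (pi_sigma_wc A P (fst p))) a
        (net_filter D' le')"
      by (rule lim[where f = "\<lambda>x. mult A a (pi_sigma_wc A P x)"])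
        (use net a in \<open>simp add: spca_net_def Let_def\<close>)
    fix p assume "p \<in> D'"
    then obtain i where "i \<in> D" "fst p = m i" using fst by blast
    then show "mult A a (pi_sigma_wc A P (fst p)) = mult A (pi_sigma_wc A P (fst p)) a"
      using net a by (simp add: spca_net_def Let_def)
  qed (rule dir')
  then show ?thesis unfolding strong_pseudo_Connes_amenable_def by (intro exI)
qed


section \<open>Matrix algebras\<close>

definition matrix_algebra :: "'i set \<Rightarrow> ('i \<Rightarrow> 'i \<Rightarrow> complex) nalgebra" where
  "matrix_algebra I =
     \<lparr>carr = {x. (\<forall>i j. i \<notin> I \<or> j \<notin> I \<longrightarrow> x i j = 0) \<and> (\<lambda>(i, j). cmod (x i j)) summable_on I \<times> I},
      nrm = (\<lambda>x. \<Sum>\<^sub>\<infinity>(i, j)\<in>I \<times> I. cmod (x i j)),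
      mult = (\<lambda>x y i j. \<Sum>\<^sub>\<infinity>k\<in>I. x i k * y k j)\<rparr>"

definition c0_matrices :: "'i set \<Rightarrow> ('i \<Rightarrow> 'i \<Rightarrow> complex) set" where
  "c0_matrices I = {f. (\<forall>i j. i \<notin> I \<or> j \<notin> I \<longrightarrow> f i j = 0) \<and>
     (\<forall>\<epsilon>>0. finite {(i, j). \<epsilon> \<le> cmod (f i j)})}"

definition matrix_pairing ::
  "'i set \<Rightarrow> ('i \<Rightarrow> 'i \<Rightarrow> complex) \<Rightarrow> ('i \<Rightarrow> 'i \<Rightarrow> complex) functional" where
  "matrix_pairing I f = (\<lambda>x. if x \<in> carr (matrix_algebra I)
     then \<Sum>\<^sub>\<infinity>(i, j)\<in>I \<times> I. x i j * f i j else 0)"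

definition matrix_predual :: "'i set \<Rightarrow> ('i \<Rightarrow> 'i \<Rightarrow> complex) functional set" where
  "matrix_predual I = matrix_pairing I ` c0_matrices I"


section \<open>Matrix algebras are dual Banach algebras\<close>

lemma carr_matrix_iff:
  "x \<in> carr (matrix_algebra I) \<longleftrightarrow> (\<forall>i j. i \<notin> I \<or> j \<notin> I \<longrightarrow> x i j = 0) \<and>
     (\<lambda>p. cmod (x (fst p) (snd p))) summable_on I \<times> I"
  by (simp add: matrix_algebra_def case_prod_unfold)

lemma nrm_matrix: "nrm (matrix_algebra I) x = (\<Sum>\<^sub>\<infinity>p\<in>I \<times> I. cmod (x (fst p) (snd p)))"
  by (simp add: matrix_algebra_def case_prod_unfold)

lemma matrix_bounded:
  assumes "\<And>i j. i \<notin> I \<or> j \<notin> I \<Longrightarrow> x i j = 0"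
    and "\<And>F. finite F \<Longrightarrow> F \<subseteq> I \<times> I \<Longrightarrow> (\<Sum>p\<in>F. cmod (x (fst p) (snd p))) \<le> K"
  shows "x \<in> carr (matrix_algebra I)" and "nrm (matrix_algebra I) x \<le> K"
proof -
  have s: "(\<lambda>p. cmod (x (fst p) (snd p))) summable_on I \<times> I"
  proof (rule nonneg_bdd_above_summable_on)
    show "bdd_above (sum (\<lambda>p. cmod (x (fst p) (snd p))) ` {F. F \<subseteq> I \<times> I \<and> finite F})"
      by (rule bdd_aboveI2[where M = K]) (simp add: assms(2))
  qed simp
  then show "x \<in> carr (matrix_algebra I)" using assms(1) by (simp add: carr_matrix_iff)
  show "nrm (matrix_algebra I) x \<le> K"
    unfolding nrm_matrix by (rule infsum_le_finite_sums[OF s assms(2)])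
qed

lemma matrix_sum_le:
  assumes "x \<in> carr (matrix_algebra I)" "finite F" "F \<subseteq> I \<times> I"
  shows "(\<Sum>p\<in>F. cmod (x (fst p) (snd p))) \<le> nrm (matrix_algebra I) x"
  using assms unfolding carr_matrix_iff nrm_matrix by (intro finite_sum_le_infsum) auto

lemma matrix_entry_le:
  assumes "x \<in> carr (matrix_algebra I)"
  shows "cmod (x i j) \<le> nrm (matrix_algebra I) x"
proof (cases "i \<in> I \<and> j \<in> I")
  case True
  then show ?thesis using matrix_sum_le[OF assms, of "{(i, j)}"] by simp
next
  case False
  then have "x i j = 0" using assms by (auto simp: carr_matrix_iff)
  then show ?thesis using matrix_sum_le[OF assms, of "{}"] by simp
qed

lemma matrix_add:
  assumes "x \<in> carr (matrix_algebra I)" "y \<in> carr (matrix_algebra I)"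
  shows "x + y \<in> carr (matrix_algebra I)"
    and "nrm (matrix_algebra I) (x + y) \<le> nrm (matrix_algebra I) x + nrm (matrix_algebra I) y"
proof -
  have bd: "(\<Sum>p\<in>F. cmod ((x + y) (fst p) (snd p))) \<le> nrm (matrix_algebra I) x + nrm (matrix_algebra I) y"
    if "finite F" "F \<subseteq> I \<times> I" for F
  proof -
    have "(\<Sum>p\<in>F. cmod ((x + y) (fst p) (snd p)))
        \<le> (\<Sum>p\<in>F. cmod (x (fst p) (snd p)) + cmod (y (fst p) (snd p)))"
      by (intro sum_mono) (simp add: norm_triangle_ineq)
    also have "\<dots> \<le> nrm (matrix_algebra I) x + nrm (matrix_algebra I) y"
      unfolding sum.distrib by (intro add_mono matrix_sum_le that assms)
    finally show ?thesis .
  qed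
  have z: "(x + y) i j = 0" if "i \<notin> I \<or> j \<notin> I" for i j
    using assms that by (auto simp: carr_matrix_iff)
  show "x + y \<in> carr (matrix_algebra I)"
    by (rule matrix_bounded(1)[OF z bd])
  show "nrm (matrix_algebra I) (x + y) \<le> nrm (matrix_algebra I) x + nrm (matrix_algebra I) y"
    by (rule matrix_bounded(2)[OF z bd])
qed

lemma matrix_scaleC:
  assumes "x \<in> carr (matrix_algebra I)"
  shows "c *\<^sub>C x \<in> carr (matrix_algebra I)"
    and "nrm (matrix_algebra I) (c *\<^sub>C x) = cmod c * nrm (matrix_algebra I) x"
  using assms
  by (simp_all add: carr_matrix_iff nrm_matrix scaleC_fun_def scaleC_complex_def norm_mult
      infsum_cmult_right' summable_on_cmult_right)

lemma matrix_diff: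
  assumes "x \<in> carr (matrix_algebra I)" "y \<in> carr (matrix_algebra I)"
  shows "x - y \<in> carr (matrix_algebra I)"
proof -
  have "x - y = x + (-1) *\<^sub>C y" by (simp add: fun_eq_iff scaleC_fun_def scaleC_complex_def)
  then show ?thesis using assms matrix_add matrix_scaleC by metis
qed

lemma matrix_cnormed_space: "cnormed_space (matrix_algebra I)"
proof
  show "csubspace (carr (matrix_algebra I))"
    by (auto simp: csubspace_def matrix_add matrix_scaleC) (simp add: carr_matrix_iff)
  fix x y :: "'a \<Rightarrow> 'a \<Rightarrow> complex" and c
  assume x: "x \<in> carr (matrix_algebra I)"
  show "0 \<le> nrm (matrix_algebra I) x" by (simp add: nrm_matrix infsum_nonneg)
  show "nrm (matrix_algebra I) x = 0 \<longleftrightarrow> x = 0"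
    using matrix_entry_le[OF x] by (auto simp: fun_eq_iff) (simp add: nrm_matrix)
  show "nrm (matrix_algebra I) (c *\<^sub>C x) = cmod c * nrm (matrix_algebra I) x"
    by (rule matrix_scaleC[OF x])
  assume "y \<in> carr (matrix_algebra I)"
  then show "nrm (matrix_algebra I) (x + y) \<le> nrm (matrix_algebra I) x + nrm (matrix_algebra I) y"
    by (rule matrix_add(2)[OF x])
qed

lemma (in cnormed_space) carr_diff: "x \<in> carr X \<Longrightarrow> y \<in> carr X \<Longrightarrow> x - y \<in> carr X"
  and nrm_minus_commute: "x \<in> carr X \<Longrightarrow> y \<in> carr X \<Longrightarrow> nrm X (x - y) = nrm X (y - x)"
proof -
  have neg: "(-1) *\<^sub>C z = - z" for z :: 'a
  proof -
    have "0 *\<^sub>C z = 0" using scaleC_add_left[of 0 0 z] by simp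
    then have "(-1) *\<^sub>C z + z = 0"
      using scaleC_add_left[of "-1" 1 z] by (simp add: scaleC_one)
    then show ?thesis by (simp add: eq_neg_iff_add_eq_0)
  qed
  show 1: "x - y \<in> carr X" if "x \<in> carr X" "y \<in> carr X" for x y
    using csubspace_carr that neg[of y] unfolding csubspace_def
    by (metis diff_conv_add_uminus)
  show "nrm X (x - y) = nrm X (y - x)" if "x \<in> carr X" "y \<in> carr X"
    using nrm_scaleC[OF 1[OF that], of "-1"] by (simp add: neg)
qed

lemma (in cnormed_space) Metric_space_ndist: "Metric_space (carr X) (ndist X)"
proof
  show "0 \<le> ndist X x y" for x y by (simp add: ndist_def nrm_nonneg carr_diff)
  show "ndist X x y = ndist X y x" for x y by (simp add: ndist_def nrm_minus_commute)
  show "ndist X x y = 0 \<longleftrightarrow> x = y" if "x \<in> carr X" "y \<in> carr X" for x y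
    using that by (simp add: ndist_def nrm_eq_0_iff carr_diff)
  show "ndist X x z \<le> ndist X x y + ndist X y z"
    if "x \<in> carr X" "y \<in> carr X" "z \<in> carr X" for x y z
    using that nrm_triangle[of "x - y" "y - z"] by (simp add: ndist_def carr_diff)
qed

lemma matrix_cbanach_space: "cbanach_space (matrix_algebra I)"
proof -
  interpret cnormed_space "matrix_algebra I" by (rule matrix_cnormed_space)
  interpret M: Metric_space "carr (matrix_algebra I)" "ndist (matrix_algebra I)"
    by (rule Metric_space_ndist)
  have "\<exists>x. limitin M.mtopology \<sigma> x sequentially" if "M.MCauchy \<sigma>" for \<sigma>
  proof -
    have \<sigma>: "\<sigma> n \<in> carr (matrix_algebra I)" for n using that by (auto simp: M.MCauchy_def)
    have C: "\<exists>N. \<forall>n\<ge>N. \<forall>n'\<ge>N. nrm (matrix_algebra I) (\<sigma> n - \<sigma> n') < e" if "e > 0" for e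
      using \<open>M.MCauchy \<sigma>\<close> that \<sigma> unfolding M.MCauchy_def ndist_def by fastforce
    have ent: "Cauchy (\<lambda>n. \<sigma> n i j)" for i j
    proof (rule CauchyI)
      fix e :: real assume "e > 0"
      then obtain N where "\<forall>n\<ge>N. \<forall>n'\<ge>N. nrm (matrix_algebra I) (\<sigma> n - \<sigma> n') < e" using C by blast
      then show "\<exists>N. \<forall>m\<ge>N. \<forall>n\<ge>N. cmod (\<sigma> m i j - \<sigma> n i j) < e"
        using matrix_entry_le[OF matrix_diff[OF \<sigma> \<sigma>]] by (metis fun_diff_def le_less_trans)
    qed
    define x where "x i j = lim (\<lambda>n. \<sigma> n i j)" for i j
    have x: "(\<lambda>n. \<sigma> n i j) \<longlonglongrightarrow> x i j" for i j
      using ent[of i j] by (simp add: x_def Cauchy_convergent_iff convergent_LIMSEQ_iff)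
    have key: "x - \<sigma> n \<in> carr (matrix_algebra I)" "nrm (matrix_algebra I) (x - \<sigma> n) \<le> e"
      if N: "\<forall>n\<ge>N. \<forall>n'\<ge>N. nrm (matrix_algebra I) (\<sigma> n - \<sigma> n') < e" "n \<ge> N" for n N e
    proof -
      have bd: "(\<Sum>p\<in>F. cmod ((x - \<sigma> n) (fst p) (snd p))) \<le> e" if F: "finite F" "F \<subseteq> I \<times> I" for F
      proof (rule LIMSEQ_le_const2)
        show "(\<lambda>k. \<Sum>p\<in>F. cmod (\<sigma> k (fst p) (snd p) - \<sigma> n (fst p) (snd p)))
            \<longlonglongrightarrow> (\<Sum>p\<in>F. cmod ((x - \<sigma> n) (fst p) (snd p)))"
          by (auto intro!: tendsto_intros x simp: fun_diff_def)
        have "(\<Sum>p\<in>F. cmod (\<sigma> k (fst p) (snd p) - \<sigma> n (fst p) (snd p))) \<le> e" if "k \<ge> N" for k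
        proof -
          have "nrm (matrix_algebra I) (\<sigma> k - \<sigma> n) < e" using N that by blast
          then show ?thesis
            using matrix_sum_le[OF matrix_diff[OF \<sigma> \<sigma>] F, of k n] by simp
        qed
        then show "\<exists>N. \<forall>k\<ge>N. (\<Sum>p\<in>F. cmod (\<sigma> k (fst p) (snd p) - \<sigma> n (fst p) (snd p))) \<le> e"
          by blast
      qed
      have z: "(x - \<sigma> n) i j = 0" if "i \<notin> I \<or> j \<notin> I" for i j
      proof -
        have "\<sigma> k i j = 0" for k using \<sigma>[of k] that by (auto simp: carr_matrix_iff)
        then show ?thesis by (simp add: x_def)
      qed
      show "x - \<sigma> n \<in> carr (matrix_algebra I)" by (rule matrix_bounded(1)[OF z bd])
      show "nrm (matrix_algebra I) (x - \<sigma> n) \<le> e" by (rule matrix_bounded(2)[OF z bd])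
    qed
    obtain N where "\<forall>n\<ge>N. \<forall>n'\<ge>N. nrm (matrix_algebra I) (\<sigma> n - \<sigma> n') < 1" using C[of 1] by auto
    then have "(x - \<sigma> N) + \<sigma> N \<in> carr (matrix_algebra I)"
      by (intro matrix_add \<sigma> key(1)[of N 1]) auto
    then have xc: "x \<in> carr (matrix_algebra I)" by simp
    have "\<forall>\<^sub>F n in sequentially. ndist (matrix_algebra I) (\<sigma> n) x < e" if e: "e > 0" for e
    proof -
      obtain N where N: "\<forall>n\<ge>N. \<forall>n'\<ge>N. nrm (matrix_algebra I) (\<sigma> n - \<sigma> n') < e / 2"
        using C[OF half_gt_zero[OF e]] by blast
      show ?thesis
        using key(2)[OF N] \<sigma> xc e nrm_minus_commute[OF xc \<sigma>]
        by (intro eventually_sequentiallyI[of N]) (force simp: ndist_def)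
    qed
    then have "limitin M.mtopology \<sigma> x sequentially"
      using \<sigma> xc by (simp add: M.limitin_metric)
    then show ?thesis by blast
  qed
  then show ?thesis by unfold_locales (simp add: M.mcomplete_def)
qed

lemma matrix_mult: "mult (matrix_algebra I) x y i j = (\<Sum>\<^sub>\<infinity>k\<in>I. x i k * y k j)"
  by (simp add: matrix_algebra_def)

lemma matrix_triple:
  assumes x: "x \<in> carr (matrix_algebra I)" and y: "y \<in> carr (matrix_algebra I)"
  defines "t \<equiv> \<lambda>q. x (fst (fst q)) (snd q) * y (snd q) (snd (fst q))"
  shows "(\<lambda>q. cmod (t q)) summable_on (I \<times> I) \<times> I"
    and "(\<Sum>\<^sub>\<infinity>q\<in>(I \<times> I) \<times> I. cmod (t q)) \<le> nrm (matrix_algebra I) x * nrm (matrix_algebra I) y"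
proof -
  define f where "f p = cmod (x (fst p) (snd p))" for p
  define g where "g p = cmod (y (fst p) (snd p))" for p
  define fg where "fg q = f (fst q) * g (snd q)" for q
  have f: "f summable_on I \<times> I" and g: "g summable_on I \<times> I"
    using x y unfolding f_def g_def carr_matrix_iff by blast+
  have fg0: "0 \<le> fg q" for q by (simp add: fg_def f_def g_def)
  have "(\<lambda>q. norm (fg q)) summable_on (I \<times> I) \<times> (I \<times> I)"
  proof (subst Infinite_Sum.abs_summable_on_Sigma_iff, intro conjI ballI)
    fix p
    show "(\<lambda>q. norm (fg (p, q))) summable_on I \<times> I"
      using summable_on_cmult_right[OF g, of "f p"] by (simp add: fg_def abs_mult f_def g_def)
    show "(\<lambda>p. norm (\<Sum>\<^sub>\<infinity>q\<in>I \<times> I. norm (fg (p, q)))) summable_on I \<times> I"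
      using fg0 summable_on_cmult_left[OF f, of "\<bar>infsum g (I \<times> I)\<bar>"]
      by (simp add: fg_def infsum_cmult_right' abs_mult f_def g_def[abs_def])
  qed
  then have s: "fg summable_on (I \<times> I) \<times> (I \<times> I)" using fg0 by simp
  have "infsum fg ((I \<times> I) \<times> (I \<times> I)) = (\<Sum>\<^sub>\<infinity>p\<in>I \<times> I. \<Sum>\<^sub>\<infinity>q\<in>I \<times> I. fg (p, q))"
    by (rule infsum_Sigma_banach[OF s, symmetric])
  also have "\<dots> = infsum f (I \<times> I) * infsum g (I \<times> I)"
    by (simp add: fg_def infsum_cmult_right' infsum_cmult_left')
  finally have eq: "infsum fg ((I \<times> I) \<times> (I \<times> I))
      = nrm (matrix_algebra I) x * nrm (matrix_algebra I) y"
    by (simp add: nrm_matrix f_def[abs_def] g_def[abs_def])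
  define h where "h q = ((fst (fst q), snd q), (snd q, snd (fst q)))" for q :: "('a \<times> 'a) \<times> 'a"
  have inj: "inj_on h ((I \<times> I) \<times> I)" by (auto simp: inj_on_def h_def)
  have sub: "h ` ((I \<times> I) \<times> I) \<subseteq> (I \<times> I) \<times> (I \<times> I)" by (auto simp: h_def)
  have s': "fg summable_on h ` ((I \<times> I) \<times> I)" by (rule summable_on_subset_banach[OF s sub])
  have t: "(\<lambda>q. cmod (t q)) = fg \<circ> h"
    by (auto simp: fun_eq_iff t_def fg_def f_def g_def h_def norm_mult)
  show "(\<lambda>q. cmod (t q)) summable_on (I \<times> I) \<times> I"
    unfolding t using s' summable_on_reindex[OF inj, of fg] by simp
  show "(\<Sum>\<^sub>\<infinity>q\<in>(I \<times> I) \<times> I. cmod (t q)) \<le> nrm (matrix_algebra I) x * nrm (matrix_algebra I) y"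
    unfolding t infsum_reindex[OF inj, symmetric] eq[symmetric]
    by (rule infsum_mono2[OF s' s sub]) (rule fg0)
qed

lemma matrix_row_col:
  assumes "x \<in> carr (matrix_algebra I)" "y \<in> carr (matrix_algebra I)"
  shows "(\<lambda>k. cmod (x i k * y k j)) summable_on I"
proof (cases "i \<in> I \<and> j \<in> I")
  case True
  have "\<forall>p\<in>I \<times> I. (\<lambda>k. cmod (x (fst p) k * y k (snd p))) summable_on I"
    using matrix_triple(1)[OF assms] unfolding Infinite_Sum.abs_summable_on_Sigma_iff by simp
  then show ?thesis using True by force
next
  case False
  then have "x i k * y k j = 0" for k using assms by (auto simp: carr_matrix_iff)
  then have "(\<lambda>k. cmod (x i k * y k j)) = (\<lambda>k. 0)" by (simp only: norm_zero)
  then show ?thesis by simp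
qed

lemma matrix_mult_closed:
  assumes x: "x \<in> carr (matrix_algebra I)" and y: "y \<in> carr (matrix_algebra I)"
  shows "mult (matrix_algebra I) x y \<in> carr (matrix_algebra I)"
    and "nrm (matrix_algebra I) (mult (matrix_algebra I) x y)
      \<le> nrm (matrix_algebra I) x * nrm (matrix_algebra I) y"
proof -
  let ?z = "mult (matrix_algebra I) x y"
  define N where "N p = (\<Sum>\<^sub>\<infinity>k\<in>I. cmod (x (fst p) k * y k (snd p)))" for p
  have le: "cmod (?z (fst p) (snd p)) \<le> N p" for p
    unfolding matrix_mult N_def by (rule norm_infsum_bound[OF matrix_row_col[OF x y]])
  have N0: "0 \<le> N p" for p unfolding N_def by (intro infsum_nonneg) simp
  have "(\<lambda>p. norm (N p)) summable_on I \<times> I"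
    using matrix_triple(1)[OF x y] unfolding Infinite_Sum.abs_summable_on_Sigma_iff N_def by simp
  then have N: "N summable_on I \<times> I" using N0 by simp
  have s: "(\<lambda>p. cmod (?z (fst p) (snd p))) summable_on I \<times> I"
    by (rule Infinite_Sum.abs_summable_on_comparison_test'[OF N le])
  have "?z i j = 0" if "i \<notin> I \<or> j \<notin> I" for i j
  proof -
    have "x i k * y k j = 0" for k using x y that by (auto simp: carr_matrix_iff)
    then show ?thesis unfolding matrix_mult by (simp only: infsum_0_simp)
  qed
  with s show "?z \<in> carr (matrix_algebra I)" unfolding carr_matrix_iff by blast
  have "nrm (matrix_algebra I) ?z \<le> infsum N (I \<times> I)"
    unfolding nrm_matrix by (rule infsum_mono[OF s N le])
  also have "\<dots> = (\<Sum>\<^sub>\<infinity>q\<in>(I \<times> I) \<times> I.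
      cmod (x (fst (fst q)) (snd q) * y (snd q) (snd (fst q))))"
    unfolding N_def by (subst infsum_Sigma_banach[OF matrix_triple(1)[OF x y], symmetric]) simp
  also have "\<dots> \<le> nrm (matrix_algebra I) x * nrm (matrix_algebra I) y"
    by (rule matrix_triple(2)[OF x y])
  finally show "nrm (matrix_algebra I) ?z \<le> nrm (matrix_algebra I) x * nrm (matrix_algebra I) y" .
qed

lemma matrix_assoc:
  assumes x: "x \<in> carr (matrix_algebra I)" and y: "y \<in> carr (matrix_algebra I)"
    and z: "z \<in> carr (matrix_algebra I)"
  shows "mult (matrix_algebra I) (mult (matrix_algebra I) x y) z
    = mult (matrix_algebra I) x (mult (matrix_algebra I) y z)"
proof (intro ext)
  fix i l
  define w where "w k j = x i k * y k j * z j l" for k j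
  let ?C = "nrm (matrix_algebra I) x * nrm (matrix_algebra I) z"
  have b: "cmod (w (fst p) (snd p)) \<le> ?C * cmod (y (fst p) (snd p))" for p
  proof -
    have "cmod (x i (fst p)) * cmod (z (snd p) l) \<le> ?C"
      by (intro mult_mono matrix_entry_le x z norm_ge_zero order_trans[OF norm_ge_zero matrix_entry_le[OF x]])
    from mult_right_mono[OF this norm_ge_zero[of "y (fst p) (snd p)"]]
    show ?thesis by (simp add: w_def norm_mult mult_ac)
  qed
  have "(\<lambda>p. ?C * cmod (y (fst p) (snd p))) summable_on I \<times> I"
    using y by (intro summable_on_cmult_right) (simp add: carr_matrix_iff)
  then have "(\<lambda>p. cmod (w (fst p) (snd p))) summable_on I \<times> I"
    by (rule Infinite_Sum.abs_summable_on_comparison_test'[OF _ b])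
  then have s: "(\<lambda>(k, j). w k j) summable_on I \<times> I"
    unfolding case_prod_unfold by (rule abs_summable_summable)
  have "mult (matrix_algebra I) (mult (matrix_algebra I) x y) z i l = (\<Sum>\<^sub>\<infinity>j\<in>I. \<Sum>\<^sub>\<infinity>k\<in>I. w k j)"
    by (simp add: matrix_mult w_def infsum_cmult_left')
  also have "\<dots> = (\<Sum>\<^sub>\<infinity>k\<in>I. \<Sum>\<^sub>\<infinity>j\<in>I. w k j)"
    by (rule infsum_swap_banach[OF s, symmetric])
  also have "\<dots> = mult (matrix_algebra I) x (mult (matrix_algebra I) y z) i l"
    by (simp add: matrix_mult w_def infsum_cmult_right' mult.assoc)
  finally show "mult (matrix_algebra I) (mult (matrix_algebra I) x y) z i l
    = mult (matrix_algebra I) x (mult (matrix_algebra I) y z) i l" .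
qed

lemma matrix_cbanach_algebra: "cbanach_algebra (matrix_algebra I)"
proof -
  interpret cbanach_space "matrix_algebra I" by (rule matrix_cbanach_space)
  note rc = abs_summable_summable[OF matrix_row_col]
  show ?thesis
  proof
    fix a b c :: "'a \<Rightarrow> 'a \<Rightarrow> complex" and z
    assume a: "a \<in> carr (matrix_algebra I)" and b: "b \<in> carr (matrix_algebra I)"
    show "mult (matrix_algebra I) a b \<in> carr (matrix_algebra I)"
      "nrm (matrix_algebra I) (mult (matrix_algebra I) a b)
        \<le> nrm (matrix_algebra I) a * nrm (matrix_algebra I) b"
      by (rule matrix_mult_closed[OF a b])+
    show "mult (matrix_algebra I) (z *\<^sub>C a) b = z *\<^sub>C mult (matrix_algebra I) a b"
      by (simp add: fun_eq_iff matrix_mult scaleC_fun_def scaleC_complex_def mult.assoc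
          infsum_cmult_right')
    show "mult (matrix_algebra I) a (z *\<^sub>C b) = z *\<^sub>C mult (matrix_algebra I) a b"
      by (simp add: fun_eq_iff matrix_mult scaleC_fun_def scaleC_complex_def mult.left_commute
          infsum_cmult_right')
    assume c: "c \<in> carr (matrix_algebra I)"
    show "mult (matrix_algebra I) (mult (matrix_algebra I) a b) c
        = mult (matrix_algebra I) a (mult (matrix_algebra I) b c)"
      by (rule matrix_assoc[OF a b c])
    show "mult (matrix_algebra I) (a + b) c
        = mult (matrix_algebra I) a c + mult (matrix_algebra I) b c"
      by (simp add: fun_eq_iff matrix_mult distrib_right infsum_add[OF rc[OF a c] rc[OF b c]])
    show "mult (matrix_algebra I) a (b + c)
        = mult (matrix_algebra I) a b + mult (matrix_algebra I) a c"
      by (simp add: fun_eq_iff matrix_mult distrib_left infsum_add[OF rc[OF a b] rc[OF a c]])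
  qed
qed

lemma dual_iff:
  "\<phi> \<in> carr (dual X) \<longleftrightarrow>
     (\<forall>x. x \<notin> carr X \<longrightarrow> \<phi> x = 0) \<and>
     (\<forall>x\<in>carr X. \<forall>y\<in>carr X. \<phi> (x + y) = \<phi> x + \<phi> y) \<and>
     (\<forall>c. \<forall>x\<in>carr X. \<phi> (c *\<^sub>C x) = c * \<phi> x) \<and>
     (\<exists>K. \<forall>x\<in>carr X. cmod (\<phi> x) \<le> K * nrm X x)"
  by (simp add: dual_def bounded_linear_maps_def complex_nspace_def scaleC_complex_def)

lemma nrm_dual: "nrm (dual X) \<phi> = (SUP x\<in>{x \<in> carr X. nrm X x \<le> 1}. cmod (\<phi> x))"
  by (simp add: dual_def)

context cnormed_space
begin

lemma zero_carr: "0 \<in> carr X" and nrm_0: "nrm X 0 = 0"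
  using csubspace_carr nrm_eq_0_iff by (auto simp: csubspace_def)

lemma dual_apply_le:
  assumes \<phi>: "\<phi> \<in> carr (dual X)" and x: "x \<in> carr X"
  shows "cmod (\<phi> x) \<le> nrm (dual X) \<phi> * nrm X x"
proof (cases "nrm X x = 0")
  case True
  then show ?thesis using \<phi> x unfolding dual_iff by force
next
  case False
  then have pos: "nrm X x > 0" using nrm_nonneg[OF x] by simp
  obtain K where K: "\<And>x. x \<in> carr X \<Longrightarrow> cmod (\<phi> x) \<le> K * nrm X x"
    using \<phi> unfolding dual_iff by blast
  have bdd: "bdd_above ((\<lambda>x. cmod (\<phi> x)) ` {x \<in> carr X. nrm X x \<le> 1})"
  proof (rule bdd_aboveI2)
    fix y assume "y \<in> {x \<in> carr X. nrm X x \<le> 1}"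
    then have y: "y \<in> carr X" "nrm X y \<le> 1" by auto
    have "cmod (\<phi> y) \<le> K * nrm X y" by (rule K[OF y(1)])
    also have "\<dots> \<le> \<bar>K\<bar> * 1"
      using y nrm_nonneg by (intro mult_mono) auto
    finally show "cmod (\<phi> y) \<le> \<bar>K\<bar>" by simp
  qed
  define c where "c = complex_of_real (1 / nrm X x)"
  have cx: "c *\<^sub>C x \<in> carr X" using csubspace_carr x by (simp add: csubspace_def)
  have c: "cmod c = 1 / nrm X x" using pos by (simp add: c_def norm_divide)
  have "nrm X (c *\<^sub>C x) = 1" using pos by (simp add: nrm_scaleC[OF x] c_def norm_divide)
  then have "cmod (\<phi> (c *\<^sub>C x)) \<le> nrm (dual X) \<phi>"
    unfolding nrm_dual using cx by (intro cSUP_upper[OF _ bdd]) auto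
  moreover have "\<phi> (c *\<^sub>C x) = c * \<phi> x" using \<phi> x unfolding dual_iff by blast
  ultimately have "cmod (\<phi> x) / nrm X x \<le> nrm (dual X) \<phi>" by (simp add: c norm_mult)
  then show ?thesis using pos by (simp add: pos_divide_le_eq)
qed

lemma dual_nrm_le:
  assumes "0 \<le> K" and "\<And>x. x \<in> carr X \<Longrightarrow> cmod (\<phi> x) \<le> K * nrm X x"
  shows "nrm (dual X) \<phi> \<le> K"
  unfolding nrm_dual
proof (rule cSUP_least)
  show "{x \<in> carr X. nrm X x \<le> 1} \<noteq> {}" using zero_carr nrm_0 by force
  fix x assume "x \<in> {x \<in> carr X. nrm X x \<le> 1}"
  then show "cmod (\<phi> x) \<le> K"
    using assms(2)[of x] mult_left_mono[of "nrm X x" 1 K] assms(1) by auto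
qed

lemma dual_nrm_nonneg:
  assumes "\<phi> \<in> carr (dual X)"
  shows "0 \<le> nrm (dual X) \<phi>"
proof -
  obtain K where K: "\<And>x. x \<in> carr X \<Longrightarrow> cmod (\<phi> x) \<le> K * nrm X x"
    using assms unfolding dual_iff by blast
  have bdd: "bdd_above ((\<lambda>x. cmod (\<phi> x)) ` {x \<in> carr X. nrm X x \<le> 1})"
  proof (rule bdd_aboveI2)
    fix y assume "y \<in> {x \<in> carr X. nrm X x \<le> 1}"
    then have y: "y \<in> carr X" "nrm X y \<le> 1" by auto
    have "cmod (\<phi> y) \<le> K * nrm X y" by (rule K[OF y(1)])
    also have "\<dots> \<le> \<bar>K\<bar> * 1"
      using y nrm_nonneg by (intro mult_mono) auto
    finally show "cmod (\<phi> y) \<le> \<bar>K\<bar>" by simp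
  qed
  have "cmod (\<phi> 0) \<le> nrm (dual X) \<phi>"
    unfolding nrm_dual using zero_carr nrm_0 by (intro cSUP_upper[OF _ bdd]) auto
  then show ?thesis using norm_ge_zero order_trans by blast
qed

lemma dual_add:
  assumes \<phi>: "\<phi> \<in> carr (dual X)" and \<psi>: "\<psi> \<in> carr (dual X)"
  shows "\<phi> + \<psi> \<in> carr (dual X)" and "nrm (dual X) (\<phi> + \<psi>) \<le> nrm (dual X) \<phi> + nrm (dual X) \<psi>"
proof -
  have b: "cmod ((\<phi> + \<psi>) x) \<le> (nrm (dual X) \<phi> + nrm (dual X) \<psi>) * nrm X x" if "x \<in> carr X" for x
    using norm_triangle_ineq[of "\<phi> x" "\<psi> x"] dual_apply_le[OF \<phi> that] dual_apply_le[OF \<psi> that]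
    by (simp add: distrib_right)
  then show "nrm (dual X) (\<phi> + \<psi>) \<le> nrm (dual X) \<phi> + nrm (dual X) \<psi>"
    using dual_nrm_nonneg[OF \<phi>] dual_nrm_nonneg[OF \<psi>] by (intro dual_nrm_le) auto
  show "\<phi> + \<psi> \<in> carr (dual X)"
    unfolding dual_iff
  proof (intro conjI)
    show "\<exists>K. \<forall>x\<in>carr X. cmod ((\<phi> + \<psi>) x) \<le> K * nrm X x" using b by blast
  qed (use \<phi> \<psi> in \<open>simp_all add: dual_iff distrib_left\<close>)
qed

lemma dual_scaleC:
  assumes \<phi>: "\<phi> \<in> carr (dual X)"
  shows "c *\<^sub>C \<phi> \<in> carr (dual X)" and "nrm (dual X) (c *\<^sub>C \<phi>) \<le> cmod c * nrm (dual X) \<phi>"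
proof -
  have b: "cmod ((c *\<^sub>C \<phi>) x) \<le> (cmod c * nrm (dual X) \<phi>) * nrm X x" if "x \<in> carr X" for x
    using mult_left_mono[OF dual_apply_le[OF \<phi> that] norm_ge_zero[of c]]
    by (simp add: scaleC_fun_def scaleC_complex_def norm_mult mult.assoc)
  then show "nrm (dual X) (c *\<^sub>C \<phi>) \<le> cmod c * nrm (dual X) \<phi>"
    using dual_nrm_nonneg[OF \<phi>] by (intro dual_nrm_le) auto
  show "c *\<^sub>C \<phi> \<in> carr (dual X)"
    unfolding dual_iff
  proof (intro conjI)
    show "\<exists>K. \<forall>x\<in>carr X. cmod ((c *\<^sub>C \<phi>) x) \<le> K * nrm X x" using b by blast
  qed (use \<phi> in \<open>simp_all add: dual_iff scaleC_fun_def scaleC_complex_def algebra_simps\<close>)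
qed

lemma dual_cnormed_space: "cnormed_space (dual X)"
proof
  have "0 \<in> carr (dual X)" unfolding dual_iff by (auto intro!: exI[of _ 0])
  then show "csubspace (carr (dual X))" by (simp add: csubspace_def dual_add dual_scaleC)
  fix \<phi> \<psi> c assume \<phi>: "\<phi> \<in> carr (dual X)"
  show "0 \<le> nrm (dual X) \<phi>" by (rule dual_nrm_nonneg[OF \<phi>])
  show "nrm (dual X) \<phi> = 0 \<longleftrightarrow> \<phi> = 0"
  proof
    assume 0: "nrm (dual X) \<phi> = 0"
    have "\<phi> x = 0" for x
    proof (cases "x \<in> carr X")
      case True
      then show ?thesis using dual_apply_le[OF \<phi> True] 0 by simp
    next
      case False
      then show ?thesis using \<phi> unfolding dual_iff by blast
    qed
    then show "\<phi> = 0" by (simp add: fun_eq_iff)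
  next
    assume "\<phi> = 0"
    then have "nrm (dual X) \<phi> \<le> 0" by (intro dual_nrm_le) auto
    then show "nrm (dual X) \<phi> = 0" using dual_nrm_nonneg[OF \<phi>] by simp
  qed
  show "nrm (dual X) (c *\<^sub>C \<phi>) = cmod c * nrm (dual X) \<phi>"
  proof (rule antisym[OF dual_scaleC(2)[OF \<phi>]])
    show "cmod c * nrm (dual X) \<phi> \<le> nrm (dual X) (c *\<^sub>C \<phi>)"
    proof (cases "c = 0")
      case True
      then show ?thesis using dual_nrm_nonneg[OF dual_scaleC(1)[OF \<phi>, of c]] by simp
    next
      case False
      then have "nrm (dual X) \<phi> \<le> cmod (1 / c) * nrm (dual X) (c *\<^sub>C \<phi>)"
        using dual_scaleC(2)[OF dual_scaleC(1)[OF \<phi>, of c], of "1 / c"]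
        by (simp add: scaleC_scaleC scaleC_one)
      then show ?thesis using False by (simp add: norm_divide field_simps)
    qed
  qed
  assume "\<psi> \<in> carr (dual X)"
  then show "nrm (dual X) (\<phi> + \<psi>) \<le> nrm (dual X) \<phi> + nrm (dual X) \<psi>" by (rule dual_add(2)[OF \<phi>])
qed

end

lemma c0_bounded:
  assumes "f \<in> c0_matrices I"
  obtains M where "0 \<le> M" "\<And>i j. cmod (f i j) \<le> M"
proof -
  have fin: "finite {(i, j). 1 \<le> cmod (f i j)}"
    using assms unfolding c0_matrices_def by (auto dest!: spec[of _ "1::real"])
  let ?S = "insert 1 ((\<lambda>(i, j). cmod (f i j)) ` {(i, j). 1 \<le> cmod (f i j)})"
  have "finite ?S" using fin by simp
  then have M: "s \<le> Max ?S" if "s \<in> ?S" for s using that by (rule Max_ge)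
  have "cmod (f i j) \<le> Max ?S" for i j
  proof (cases "1 \<le> cmod (f i j)")
    case True
    then have "(\<lambda>(i, j). cmod (f i j)) (i, j) \<in> ?S" by (intro insertI2 imageI) simp
    then show ?thesis using M by simp
  next
    case False
    then show ?thesis using M[of 1] by simp
  qed
  moreover have "0 \<le> Max ?S" using M[of 1] by simp
  ultimately show ?thesis by (rule that[rotated])
qed

lemma matrix_bounded_summable:
  assumes x: "x \<in> carr (matrix_algebra I)" and M: "\<And>i j. cmod (f i j) \<le> M"
  shows "(\<lambda>p. cmod (x (fst p) (snd p) * f (fst p) (snd p))) summable_on I \<times> I"
    and "(\<lambda>p. x (fst p) (snd p) * f (fst p) (snd p)) summable_on I \<times> I"
    and "cmod (\<Sum>\<^sub>\<infinity>p\<in>I \<times> I. x (fst p) (snd p) * f (fst p) (snd p)) \<le> M * nrm (matrix_algebra I) x"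
proof -
  have s: "(\<lambda>p. M * cmod (x (fst p) (snd p))) summable_on I \<times> I"
    using x by (intro summable_on_cmult_right) (simp add: carr_matrix_iff)
  have le: "cmod (x (fst p) (snd p) * f (fst p) (snd p)) \<le> M * cmod (x (fst p) (snd p))" for p
    using mult_right_mono[OF M norm_ge_zero, of "fst p" "snd p" "x (fst p) (snd p)"]
    by (simp add: norm_mult mult.commute)
  show 1: "(\<lambda>p. cmod (x (fst p) (snd p) * f (fst p) (snd p))) summable_on I \<times> I"
    by (rule Infinite_Sum.abs_summable_on_comparison_test'[OF s le])
  show "(\<lambda>p. x (fst p) (snd p) * f (fst p) (snd p)) summable_on I \<times> I"
    by (rule abs_summable_summable[OF 1])
  have "cmod (\<Sum>\<^sub>\<infinity>p\<in>I \<times> I. x (fst p) (snd p) * f (fst p) (snd p))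
      \<le> (\<Sum>\<^sub>\<infinity>p\<in>I \<times> I. cmod (x (fst p) (snd p) * f (fst p) (snd p)))"
    by (rule norm_infsum_bound[OF 1])
  also have "\<dots> \<le> (\<Sum>\<^sub>\<infinity>p\<in>I \<times> I. M * cmod (x (fst p) (snd p)))"
    by (rule infsum_mono[OF 1 s le])
  finally show "cmod (\<Sum>\<^sub>\<infinity>p\<in>I \<times> I. x (fst p) (snd p) * f (fst p) (snd p))
      \<le> M * nrm (matrix_algebra I) x"
    by (simp add: nrm_matrix infsum_cmult_right')
qed

lemma matrix_pairing_apply:
  "x \<in> carr (matrix_algebra I) \<Longrightarrow>
     matrix_pairing I f x = (\<Sum>\<^sub>\<infinity>p\<in>I \<times> I. x (fst p) (snd p) * f (fst p) (snd p))"
  by (simp add: matrix_pairing_def case_prod_unfold)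

lemma matrix_pairing_dual:
  assumes M: "0 \<le> M" "\<And>i j. cmod (f i j) \<le> M"
  shows "matrix_pairing I f \<in> carr (dual (matrix_algebra I))"
    and "nrm (dual (matrix_algebra I)) (matrix_pairing I f) \<le> M"
proof -
  interpret cnormed_space "matrix_algebra I" by (rule matrix_cnormed_space)
  have b: "cmod (matrix_pairing I f x) \<le> M * nrm (matrix_algebra I) x"
    if "x \<in> carr (matrix_algebra I)" for x
    using matrix_bounded_summable(3)[OF that M(2)] by (simp add: matrix_pairing_apply that)
  then show "nrm (dual (matrix_algebra I)) (matrix_pairing I f) \<le> M" by (intro dual_nrm_le M)
  show "matrix_pairing I f \<in> carr (dual (matrix_algebra I))"
    unfolding dual_iff
  proof (intro conjI)
    show "\<forall>x. x \<notin> carr (matrix_algebra I) \<longrightarrow> matrix_pairing I f x = 0"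
      by (simp add: matrix_pairing_def)
    show "\<exists>K. \<forall>x\<in>carr (matrix_algebra I). cmod (matrix_pairing I f x) \<le> K * nrm (matrix_algebra I) x"
      using b by blast
    show "\<forall>x\<in>carr (matrix_algebra I). \<forall>y\<in>carr (matrix_algebra I).
        matrix_pairing I f (x + y) = matrix_pairing I f x + matrix_pairing I f y"
    proof (intro ballI)
      fix x y assume xy: "x \<in> carr (matrix_algebra I)" "y \<in> carr (matrix_algebra I)"
      show "matrix_pairing I f (x + y) = matrix_pairing I f x + matrix_pairing I f y"
        using infsum_add[OF matrix_bounded_summable(2)[OF xy(1) M(2)]
            matrix_bounded_summable(2)[OF xy(2) M(2)]]
        by (simp add: matrix_pairing_apply matrix_add xy distrib_right)
    qed
    show "\<forall>c. \<forall>x\<in>carr (matrix_algebra I).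
        matrix_pairing I f (c *\<^sub>C x) = c * matrix_pairing I f x"
    proof (intro allI ballI)
      fix c x assume x: "x \<in> carr (matrix_algebra I)"
      show "matrix_pairing I f (c *\<^sub>C x) = c * matrix_pairing I f x"
        unfolding matrix_pairing_apply[OF x] matrix_pairing_apply[OF matrix_scaleC(1)[OF x]]
        by (simp add: scaleC_fun_def scaleC_complex_def mult.assoc infsum_cmult_right')
    qed
  qed
qed

lemma matrix_pairing_add:
  assumes f: "f \<in> c0_matrices I" and g: "g \<in> c0_matrices I"
  shows "matrix_pairing I (f + g) = matrix_pairing I f + matrix_pairing I g"
proof
  fix x
  obtain M N where M: "\<And>i j. cmod (f i j) \<le> M" and N: "\<And>i j. cmod (g i j) \<le> N"
    using c0_bounded[OF f] c0_bounded[OF g] by metis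
  show "matrix_pairing I (f + g) x = (matrix_pairing I f + matrix_pairing I g) x"
  proof (cases "x \<in> carr (matrix_algebra I)")
    case True
    then show ?thesis
      using infsum_add[OF matrix_bounded_summable(2)[OF True M]
          matrix_bounded_summable(2)[OF True N]]
      by (simp add: matrix_pairing_apply distrib_left)
  qed (simp add: matrix_pairing_def)
qed

lemma matrix_pairing_scaleC: "matrix_pairing I (c *\<^sub>C f) = c *\<^sub>C matrix_pairing I f"
  by (simp add: fun_eq_iff matrix_pairing_def scaleC_fun_def scaleC_complex_def
      case_prod_unfold mult.left_commute infsum_cmult_right')

lemma c0_add:
  assumes "f \<in> c0_matrices I" "g \<in> c0_matrices I"
  shows "f + g \<in> c0_matrices I"
  unfolding c0_matrices_def mem_Collect_eq
proof (intro conjI allI impI)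
  show "(f + g) i j = 0" if "i \<notin> I \<or> j \<notin> I" for i j using assms that by (auto simp: c0_matrices_def)
  fix \<epsilon> :: real assume "\<epsilon> > 0"
  have le: "\<epsilon> / 2 \<le> cmod (f i j) \<or> \<epsilon> / 2 \<le> cmod (g i j)" if "\<epsilon> \<le> cmod ((f + g) i j)" for i j
    using that norm_triangle_ineq[of "f i j" "g i j"] by auto
  have "finite ({(i, j). \<epsilon> / 2 \<le> cmod (f i j)} \<union> {(i, j). \<epsilon> / 2 \<le> cmod (g i j)})"
    using assms \<open>\<epsilon> > 0\<close> unfolding c0_matrices_def by (auto dest!: spec[of _ "\<epsilon> / 2"])
  then show "finite {(i, j). \<epsilon> \<le> cmod ((f + g) i j)}"
    by (rule finite_subset[rotated]) (use le in blast)
qed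

lemma c0_scaleC:
  assumes "f \<in> c0_matrices I"
  shows "c *\<^sub>C f \<in> c0_matrices I"
  unfolding c0_matrices_def mem_Collect_eq
proof (intro conjI allI impI)
  show "(c *\<^sub>C f) i j = 0" if "i \<notin> I \<or> j \<notin> I" for i j
    using assms that by (auto simp: c0_matrices_def scaleC_fun_def scaleC_complex_def)
  fix \<epsilon> :: real assume "\<epsilon> > 0"
  show "finite {(i, j). \<epsilon> \<le> cmod ((c *\<^sub>C f) i j)}"
  proof (cases "c = 0")
    case True
    then show ?thesis using \<open>\<epsilon> > 0\<close> by (simp add: scaleC_fun_def scaleC_complex_def)
  next
    case False
    then have "finite {(i, j). \<epsilon> / cmod c \<le> cmod (f i j)}"
      using assms \<open>\<epsilon> > 0\<close> by (simp add: c0_matrices_def)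
    then show ?thesis
      using False by (simp add: scaleC_fun_def scaleC_complex_def norm_mult field_simps)
  qed
qed

lemma c0_finite:
  assumes "finite F" "F \<subseteq> I \<times> I"
  shows "(\<lambda>i j. if (i, j) \<in> F then c i j else 0) \<in> c0_matrices I"
  unfolding c0_matrices_def mem_Collect_eq
proof (intro conjI allI impI)
  fix \<epsilon> :: real assume "\<epsilon> > 0"
  then show "finite {(i, j). \<epsilon> \<le> cmod (if (i, j) \<in> F then c i j else 0)}"
    by (intro finite_subset[OF _ assms(1)]) (auto split: if_splits)
qed (use assms in auto)

lemma c0_act:
  assumes f: "f \<in> c0_matrices I" and b: "b \<in> carr (matrix_algebra I)"
  shows "(\<lambda>i j. \<Sum>\<^sub>\<infinity>k\<in>I. f i k * b j k) \<in> c0_matrices I"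
  unfolding c0_matrices_def mem_Collect_eq
proof (intro conjI allI impI)
  fix i j assume ij: "i \<notin> I \<or> j \<notin> I"
  have "f i k * b j k = 0" for k
    using ij f b by (auto simp: c0_matrices_def carr_matrix_iff)
  then show "(\<Sum>\<^sub>\<infinity>k\<in>I. f i k * b j k) = 0" by (simp only: infsum_0_simp)
next
  fix \<epsilon> :: real assume e: "\<epsilon> > 0"
  let ?N = "nrm (matrix_algebra I) b"
  obtain M where M: "0 \<le> M" "\<And>i j. cmod (f i j) \<le> M" using c0_bounded[OF f] by metis
  have N: "0 \<le> ?N" by (simp add: nrm_matrix infsum_nonneg)
  define \<delta> where "\<delta> = \<epsilon> / (3 * (M + 1))"
  define \<eta> where "\<eta> = \<epsilon> / (3 * (?N + 1))"
  have \<delta>: "\<delta> > 0" and \<eta>: "\<eta> > 0" using e M N by (simp_all add: \<delta>_def \<eta>_def)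
  have bs: "(\<lambda>p. cmod (b (fst p) (snd p))) summable_on I \<times> I" using b by (simp add: carr_matrix_iff)
  obtain F where F: "finite F" "F \<subseteq> I \<times> I"
    "dist (\<Sum>p\<in>F. cmod (b (fst p) (snd p))) ?N \<le> \<delta>"
    using infsum_finite_approximation[OF bs \<delta>] unfolding nrm_matrix by blast
  define G where "G = {(i, j). \<eta> \<le> cmod (f i j)}"
  have G: "finite G" using f \<eta> by (simp add: G_def c0_matrices_def)
  have rest: "(\<Sum>p\<in>H. cmod (b (fst p) (snd p))) \<le> \<delta>" if H: "finite H" "H \<subseteq> I \<times> I - F" for H
  proof -
    have "(\<Sum>p\<in>F. cmod (b (fst p) (snd p))) + (\<Sum>p\<in>H. cmod (b (fst p) (snd p)))
        = (\<Sum>p\<in>F \<union> H. cmod (b (fst p) (snd p)))"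
      using F(1) H by (intro sum.union_disjoint[symmetric]) auto
    also have "\<dots> \<le> ?N" using F H by (intro matrix_sum_le[OF b]) auto
    finally show ?thesis using F(3) by (simp add: dist_real_def)
  qed
  have small: "cmod (\<Sum>\<^sub>\<infinity>k\<in>I. f i k * b j k) < \<epsilon>" if ij: "(i, j) \<notin> fst ` G \<times> fst ` F" for i j
  proof (cases "j \<in> I")
    case False
    have "f i k * b j k = 0" for k using False b by (auto simp: carr_matrix_iff)
    then have "(\<Sum>\<^sub>\<infinity>k\<in>I. f i k * b j k) = 0" by (simp only: infsum_0_simp)
    then show ?thesis using e by simp
  next
    case j: True
    have fin: "(\<Sum>k\<in>K. cmod (f i k * b j k)) \<le> 2 * \<epsilon> / 3" if K: "finite K" "K \<subseteq> I" for K
    proof -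
      let ?K1 = "{k \<in> K. (j, k) \<in> F}" and ?K2 = "{k \<in> K. (j, k) \<notin> F}"
      have "(\<Sum>k\<in>?K1. cmod (f i k * b j k)) \<le> (\<Sum>k\<in>?K1. \<eta> * cmod (b j k))"
      proof (rule sum_mono)
        fix k assume "k \<in> ?K1"
        then have "j \<in> fst ` F" by force
        then have "(i, k) \<notin> G" using ij by force
        then have "cmod (f i k) \<le> \<eta>" by (simp add: G_def)
        then show "cmod (f i k * b j k) \<le> \<eta> * cmod (b j k)" by (simp add: norm_mult mult_right_mono)
      qed
      also have "\<dots> = \<eta> * (\<Sum>p\<in>Pair j ` ?K1. cmod (b (fst p) (snd p)))"
        by (simp add: sum_distrib_left sum.reindex inj_on_def)
      also have "\<dots> \<le> \<eta> * ?N"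
        using K j \<eta> by (intro mult_left_mono matrix_sum_le[OF b]) auto
      also have "\<dots> \<le> \<epsilon> / 3"
        using e N by (simp add: \<eta>_def field_simps)
      finally have 1: "(\<Sum>k\<in>?K1. cmod (f i k * b j k)) \<le> \<epsilon> / 3" .
      have "(\<Sum>k\<in>?K2. cmod (f i k * b j k)) \<le> (\<Sum>k\<in>?K2. M * cmod (b j k))"
        by (intro sum_mono) (simp add: norm_mult mult_right_mono M)
      also have "\<dots> = M * (\<Sum>p\<in>Pair j ` ?K2. cmod (b (fst p) (snd p)))"
        by (simp add: sum_distrib_left sum.reindex inj_on_def)
      also have "\<dots> \<le> M * \<delta>"
        using K j by (intro mult_left_mono[OF rest M(1)]) auto
      also have "\<dots> \<le> \<epsilon> / 3"
        using e M(1) by (simp add: \<delta>_def field_simps)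
      finally have 2: "(\<Sum>k\<in>?K2. cmod (f i k * b j k)) \<le> \<epsilon> / 3" .
      have "(\<Sum>k\<in>K. cmod (f i k * b j k))
          = (\<Sum>k\<in>?K1 \<union> ?K2. cmod (f i k * b j k))"
        by (rule sum.cong) auto
      also have "\<dots> = (\<Sum>k\<in>?K1. cmod (f i k * b j k)) + (\<Sum>k\<in>?K2. cmod (f i k * b j k))"
        using K(1) by (intro sum.union_disjoint) auto
      finally show ?thesis using 1 2 by simp
    qed
    have s: "(\<lambda>k. cmod (f i k * b j k)) summable_on I"
    proof (rule nonneg_bdd_above_summable_on)
      show "bdd_above (sum (\<lambda>k. cmod (f i k * b j k)) ` {F. F \<subseteq> I \<and> finite F})"
        by (rule bdd_aboveI2[where M = "2 * \<epsilon> / 3"]) (use fin in blast)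
    qed simp
    have "cmod (\<Sum>\<^sub>\<infinity>k\<in>I. f i k * b j k) \<le> (\<Sum>\<^sub>\<infinity>k\<in>I. cmod (f i k * b j k))"
      by (rule norm_infsum_bound[OF s])
    also have "\<dots> \<le> 2 * \<epsilon> / 3" by (rule infsum_le_finite_sums[OF s fin])
    finally show ?thesis using e by simp
  qed
  have "{(i, j). \<epsilon> \<le> cmod (\<Sum>\<^sub>\<infinity>k\<in>I. f i k * b j k)} \<subseteq> fst ` G \<times> fst ` F"
    using small by (force simp: not_le[symmetric])
  then show "finite {(i, j). \<epsilon> \<le> cmod (\<Sum>\<^sub>\<infinity>k\<in>I. f i k * b j k)}"
    by (rule finite_subset) (use F G in simp)
qed

lemma matrix_transpose:
  assumes x: "x \<in> carr (matrix_algebra I)"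
  shows "(\<lambda>i j. x j i) \<in> carr (matrix_algebra I)"
proof (rule matrix_bounded(1)[where K = "nrm (matrix_algebra I) x"])
  show "x j i = 0" if "i \<notin> I \<or> j \<notin> I" for i j using x that by (auto simp: carr_matrix_iff)
  fix F :: "('a \<times> 'a) set" assume F: "finite F" "F \<subseteq> I \<times> I"
  have "(\<Sum>p\<in>F. cmod (x (snd p) (fst p))) = (\<Sum>p\<in>prod.swap ` F. cmod (x (fst p) (snd p)))"
    by (simp add: sum.reindex)
  also have "\<dots> \<le> nrm (matrix_algebra I) x" using F by (intro matrix_sum_le[OF x]) auto
  finally show "(\<Sum>p\<in>F. cmod (x (snd p) (fst p))) \<le> nrm (matrix_algebra I) x" .
qed

lemma c0_transpose:
  assumes "f \<in> c0_matrices I"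
  shows "(\<lambda>i j. f j i) \<in> c0_matrices I"
  unfolding c0_matrices_def mem_Collect_eq
proof (intro conjI allI impI)
  show "f j i = 0" if "i \<notin> I \<or> j \<notin> I" for i j using assms that by (auto simp: c0_matrices_def)
  fix \<epsilon> :: real assume "\<epsilon> > 0"
  then have "finite (prod.swap ` {(i, j). \<epsilon> \<le> cmod (f i j)})" using assms by (simp add: c0_matrices_def)
  then show "finite {(i, j). \<epsilon> \<le> cmod (f j i)}" by (rule finite_subset[rotated]) force
qed

lemma matrix_pairing_mult:
  assumes x: "x \<in> carr (matrix_algebra I)" and y: "y \<in> carr (matrix_algebra I)"
    and f: "f \<in> c0_matrices I"
  shows "matrix_pairing I f (mult (matrix_algebra I) x y)
      = matrix_pairing I (\<lambda>i j. \<Sum>\<^sub>\<infinity>k\<in>I. f i k * y j k) x"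
    and "matrix_pairing I f (mult (matrix_algebra I) x y)
      = matrix_pairing I (\<lambda>j k. \<Sum>\<^sub>\<infinity>i\<in>I. f i k * x i j) y"
proof -
  obtain M where M: "0 \<le> M" "\<And>i j. cmod (f i j) \<le> M" using c0_bounded[OF f] by metis
  define w where "w q = x (fst (fst q)) (snd q) * y (snd q) (snd (fst q)) * f (fst (fst q)) (snd (fst q))"
    for q
  have s: "(\<lambda>q. M * cmod (x (fst (fst q)) (snd q) * y (snd q) (snd (fst q)))) summable_on (I \<times> I) \<times> I"
    by (rule summable_on_cmult_right[OF matrix_triple(1)[OF x y]])
  have le: "cmod (w q) \<le> M * cmod (x (fst (fst q)) (snd q) * y (snd q) (snd (fst q)))" for q
    unfolding w_def norm_mult[of _ "f _ _"] by (subst mult.commute) (rule mult_right_mono[OF M(2) norm_ge_zero])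
  have w: "w summable_on (I \<times> I) \<times> I"
    by (rule abs_summable_summable[OF Infinite_Sum.abs_summable_on_comparison_test'[OF s le]])
  define h1 where "h1 q = ((fst (fst q), snd q), snd (fst q))" for q :: "('a \<times> 'a) \<times> 'a"
  define h2 where "h2 q = ((snd q, snd (fst q)), fst (fst q))" for q :: "('a \<times> 'a) \<times> 'a"
  have h1: "bij_betw h1 ((I \<times> I) \<times> I) ((I \<times> I) \<times> I)"
    by (rule bij_betwI[where g = h1]) (auto simp: h1_def)
  have h2: "bij_betw h2 ((I \<times> I) \<times> I) ((I \<times> I) \<times> I)"
    by (rule bij_betwI[where g = h2]) (auto simp: h2_def)
  have w1: "(\<lambda>q. w (h1 q)) summable_on (I \<times> I) \<times> I"
    using w summable_on_reindex_bij_betw[OF h1, of w] by simp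
  have w2: "(\<lambda>q. w (h2 q)) summable_on (I \<times> I) \<times> I"
    using w summable_on_reindex_bij_betw[OF h2, of w] by simp
  have "matrix_pairing I f (mult (matrix_algebra I) x y) = (\<Sum>\<^sub>\<infinity>p\<in>I \<times> I. \<Sum>\<^sub>\<infinity>k\<in>I. w (p, k))"
    unfolding matrix_pairing_apply[OF matrix_mult_closed(1)[OF x y]]
    by (simp add: w_def matrix_mult infsum_cmult_left')
  then have eq: "matrix_pairing I f (mult (matrix_algebra I) x y) = infsum w ((I \<times> I) \<times> I)"
    by (simp add: infsum_Sigma_banach[OF w])
  have "infsum w ((I \<times> I) \<times> I) = (\<Sum>\<^sub>\<infinity>p\<in>I \<times> I. \<Sum>\<^sub>\<infinity>k\<in>I. w (h1 (p, k)))"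
    unfolding infsum_Sigma_banach[OF w1] by (rule infsum_reindex_bij_betw[OF h1, symmetric])
  also have "\<dots> = (\<Sum>\<^sub>\<infinity>p\<in>I \<times> I. x (fst p) (snd p) * (\<Sum>\<^sub>\<infinity>k\<in>I. f (fst p) k * y (snd p) k))"
    by (simp add: w_def h1_def mult_ac infsum_cmult_right'[symmetric])
  finally show "matrix_pairing I f (mult (matrix_algebra I) x y)
      = matrix_pairing I (\<lambda>i j. \<Sum>\<^sub>\<infinity>k\<in>I. f i k * y j k) x"
    by (simp add: eq matrix_pairing_apply[OF x])
  have "infsum w ((I \<times> I) \<times> I) = (\<Sum>\<^sub>\<infinity>p\<in>I \<times> I. \<Sum>\<^sub>\<infinity>k\<in>I. w (h2 (p, k)))"
    unfolding infsum_Sigma_banach[OF w2] by (rule infsum_reindex_bij_betw[OF h2, symmetric])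
  also have "\<dots> = (\<Sum>\<^sub>\<infinity>p\<in>I \<times> I. y (fst p) (snd p) * (\<Sum>\<^sub>\<infinity>k\<in>I. f k (snd p) * x k (fst p)))"
    by (simp add: w_def h2_def mult_ac infsum_cmult_right'[symmetric])
  finally show "matrix_pairing I f (mult (matrix_algebra I) x y)
      = matrix_pairing I (\<lambda>j k. \<Sum>\<^sub>\<infinity>i\<in>I. f i k * x i j) y"
    by (simp add: eq matrix_pairing_apply[OF y])
qed

definition matrix_unit :: "'i \<Rightarrow> 'i \<Rightarrow> 'i \<Rightarrow> 'i \<Rightarrow> complex" where
  "matrix_unit i j = (\<lambda>k l. if k = i \<and> l = j then 1 else 0)"

lemma matrix_unit_carr:
  assumes "i \<in> I" "j \<in> I"
  shows "matrix_unit i j \<in> carr (matrix_algebra I)"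
    and "nrm (matrix_algebra I) (matrix_unit i j) \<le> 1"
proof -
  have z: "matrix_unit i j k l = 0" if "k \<notin> I \<or> l \<notin> I" for k l
    using that assms by (auto simp: matrix_unit_def)
  have b: "(\<Sum>p\<in>F. cmod (matrix_unit i j (fst p) (snd p))) \<le> 1" if "finite F" "F \<subseteq> I \<times> I" for F
  proof -
    have "(\<Sum>p\<in>F. cmod (matrix_unit i j (fst p) (snd p))) = (\<Sum>p\<in>F. if p = (i, j) then 1 else 0)"
      by (intro sum.cong) (auto simp: matrix_unit_def)
    then show ?thesis using that(1) by simp
  qed
  show "matrix_unit i j \<in> carr (matrix_algebra I)" by (rule matrix_bounded(1)[OF z b])
  show "nrm (matrix_algebra I) (matrix_unit i j) \<le> 1" by (rule matrix_bounded(2)[OF z b])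
qed

lemma matrix_unit_c0: "i \<in> I \<Longrightarrow> j \<in> I \<Longrightarrow> matrix_unit i j \<in> c0_matrices I"
  using c0_finite[of "{(i, j)}" I "\<lambda>_ _. 1"] by (simp add: matrix_unit_def)

lemma matrix_pairing_unit:
  assumes "i \<in> I" "j \<in> I"
  shows "matrix_pairing I f (matrix_unit i j) = f i j"
    and "x \<in> carr (matrix_algebra I) \<Longrightarrow> matrix_pairing I (matrix_unit i j) x = x i j"
proof -
  have "infsum (\<lambda>p. matrix_unit i j (fst p) (snd p) * f (fst p) (snd p)) (I \<times> I)
      = infsum (\<lambda>p. f i j) {(i, j)}"
    using assms by (intro infsum_cong_neutral) (auto simp: matrix_unit_def)
  then show "matrix_pairing I f (matrix_unit i j) = f i j"
    by (simp add: matrix_pairing_apply matrix_unit_carr assms)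
  have "infsum (\<lambda>p. x (fst p) (snd p) * matrix_unit i j (fst p) (snd p)) (I \<times> I)
      = infsum (\<lambda>p. x i j) {(i, j)}"
    using assms by (intro infsum_cong_neutral) (auto simp: matrix_unit_def)
  then show "matrix_pairing I (matrix_unit i j) x = x i j" if "x \<in> carr (matrix_algebra I)"
    by (simp add: matrix_pairing_apply that)
qed

lemma matrix_predual_dual: "matrix_predual I \<subseteq> carr (dual (matrix_algebra I))"
proof
  fix \<phi> assume "\<phi> \<in> matrix_predual I"
  then obtain f where f: "f \<in> c0_matrices I" and \<phi>: "\<phi> = matrix_pairing I f"
    by (auto simp: matrix_predual_def)
  obtain M where "0 \<le> M" "\<And>i j. cmod (f i j) \<le> M" using c0_bounded[OF f] by metis
  then show "\<phi> \<in> carr (dual (matrix_algebra I))" unfolding \<phi> by (rule matrix_pairing_dual(1))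
qed

lemma matrix_predual_csubspace: "csubspace (matrix_predual I)"
  unfolding csubspace_def
proof (intro conjI ballI allI)
  have "(\<lambda>i j. 0) \<in> c0_matrices I" using c0_finite[of "{}" I "\<lambda>_ _. 0"] by simp
  moreover have "matrix_pairing I (\<lambda>i j. 0) = 0" by (simp add: matrix_pairing_def fun_eq_iff case_prod_unfold)
  ultimately show "0 \<in> matrix_predual I" unfolding matrix_predual_def by (metis imageI)
  fix \<phi> \<psi> c assume "\<phi> \<in> matrix_predual I"
  then obtain f where f: "f \<in> c0_matrices I" "\<phi> = matrix_pairing I f"
    by (auto simp: matrix_predual_def)
  then show "c *\<^sub>C \<phi> \<in> matrix_predual I"
    using c0_scaleC matrix_pairing_scaleC unfolding matrix_predual_def by (metis imageI)
  assume "\<psi> \<in> matrix_predual I"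
  then obtain g where "g \<in> c0_matrices I" "\<psi> = matrix_pairing I g"
    by (auto simp: matrix_predual_def)
  with f show "\<phi> + \<psi> \<in> matrix_predual I"
    using c0_add matrix_pairing_add unfolding matrix_predual_def by (metis imageI)
qed

lemma matrix_unit_apply_le:
  assumes "\<phi> \<in> carr (dual (matrix_algebra I))" "i \<in> I" "j \<in> I"
  shows "cmod (\<phi> (matrix_unit i j)) \<le> nrm (dual (matrix_algebra I)) \<phi>"
proof -
  interpret cnormed_space "matrix_algebra I" by (rule matrix_cnormed_space)
  show ?thesis
    using dual_apply_le[OF assms(1) matrix_unit_carr(1)[OF assms(2,3)]]
      mult_left_mono[OF matrix_unit_carr(2)[OF assms(2,3)] dual_nrm_nonneg[OF assms(1)]]
    by simp
qed

lemma matrix_predual_closed: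
  assumes \<sigma>: "\<And>n::nat. \<sigma> n \<in> matrix_predual I" and l: "l \<in> carr (dual (matrix_algebra I))"
    and lim: "\<And>e. e > 0 \<Longrightarrow> \<exists>n. nrm (dual (matrix_algebra I)) (\<sigma> n - l) < e"
  shows "l \<in> matrix_predual I"
proof -
  let ?A = "matrix_algebra I"
  interpret cnormed_space ?A by (rule matrix_cnormed_space)
  interpret D: cnormed_space "dual ?A" by (rule dual_cnormed_space)
  define f where "f i j = (if i \<in> I \<and> j \<in> I then l (matrix_unit i j) else 0)" for i j
  have \<sigma>d: "\<sigma> n \<in> carr (dual ?A)" for n using \<sigma> matrix_predual_dual by blast
  have app: "\<exists>g\<in>c0_matrices I. \<exists>\<psi>\<in>carr (dual ?A). matrix_pairing I g = l + \<psi> \<and>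
      nrm (dual ?A) \<psi> < e \<and> (\<forall>i j. cmod (f i j - g i j) < e)" if e: "e > 0" for e
  proof -
    obtain n where n: "nrm (dual ?A) (\<sigma> n - l) < e" using lim[OF e] by blast
    obtain g where g: "g \<in> c0_matrices I" "\<sigma> n = matrix_pairing I g"
      using \<sigma>[of n] by (auto simp: matrix_predual_def)
    have d: "\<sigma> n - l \<in> carr (dual ?A)" by (rule D.carr_diff[OF \<sigma>d l])
    have "cmod (f i j - g i j) < e" for i j
    proof (cases "i \<in> I \<and> j \<in> I")
      case True
      then show ?thesis
        using matrix_unit_apply_le[OF d, of i j] n matrix_pairing_unit(1)[of i I j g]
        by (simp add: f_def g(2) norm_minus_commute)
    next
      case False
      then show ?thesis using g(1) e by (auto simp: f_def c0_matrices_def)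
    qed
    then show ?thesis using g n d by (intro bexI[of _ g] bexI[of _ "\<sigma> n - l"]) auto
  qed
  have fc: "f \<in> c0_matrices I"
    unfolding c0_matrices_def mem_Collect_eq
  proof (intro conjI allI impI)
    show "f i j = 0" if "i \<notin> I \<or> j \<notin> I" for i j using that by (auto simp: f_def)
    fix \<epsilon> :: real assume e: "\<epsilon> > 0"
    then obtain g where g: "g \<in> c0_matrices I" and fg: "\<And>i j. cmod (f i j - g i j) < \<epsilon> / 2"
      using app[of "\<epsilon> / 2"] by auto
    have fin: "finite {(i, j). \<epsilon> / 2 \<le> cmod (g i j)}"
      using g e half_gt_zero unfolding c0_matrices_def by blast
    have "\<epsilon> / 2 \<le> cmod (g i j)" if "\<epsilon> \<le> cmod (f i j)" for i j
      using that fg[of i j] norm_triangle_ineq2[of "f i j" "g i j"] by linarith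
    then show "finite {(i, j). \<epsilon> \<le> cmod (f i j)}"
      by (intro finite_subset[OF _ fin]) blast
  qed
  have "l x = matrix_pairing I f x" for x
  proof (cases "x \<in> carr ?A")
    case False
    then show ?thesis using l unfolding dual_iff matrix_pairing_def by auto
  next
    case x: True
    have "cmod (l x - matrix_pairing I f x) \<le> 0 + e" if e: "e > 0" for e
    proof -
      let ?r = "e / (2 * (nrm ?A x + 1))"
      have r: "?r > 0" using e nrm_nonneg[OF x] by simp
      obtain g \<psi> where g: "g \<in> c0_matrices I" and \<psi>: "\<psi> \<in> carr (dual ?A)"
        and eq: "matrix_pairing I g = l + \<psi>"
        and \<psi>r: "nrm (dual ?A) \<psi> < ?r" and fg: "\<And>i j. cmod (f i j - g i j) < ?r"
        using app[OF r] by blast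
      have m: "(-1) *\<^sub>C g \<in> c0_matrices I" by (rule c0_scaleC[OF g])
      have h: "f + (-1) *\<^sub>C g = (\<lambda>i j. f i j - g i j)"
        by (simp add: fun_eq_iff scaleC_fun_def scaleC_complex_def)
      define R where "R = ?r * nrm ?A x"
      have dx: "matrix_pairing I (\<lambda>i j. f i j - g i j) x = matrix_pairing I f x - (l x + \<psi> x)"
        unfolding h[symmetric] matrix_pairing_add[OF fc m] matrix_pairing_scaleC eq
        by (simp add: scaleC_fun_def scaleC_complex_def)
      have "cmod (matrix_pairing I (\<lambda>i j. f i j - g i j) x) \<le> R"
        unfolding matrix_pairing_apply[OF x] R_def
        by (rule matrix_bounded_summable(3)[OF x less_imp_le[OF fg]])
      then have "cmod (matrix_pairing I f x - (l x + \<psi> x)) \<le> R" unfolding dx .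
      moreover have "cmod (\<psi> x) \<le> R"
        unfolding R_def
        by (rule order_trans[OF dual_apply_le[OF \<psi> x]
              mult_right_mono[OF less_imp_le[OF \<psi>r] nrm_nonneg[OF x]]])
      moreover have "cmod (l x - matrix_pairing I f x)
          \<le> cmod (matrix_pairing I f x - (l x + \<psi> x)) + cmod (\<psi> x)"
        using norm_triangle_ineq[of "matrix_pairing I f x - (l x + \<psi> x)" "\<psi> x"]
        by (simp add: norm_minus_commute)
      ultimately have "cmod (l x - matrix_pairing I f x) \<le> R + R" by linarith
      also have "R + R = ?r * (2 * nrm ?A x)" by (simp add: R_def)
      also have "\<dots> \<le> ?r * (2 * (nrm ?A x + 1))"
        using r by (intro mult_left_mono) auto
      also have "\<dots> = e" using nrm_nonneg[OF x] by simp
      finally show ?thesis by simp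
    qed
    then have "cmod (l x - matrix_pairing I f x) \<le> 0" by (rule field_le_epsilon)
    then show ?thesis by simp
  qed
  then have "l = matrix_pairing I f" by (rule ext)
  then show ?thesis using fc by (auto simp: matrix_predual_def)
qed

lemma matrix_predual_closed_submodule:
  "closed_submodule (matrix_algebra I) (dual_bimodule (regular_bimodule (matrix_algebra I)))
     (matrix_predual I)"
proof -
  let ?A = "matrix_algebra I" let ?E = "dual_bimodule (regular_bimodule ?A)"
  interpret cnormed_space ?A by (rule matrix_cnormed_space)
  interpret D: cnormed_space "dual ?A" by (rule dual_cnormed_space)
  interpret M: Metric_space "carr (dual ?A)" "ndist (dual ?A)" by (rule D.Metric_space_ndist)
  have dual_reg: "dual (regular_bimodule ?A) = dual ?A"
    by (simp add: dual_def bounded_linear_maps_def regular_bimodule_def)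
  have "norm_topology ?E = M.mtopology"
  proof -
    have E: "carr ?E = carr (dual ?A)" "nrm ?E = nrm (dual ?A)"
      by (simp_all add: dual_bimodule_def dual_reg)
    show ?thesis unfolding norm_topology_def ndist_def[abs_def] E by (rule refl)
  qed
  moreover have "closedin M.mtopology (matrix_predual I)"
    unfolding M.metric_closedin_iff_sequentially_closed
  proof (intro conjI allI impI)
    show "matrix_predual I \<subseteq> carr (dual ?A)" by (rule matrix_predual_dual)
    fix \<sigma> l assume *: "range \<sigma> \<subseteq> matrix_predual I \<and> limitin M.mtopology \<sigma> l sequentially"
    then have l: "l \<in> carr (dual ?A)"
      and lim: "\<And>e. e > 0 \<Longrightarrow> eventually (\<lambda>n. ndist (dual ?A) (\<sigma> n) l < e) sequentially"
      by (auto simp: M.limitin_metric eventually_conj_iff)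
    have \<sigma>: "\<sigma> n \<in> matrix_predual I" for n using * by blast
    show "l \<in> matrix_predual I"
    proof (rule matrix_predual_closed[OF \<sigma> l])
      fix e :: real assume "e > 0"
      then obtain n where "ndist (dual ?A) (\<sigma> n) l < e"
        using lim[of e] by (auto simp: eventually_sequentially)
      moreover have "\<sigma> n \<in> carr (dual ?A)" using \<sigma> matrix_predual_dual by blast
      ultimately show "\<exists>n. nrm (dual ?A) (\<sigma> n - l) < e" using l by (auto simp: ndist_def)
    qed
  qed
  moreover have "lact ?E a \<phi> \<in> matrix_predual I \<and> ract ?E \<phi> a \<in> matrix_predual I"
    if a: "a \<in> carr ?A" and \<phi>: "\<phi> \<in> matrix_predual I" for a \<phi>
  proof -
    obtain f where f: "f \<in> c0_matrices I" "\<phi> = matrix_pairing I f"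
      using \<phi> by (auto simp: matrix_predual_def)
    have "lact ?E a \<phi> = matrix_pairing I (\<lambda>i j. \<Sum>\<^sub>\<infinity>k\<in>I. f i k * a j k)"
    proof
      fix x
      show "lact ?E a \<phi> x = matrix_pairing I (\<lambda>i j. \<Sum>\<^sub>\<infinity>k\<in>I. f i k * a j k) x"
        using matrix_pairing_mult(1)[OF _ a f(1), of x]
        by (simp add: dual_bimodule_def regular_bimodule_def f(2))
          (simp add: matrix_pairing_def)
    qed
    moreover have "ract ?E \<phi> a = matrix_pairing I (\<lambda>j k. \<Sum>\<^sub>\<infinity>i\<in>I. f i k * a i j)"
    proof
      fix x
      show "ract ?E \<phi> a x = matrix_pairing I (\<lambda>j k. \<Sum>\<^sub>\<infinity>i\<in>I. f i k * a i j) x"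
        using matrix_pairing_mult(2)[OF a _ f(1), of x]
        by (simp add: dual_bimodule_def regular_bimodule_def f(2))
          (simp add: matrix_pairing_def)
    qed
    moreover have "(\<lambda>i j. \<Sum>\<^sub>\<infinity>k\<in>I. f i k * a j k) \<in> c0_matrices I" by (rule c0_act[OF f(1) a])
    moreover have "(\<lambda>j k. \<Sum>\<^sub>\<infinity>i\<in>I. f i k * a i j) \<in> c0_matrices I"
      using c0_transpose[OF c0_act[OF c0_transpose[OF f(1)] matrix_transpose[OF a]]] by simp
    ultimately show ?thesis by (simp add: matrix_predual_def)
  qed
  ultimately show ?thesis by (simp add: closed_submodule_def matrix_predual_csubspace)
qed

lemma carr_predual_space [simp]: "carr (predual_space A P) = P"
  and nrm_predual_space [simp]: "nrm (predual_space A P) = nrm (dual A)"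
  by (simp_all add: predual_space_def)

lemma matrix_predual_cnormed_space:
  "cnormed_space (predual_space (matrix_algebra I) (matrix_predual I))"
proof -
  interpret cnormed_space "matrix_algebra I" by (rule matrix_cnormed_space)
  interpret D: cnormed_space "dual (matrix_algebra I)" by (rule dual_cnormed_space)
  note sub = subsetD[OF matrix_predual_dual]
  show ?thesis
    by unfold_locales
      (simp_all add: matrix_predual_csubspace sub D.nrm_nonneg D.nrm_eq_0_iff D.nrm_triangle
        D.nrm_scaleC)
qed

lemma matrix_pairing_finite:
  assumes \<Lambda>: "\<Lambda> \<in> carr (dual (predual_space (matrix_algebra I) (matrix_predual I)))"
    and F: "finite F" "F \<subseteq> I \<times> I"
  shows "\<Lambda> (matrix_pairing I (\<lambda>i j. if (i, j) \<in> F then c i j else 0))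
    = (\<Sum>(i, j)\<in>F. c i j * \<Lambda> (matrix_pairing I (matrix_unit i j)))"
  using F
proof (induction F rule: finite_induct)
  case empty
  have "0 \<in> matrix_predual I" using matrix_predual_csubspace by (auto simp: csubspace_def)
  then have "\<Lambda> (0 *\<^sub>C 0) = 0 * \<Lambda> 0" using \<Lambda> unfolding dual_iff by auto
  moreover have "matrix_pairing I (\<lambda>i j. 0) = 0 *\<^sub>C 0"
    by (simp add: matrix_pairing_def fun_eq_iff case_prod_unfold scaleC_fun_def scaleC_complex_def)
  ultimately show ?case by simp
next
  case (insert p F)
  obtain a b where p: "p = (a, b)" by (cases p)
  have ab: "a \<in> I" "b \<in> I" and F: "F \<subseteq> I \<times> I" using insert p by auto
  let ?r = "\<lambda>i j. if (i, j) \<in> F then c i j else 0"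
  have u: "matrix_unit a b \<in> c0_matrices I" by (rule matrix_unit_c0[OF ab])
  have cu: "c a b *\<^sub>C matrix_unit a b \<in> c0_matrices I" by (rule c0_scaleC[OF u])
  have r: "?r \<in> c0_matrices I" by (rule c0_finite[OF insert(1) F])
  have "(\<lambda>i j. if (i, j) \<in> insert p F then c i j else 0) = c a b *\<^sub>C matrix_unit a b + ?r"
    using insert(2) by (auto simp: fun_eq_iff p matrix_unit_def scaleC_fun_def scaleC_complex_def)
  then have eq: "matrix_pairing I (\<lambda>i j. if (i, j) \<in> insert p F then c i j else 0)
      = c a b *\<^sub>C matrix_pairing I (matrix_unit a b) + matrix_pairing I ?r"
    by (simp add: matrix_pairing_add[OF cu r] matrix_pairing_scaleC)
  have uP: "matrix_pairing I (matrix_unit a b) \<in> matrix_predual I"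
    and cuP: "c a b *\<^sub>C matrix_pairing I (matrix_unit a b) \<in> matrix_predual I"
    and rP: "matrix_pairing I ?r \<in> matrix_predual I"
    unfolding matrix_pairing_scaleC[symmetric] matrix_predual_def by (intro imageI u cu r)+
  have add: "\<Lambda> (\<phi> + \<psi>) = \<Lambda> \<phi> + \<Lambda> \<psi>" and scale: "\<Lambda> (z *\<^sub>C \<phi>) = z * \<Lambda> \<phi>"
    if "\<phi> \<in> matrix_predual I" "\<psi> \<in> matrix_predual I" for \<phi> \<psi> z
    using \<Lambda> that unfolding dual_iff carr_predual_space by blast+
  have "\<Lambda> (matrix_pairing I (\<lambda>i j. if (i, j) \<in> insert p F then c i j else 0))
      = c a b * \<Lambda> (matrix_pairing I (matrix_unit a b)) + \<Lambda> (matrix_pairing I ?r)"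
    unfolding eq add[OF cuP rP] scale[OF uP uP] by (rule refl)
  then show ?case using insert F by (simp add: p)
qed

lemma matrix_predual_sum_le:
  assumes \<Lambda>: "\<Lambda> \<in> carr (dual (predual_space (matrix_algebra I) (matrix_predual I)))"
    and F: "finite F" "F \<subseteq> I \<times> I"
  shows "(\<Sum>p\<in>F. cmod (\<Lambda> (matrix_pairing I (matrix_unit (fst p) (snd p)))))
    \<le> nrm (dual (predual_space (matrix_algebra I) (matrix_predual I))) \<Lambda>"
proof -
  let ?Q = "predual_space (matrix_algebra I) (matrix_predual I)"
  interpret Q: cnormed_space ?Q by (rule matrix_predual_cnormed_space)
  define x where "x i j = \<Lambda> (matrix_pairing I (matrix_unit i j))" for i j
  define c where "c i j = cnj (sgn (x i j))" for i j
  define s where "s = (\<lambda>i j. if (i, j) \<in> F then c i j else 0)"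
  have s1: "cmod (s i j) \<le> 1" for i j by (simp add: s_def c_def norm_sgn)
  have sp: "matrix_pairing I s \<in> matrix_predual I"
    unfolding matrix_predual_def s_def by (intro imageI c0_finite F)
  have cx: "c i j * x i j = complex_of_real (cmod (x i j))" for i j
  proof (cases "x i j = 0")
    case False
    then show ?thesis
      using complex_norm_square[of "x i j"]
      by (simp add: c_def sgn_div_norm scaleR_conv_of_real power2_eq_square field_simps)
  qed (simp add: c_def)
  have "\<Lambda> (matrix_pairing I s) = (\<Sum>p\<in>F. c (fst p) (snd p) * x (fst p) (snd p))"
    unfolding s_def by (subst matrix_pairing_finite[OF \<Lambda> F]) (simp add: x_def case_prod_unfold)
  also have "\<dots> = complex_of_real (\<Sum>p\<in>F. cmod (x (fst p) (snd p)))" by (simp add: cx)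
  finally have "(\<Sum>p\<in>F. cmod (x (fst p) (snd p))) = cmod (\<Lambda> (matrix_pairing I s))"
    by (simp add: sum_nonneg del: of_real_sum)
  also have "\<dots> \<le> nrm (dual ?Q) \<Lambda> * nrm ?Q (matrix_pairing I s)"
    by (rule Q.dual_apply_le[OF \<Lambda>]) (simp add: sp)
  also have "\<dots> \<le> nrm (dual ?Q) \<Lambda> * 1"
    using matrix_pairing_dual(2)[of 1 s I] s1 by (intro mult_left_mono Q.dual_nrm_nonneg[OF \<Lambda>]) auto
  finally show ?thesis by (simp add: x_def)
qed

theorem matrix_dual_banach_algebra:
  "dual_banach_algebra (matrix_algebra I) (matrix_predual I)"
proof -
  let ?A = "matrix_algebra I" let ?P = "matrix_predual I" let ?Q = "predual_space ?A ?P"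
  interpret cbanach_algebra ?A by (rule matrix_cbanach_algebra)
  interpret Q: cnormed_space ?Q by (rule matrix_predual_cnormed_space)
  have Pd: "\<phi> \<in> carr (dual ?A)" if "\<phi> \<in> ?P" for \<phi> using that matrix_predual_dual by blast
  have ev_le: "cmod (evaluation ?P a \<phi>) \<le> nrm ?A a * nrm ?Q \<phi>"
    if "a \<in> carr ?A" "\<phi> \<in> carr ?Q" for a \<phi>
    using dual_apply_le[OF Pd that(1)] that by (simp add: evaluation_def mult.commute)
  have ev: "evaluation ?P a \<in> carr (dual ?Q)" if a: "a \<in> carr ?A" for a
    unfolding dual_iff
  proof (intro conjI)
    show "\<exists>K. \<forall>\<phi>\<in>carr ?Q. cmod (evaluation ?P a \<phi>) \<le> K * nrm ?Q \<phi>"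
      using ev_le[OF a] by blast
  qed (use Q.csubspace_carr in
      \<open>auto simp: evaluation_def csubspace_def scaleC_fun_def scaleC_complex_def\<close>)
  have ent: "evaluation ?P a (matrix_pairing I (matrix_unit i j)) = a i j"
    if "a \<in> carr ?A" "i \<in> I" "j \<in> I" for a i j
    using matrix_unit_c0[OF that(2,3)] matrix_pairing_unit(2)[OF that(2,3,1)]
    by (simp add: evaluation_def matrix_predual_def)
  have iso: "nrm (dual ?Q) (evaluation ?P a) = nrm ?A a" if a: "a \<in> carr ?A" for a
  proof (rule antisym)
    show "nrm (dual ?Q) (evaluation ?P a) \<le> nrm ?A a"
      by (rule Q.dual_nrm_le[OF nrm_nonneg[OF a] ev_le[OF a]])
    show "nrm ?A a \<le> nrm (dual ?Q) (evaluation ?P a)"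
    proof (rule matrix_bounded(2))
      show "a i j = 0" if "i \<notin> I \<or> j \<notin> I" for i j using a that by (auto simp: carr_matrix_iff)
      fix F assume F: "finite F" "F \<subseteq> I \<times> I"
      have "(\<Sum>p\<in>F. cmod (a (fst p) (snd p)))
          = (\<Sum>p\<in>F. cmod (evaluation ?P a (matrix_pairing I (matrix_unit (fst p) (snd p)))))"
        using F by (intro sum.cong refl) (auto simp: ent a)
      also have "\<dots> \<le> nrm (dual ?Q) (evaluation ?P a)" by (rule matrix_predual_sum_le[OF ev[OF a] F])
      finally show "(\<Sum>p\<in>F. cmod (a (fst p) (snd p))) \<le> nrm (dual ?Q) (evaluation ?P a)" .
    qed
  qed
  have inj: "inj_on (evaluation ?P) (carr ?A)"
  proof (rule inj_onI)
    fix a b assume a: "a \<in> carr ?A" and b: "b \<in> carr ?A" and eq: "evaluation ?P a = evaluation ?P b"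
    have "a i j = b i j" for i j
    proof (cases "i \<in> I \<and> j \<in> I")
      case True
      then show ?thesis using ent[OF a, of i j] ent[OF b, of i j] eq by simp
    next
      case False
      then have "a i j = 0" "b i j = 0" using a b by (auto simp: carr_matrix_iff)
      then show ?thesis by simp
    qed
    then show "a = b" by (simp add: fun_eq_iff)
  qed
  have surj: "\<Lambda> \<in> evaluation ?P ` carr ?A" if \<Lambda>: "\<Lambda> \<in> carr (dual ?Q)" for \<Lambda>
  proof -
    define x where "x i j = (if i \<in> I \<and> j \<in> I then \<Lambda> (matrix_pairing I (matrix_unit i j)) else 0)"
      for i j
    have x: "x \<in> carr ?A"
    proof (rule matrix_bounded(1))
      show "x i j = 0" if "i \<notin> I \<or> j \<notin> I" for i j using that by (auto simp: x_def)
      fix F :: "('a \<times> 'a) set" assume F: "finite F" "F \<subseteq> I \<times> I"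
      have "(\<Sum>p\<in>F. cmod (x (fst p) (snd p)))
          = (\<Sum>p\<in>F. cmod (\<Lambda> (matrix_pairing I (matrix_unit (fst p) (snd p)))))"
        using F by (intro sum.cong refl) (auto simp: x_def)
      also have "\<dots> \<le> nrm (dual ?Q) \<Lambda>" by (rule matrix_predual_sum_le[OF \<Lambda> F])
      finally show "(\<Sum>p\<in>F. cmod (x (fst p) (snd p))) \<le> nrm (dual ?Q) \<Lambda>" .
    qed
    have ev_x: "evaluation ?P x \<in> carr (dual ?Q)" by (rule ev[OF x])
    interpret DQ: cnormed_space "dual ?Q" by (rule Q.dual_cnormed_space)
    let ?D = "\<Lambda> - evaluation ?P x"
    have D: "?D \<in> carr (dual ?Q)" by (rule DQ.carr_diff[OF \<Lambda> ev_x])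
    have "?D \<phi> = 0" for \<phi>
    proof (cases "\<phi> \<in> ?P")
      case False
      then show ?thesis using D unfolding dual_iff carr_predual_space by blast
    next
      case True
      then obtain f where f: "f \<in> c0_matrices I" and \<phi>: "\<phi> = matrix_pairing I f"
        by (auto simp: matrix_predual_def)
      have "cmod (?D \<phi>) \<le> 0 + e" if e: "e > 0" for e
      proof -
        let ?n = "nrm (dual ?Q) ?D"
        have n: "0 \<le> ?n" by (rule Q.dual_nrm_nonneg[OF D])
        define r where "r = e / (?n + 1)"
        have r: "r > 0" using e n by (simp add: r_def)
        define F where "F = {(i, j). r \<le> cmod (f i j)}"
        have F: "finite F" "F \<subseteq> I \<times> I"
        proof -
          show "finite F" using f r by (simp add: F_def c0_matrices_def)
          have "i \<in> I \<and> j \<in> I" if "r \<le> cmod (f i j)" for i j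
            using f r that by (cases "i \<in> I \<and> j \<in> I") (auto simp: c0_matrices_def)
          then show "F \<subseteq> I \<times> I" by (auto simp: F_def)
        qed
        define g where "g = (\<lambda>i j. if (i, j) \<in> F then f i j else 0)"
        define h where "h = f + (-1) *\<^sub>C g"
        have g: "g \<in> c0_matrices I" unfolding g_def by (rule c0_finite[OF F])
        have h: "h \<in> c0_matrices I" unfolding h_def by (intro c0_add f c0_scaleC g)
        have hr: "cmod (h i j) \<le> r" for i j
          using r by (auto simp: h_def g_def F_def scaleC_fun_def scaleC_complex_def)
        have "f = g + h" by (simp add: h_def fun_eq_iff scaleC_fun_def scaleC_complex_def)
        then have "\<phi> = matrix_pairing I g + matrix_pairing I h"
          unfolding \<phi> by (simp add: matrix_pairing_add[OF g h])
        moreover have gP: "matrix_pairing I g \<in> ?P" and hP: "matrix_pairing I h \<in> ?P"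
          using g h by (auto simp: matrix_predual_def)
        ultimately have "?D \<phi> = ?D (matrix_pairing I g) + ?D (matrix_pairing I h)"
          using D unfolding dual_iff carr_predual_space by blast
        moreover have "?D (matrix_pairing I g) = 0"
        proof -
          have "?D (matrix_pairing I (matrix_unit i j)) = 0" if "(i, j) \<in> F" for i j
            using that F(2) ent[OF x, of i j] by (auto simp: x_def)
          then show ?thesis
            unfolding g_def matrix_pairing_finite[OF D F] by (intro sum.neutral) auto
        qed
        moreover have "cmod (?D (matrix_pairing I h)) \<le> ?n * nrm ?Q (matrix_pairing I h)"
          by (rule Q.dual_apply_le[OF D]) (simp add: hP)
        moreover have "?n * nrm ?Q (matrix_pairing I h) \<le> ?n * r"
          using matrix_pairing_dual(2)[OF less_imp_le[OF r] hr] n by (intro mult_left_mono) auto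
        moreover have "?n * r \<le> e" using e n by (simp add: r_def field_simps)
        ultimately show ?thesis by simp
      qed
      then have "cmod (?D \<phi>) \<le> 0" by (rule field_le_epsilon)
      then show ?thesis by simp
    qed
    then have "\<Lambda> = evaluation ?P x" by (simp add: fun_eq_iff)
    then show ?thesis using x by blast
  qed
  have "evaluation ?P ` carr ?A = carr (dual ?Q)" using ev surj by blast
  then have "bij_betw (evaluation ?P) (carr ?A) (carr (dual ?Q))" using inj by (simp add: bij_betw_def)
  with matrix_predual_closed_submodule iso show ?thesis
    by (intro dual_banach_algebra.intro matrix_cbanach_algebra dual_banach_algebra_axioms.intro)
qed

end

theory Submission
  imports Defs
begin

text \<open>
  Write \<open>A\<close> for the matrix algebra, \<open>P\<close> for its predual and \<open>T\<close> for the projective tensor product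
  of \<open>A\<close> with itself.

  If a net \<open>m\<^sub>\<alpha>\<close> as in the definition of strong pseudo-Connes amenability exists, then
  \<open>z\<^sub>\<alpha> = \<pi>\<^sub>\<sigma>\<^sub>w\<^sub>c(m\<^sub>\<alpha>)\<close> is a central element of \<open>A\<close>.  Comparing \<open>e\<^sub>i\<^sub>j z\<^sub>\<alpha>\<close> with \<open>z\<^sub>\<alpha> e\<^sub>i\<^sub>j\<close> in the
  entry \<open>(i, j)\<close> shows that its diagonal is constant.  A summable constant diagonal of infinite length
  vanishes (\<open>central_diagonal_zero\<close>), so for infinite \<open>I\<close> the \<open>(i, i)\<close> entries of
  \<open>e\<^sub>i\<^sub>i z\<^sub>\<alpha>\<close> are all \<open>0\<close>.  They should converge to the entry \<open>1\<close> of \<open>e\<^sub>i\<^sub>i\<close>, because reading off an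
  entry is a functional from \<open>P\<close>.

  If \<open>I\<close> is finite, then for a fixed \<open>r\<close> the tensor \<open>t = \<Sum>\<^sub>i e\<^sub>i\<^sub>r \<otimes> e\<^sub>r\<^sub>i\<close> satisfies \<open>a \<cdot> t = t \<cdot> a\<close> for all
  \<open>a\<close>, and \<open>\<pi>(t)\<close> is the identity matrix (\<open>matrix_diagonal\<close>).  Every linear functional on \<open>A\<close> is
  then weak-star continuous, so that the \<open>\<sigma>wc\<close> part of the dual of \<open>T\<close> is the whole dual
  (\<open>sigma_wc_tensor_finite\<close>), and evaluation at \<open>t\<close> is a constant net with the required properties.

  Both directions need \<open>\<pi>\<^sub>\<sigma>\<^sub>w\<^sub>c\<close> to take values in \<open>A\<close>, that is, \<open>\<pi>\<^sup>*\<close> has to map \<open>P\<close> boundedly into the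
  \<open>\<sigma>wc\<close> part (\<open>pi_adjoint_sigma_wc\<close>).  This holds in every dual Banach algebra, by duality: for a
  functional \<open>\<Lambda>\<close> on the dual of \<open>T\<close>, the composition \<open>\<Lambda> \<circ> \<pi>\<^sup>*\<close> is a bounded functional on \<open>P\<close>, hence
  evaluation at some \<open>z \<in> A\<close>, and then \<open>\<Lambda>(a \<cdot> \<pi>\<^sup>*\<phi>) = \<phi>(z a) = (\<phi> \<cdot> z)(a)\<close> with \<open>\<phi> \<cdot> z \<in> P\<close>.

  The actions on \<open>T\<close> and the map \<open>\<pi>\<close> are given by the universal property of \<open>T\<close>, so it has
  to be established first.  Uniqueness of lifts is density of the algebraic tensor product
  (\<open>proj_tensor_ext\<close>).  Existence is shown for bounded bilinear maps \<open>\<beta>\<close> into a dual space \<open>Q\<^sup>*\<close>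
  (\<open>proj_lift_dual\<close>), which covers all three maps: \<open>T\<close> consists of functionals on the dual of the
  algebraic tensor product, and \<open>u \<mapsto> (\<psi> \<mapsto> u(\<psi> \<circ> \<beta>))\<close> is the lift.
\<close>

section \<open>Bounded linear maps on carriers\<close>

lemma scaleC_0_left [simp]: "0 *\<^sub>C (x :: 'a::complex_vector) = 0"
  using scaleC_add_left[of 0 0 x] by simp

lemma scaleC_0_right [simp]: "c *\<^sub>C (0 :: 'a::complex_vector) = 0"
  using scaleC_add_right[of c 0 0] by simp

lemma scaleC_minus1_left: "(-1) *\<^sub>C (x :: 'a::complex_vector) = - x"
  using scaleC_add_left[of "-1" 1 x] by (simp add: scaleC_one eq_neg_iff_add_eq_0)

lemma csubspace_zero: "csubspace S \<Longrightarrow> 0 \<in> S"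
  and csubspace_add: "csubspace S \<Longrightarrow> x \<in> S \<Longrightarrow> y \<in> S \<Longrightarrow> x + y \<in> S"
  and csubspace_scaleC: "csubspace S \<Longrightarrow> x \<in> S \<Longrightarrow> c *\<^sub>C x \<in> S"
  by (simp_all add: csubspace_def)

lemma csubspace_diff: "csubspace S \<Longrightarrow> x \<in> S \<Longrightarrow> y \<in> S \<Longrightarrow> x - y \<in> S"
  using csubspace_add[of S x "(-1) *\<^sub>C y"] csubspace_scaleC[of S y "-1"]
  by (simp add: scaleC_minus1_left)

lemma csubspace_sum_list:
  "csubspace S \<Longrightarrow> (\<And>p. p \<in> set ps \<Longrightarrow> f p \<in> S) \<Longrightarrow> (\<Sum>p\<leftarrow>ps. f p) \<in> S"
  by (induction ps) (auto simp: csubspace_zero csubspace_add)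

lemma csubspace_sum:
  "csubspace S \<Longrightarrow> (\<And>p. p \<in> F \<Longrightarrow> f p \<in> S) \<Longrightarrow> (\<Sum>p\<in>F. f p) \<in> S"
  by (induction F rule: infinite_finite_induct) (auto simp: csubspace_zero csubspace_add)

lemma carrier_linear_sum:
  assumes S: "csubspace S" and add: "\<And>x y. x \<in> S \<Longrightarrow> y \<in> S \<Longrightarrow> f (x + y) = f x + f y"
    and scaleC: "\<And>c x. x \<in> S \<Longrightarrow> f (c *\<^sub>C x) = c *\<^sub>C f x"
    and g: "\<And>p. p \<in> F \<Longrightarrow> g p \<in> S"
  shows "f (\<Sum>p\<in>F. g p) = (\<Sum>p\<in>F. f (g p))"
proof -
  have "f 0 = 0" using scaleC[OF csubspace_zero[OF S], of 0] by simp
  then show ?thesis using g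
    by (induction F rule: infinite_finite_induct) (auto simp: add csubspace_sum[OF S])
qed

lemma bounded_linear_mapsD:
  assumes "u \<in> bounded_linear_maps X Y"
  shows "x \<notin> carr X \<Longrightarrow> u x = 0"
    and "x \<in> carr X \<Longrightarrow> u x \<in> carr Y"
    and "x \<in> carr X \<Longrightarrow> y \<in> carr X \<Longrightarrow> u (x + y) = u x + u y"
    and "x \<in> carr X \<Longrightarrow> u (c *\<^sub>C x) = c *\<^sub>C u x"
  using assms unfolding bounded_linear_maps_def by blast+

lemma bounded_linear_maps_bound:
  assumes "u \<in> bounded_linear_maps X Y" and "\<And>x. x \<in> carr X \<Longrightarrow> 0 \<le> nrm X x"
  obtains K where "0 \<le> K" "\<And>x. x \<in> carr X \<Longrightarrow> nrm Y (u x) \<le> K * nrm X x"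
proof -
  obtain K where K: "\<And>x. x \<in> carr X \<Longrightarrow> nrm Y (u x) \<le> K * nrm X x"
    using assms(1) unfolding bounded_linear_maps_def by blast
  have "nrm Y (u x) \<le> max K 0 * nrm X x" if "x \<in> carr X" for x
    using K[OF that] mult_right_mono[OF max.cobounded1 assms(2)[OF that], of K 0] by linarith
  then show ?thesis by (intro that[of "max K 0"]) simp_all
qed

lemma bounded_linear_maps_diff:
  assumes u: "u \<in> bounded_linear_maps X Y" and X: "csubspace (carr X)"
    and x: "x \<in> carr X" and y: "y \<in> carr X"
  shows "u (x - y) = u x - u y"
  using bounded_linear_mapsD(3)[OF u x csubspace_scaleC[OF X y, of "-1"]]
    bounded_linear_mapsD(4)[OF u y, of "-1"]
  by (simp add: scaleC_minus1_left)

lemma bounded_linear_maps_zero: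
  assumes u: "u \<in> bounded_linear_maps X Y" and X: "csubspace (carr X)"
  shows "u 0 = 0"
  using bounded_linear_mapsD(4)[OF u csubspace_zero[OF X], of 0] by simp

lemma bounded_linear_maps_sum_list:
  assumes u: "u \<in> bounded_linear_maps X Y" and X: "csubspace (carr X)"
  shows "(\<And>p. p \<in> set ps \<Longrightarrow> f p \<in> carr X) \<Longrightarrow> u (\<Sum>p\<leftarrow>ps. f p) = (\<Sum>p\<leftarrow>ps. u (f p))"
  by (induction ps)
    (auto simp: bounded_linear_maps_zero[OF u X] bounded_linear_mapsD(3)[OF u] csubspace_sum_list[OF X])

lemma bounded_linear_maps_sum:
  assumes u: "u \<in> bounded_linear_maps X Y" and X: "csubspace (carr X)"
    and f: "\<And>p. p \<in> F \<Longrightarrow> f p \<in> carr X"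
  shows "u (\<Sum>p\<in>F. f p) = (\<Sum>p\<in>F. u (f p))"
  by (rule carrier_linear_sum[where f = u, OF X bounded_linear_mapsD(3,4)[OF u] f])

lemma bounded_linear_maps_compose:
  assumes u: "u \<in> bounded_linear_maps X Y" and v: "v \<in> bounded_linear_maps Y Z"
    and X_sub: "csubspace (carr X)" and X: "\<And>x. x \<in> carr X \<Longrightarrow> 0 \<le> nrm X x"
    and Y: "\<And>y. y \<in> carr Y \<Longrightarrow> 0 \<le> nrm Y y"
  shows "(\<lambda>x. if x \<in> carr X then v (u x) else 0) \<in> bounded_linear_maps X Z"
    (is "?w \<in> _")
  unfolding bounded_linear_maps_def
proof (intro CollectI conjI ballI allI impI)
  note D = bounded_linear_mapsD[OF u] bounded_linear_mapsD[OF v]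
  obtain K where K: "0 \<le> K" "\<And>x. x \<in> carr X \<Longrightarrow> nrm Y (u x) \<le> K * nrm X x"
    using bounded_linear_maps_bound[OF u X] by blast
  obtain L where L: "0 \<le> L" "\<And>y. y \<in> carr Y \<Longrightarrow> nrm Z (v y) \<le> L * nrm Y y"
    using bounded_linear_maps_bound[OF v Y] by blast
  have "nrm Z (?w x) \<le> L * K * nrm X x" if x: "x \<in> carr X" for x
    using L(2)[OF D(2)[OF x]] mult_left_mono[OF K(2)[OF x] L(1)] x by (simp add: mult.assoc)
  then show "\<exists>K. \<forall>x\<in>carr X. nrm Z (?w x) \<le> K * nrm X x" by blast
  fix x c assume x: "x \<in> carr X"
  show "?w x \<in> carr Z" using x D by simp
  show "?w (c *\<^sub>C x) = c *\<^sub>C ?w x" using x X_sub D by (simp add: csubspace_scaleC)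
  fix y assume "y \<in> carr X"
  then show "?w (x + y) = ?w x + ?w y" using x X_sub D by (simp add: csubspace_add)
qed simp

section \<open>Duals of seminormed spaces\<close>

text \<open>For the algebraic tensor product, whose projective norm is handled as a seminorm: the projective
  tensor product is built from its dual, and the dual of a seminormed space is a normed space.\<close>

locale cseminormed_space =
  fixes X :: "('a::complex_vector, 'm) nspace_scheme"
  assumes csubspace_carr: "csubspace (carr X)"
    and nrm_nonneg: "x \<in> carr X \<Longrightarrow> 0 \<le> nrm X x"
    and nrm_triangle: "x \<in> carr X \<Longrightarrow> y \<in> carr X \<Longrightarrow> nrm X (x + y) \<le> nrm X x + nrm X y"
    and nrm_scaleC: "x \<in> carr X \<Longrightarrow> nrm X (c *\<^sub>C x) = cmod c * nrm X x"
begin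

lemma dual_bdd_above:
  assumes "\<phi> \<in> carr (dual X)"
  shows "bdd_above ((\<lambda>x. cmod (\<phi> x)) ` {x \<in> carr X. nrm X x \<le> 1})"
proof -
  obtain K where K: "0 \<le> K" "\<And>x. x \<in> carr X \<Longrightarrow> cmod (\<phi> x) \<le> K * nrm X x"
    using bounded_linear_maps_bound[of \<phi> X complex_nspace] assms nrm_nonneg
    by (auto simp: dual_def complex_nspace_def)
  have "cmod (\<phi> x) \<le> K" if "x \<in> carr X" "nrm X x \<le> 1" for x
    using K(2)[OF that(1)] mult_left_mono[OF that(2) K(1)] by simp
  then show ?thesis by (intro bdd_aboveI2[where M = K]) blast
qed

text \<open>Vectors of seminorm \<open>0\<close> cannot be scaled to unit length; there boundedness of \<open>\<phi>\<close> forces the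
  value \<open>0\<close>.\<close>

lemma dual_apply_le:
  assumes \<phi>: "\<phi> \<in> carr (dual X)" and x: "x \<in> carr X"
  shows "cmod (\<phi> x) \<le> nrm (dual X) \<phi> * nrm X x"
proof (cases "nrm X x = 0")
  case True
  then show ?thesis using \<phi> x unfolding dual_iff by force
next
  case False
  then have pos: "nrm X x > 0" using nrm_nonneg[OF x] by simp
  define c where "c = complex_of_real (1 / nrm X x)"
  have c: "cmod c = 1 / nrm X x" using pos by (simp add: c_def norm_divide)
  have "nrm X (c *\<^sub>C x) = 1" using pos c by (simp add: nrm_scaleC[OF x])
  then have "cmod (\<phi> (c *\<^sub>C x)) \<le> nrm (dual X) \<phi>"
    unfolding nrm_dual using csubspace_scaleC[OF csubspace_carr x]
    by (intro cSUP_upper[OF _ dual_bdd_above[OF \<phi>]]) auto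
  moreover have "\<phi> (c *\<^sub>C x) = c * \<phi> x" using \<phi> x unfolding dual_iff by blast
  ultimately have "cmod (\<phi> x) / nrm X x \<le> nrm (dual X) \<phi>" by (simp add: c norm_mult)
  then show ?thesis using pos by (simp add: pos_divide_le_eq)
qed

lemma nrm_zero: "nrm X 0 = 0"
  using nrm_scaleC[OF csubspace_zero[OF csubspace_carr], of 0] by simp

lemma dual_nrm_le:
  assumes "0 \<le> K" and "\<And>x. x \<in> carr X \<Longrightarrow> cmod (\<phi> x) \<le> K * nrm X x"
  shows "nrm (dual X) \<phi> \<le> K"
  unfolding nrm_dual
proof (rule cSUP_least)
  show "{x \<in> carr X. nrm X x \<le> 1} \<noteq> {}"
    using csubspace_zero[OF csubspace_carr] nrm_zero by force
  fix x assume "x \<in> {x \<in> carr X. nrm X x \<le> 1}"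
  then show "cmod (\<phi> x) \<le> K"
    using assms(2)[of x] mult_left_mono[of "nrm X x" 1 K] assms(1) by auto
qed

lemma dual_nrm_nonneg:
  assumes \<phi>: "\<phi> \<in> carr (dual X)"
  shows "0 \<le> nrm (dual X) \<phi>"
proof -
  have "cmod (\<phi> 0) \<le> nrm (dual X) \<phi>"
    unfolding nrm_dual using csubspace_zero[OF csubspace_carr] nrm_zero
    by (intro cSUP_upper[OF _ dual_bdd_above[OF \<phi>]]) auto
  then show ?thesis using norm_ge_zero order_trans by blast
qed

lemma dual_space_cnormed: "cnormed_space (dual X)"
proof
  have add: "cmod ((\<phi> + \<psi>) x) \<le> (nrm (dual X) \<phi> + nrm (dual X) \<psi>) * nrm X x"
    if "\<phi> \<in> carr (dual X)" "\<psi> \<in> carr (dual X)" "x \<in> carr X" for \<phi> \<psi> x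
    using norm_triangle_ineq[of "\<phi> x" "\<psi> x"] dual_apply_le[OF that(1,3)] dual_apply_le[OF that(2,3)]
    by (simp add: distrib_right)
  have scl: "cmod ((c *\<^sub>C \<phi>) x) \<le> (cmod c * nrm (dual X) \<phi>) * nrm X x"
    if "\<phi> \<in> carr (dual X)" "x \<in> carr X" for \<phi> x c
    using mult_left_mono[OF dual_apply_le[OF that] norm_ge_zero[of c]]
    by (simp add: scaleC_fun_def scaleC_complex_def norm_mult mult.assoc)
  have carr_scl: "c *\<^sub>C \<phi> \<in> carr (dual X)" if "\<phi> \<in> carr (dual X)" for \<phi> c
    unfolding dual_iff
  proof (intro conjI)
    show "\<exists>K. \<forall>x\<in>carr X. cmod ((c *\<^sub>C \<phi>) x) \<le> K * nrm X x" using scl[OF that] by blast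
  qed (use that in \<open>simp_all add: dual_iff scaleC_fun_def scaleC_complex_def algebra_simps\<close>)
  have carr_add: "\<phi> + \<psi> \<in> carr (dual X)" if "\<phi> \<in> carr (dual X)" "\<psi> \<in> carr (dual X)" for \<phi> \<psi>
    unfolding dual_iff
  proof (intro conjI)
    show "\<exists>K. \<forall>x\<in>carr X. cmod ((\<phi> + \<psi>) x) \<le> K * nrm X x" using add[OF that] by blast
  qed (use that in \<open>simp_all add: dual_iff distrib_left\<close>)
  have "0 \<in> carr (dual X)" unfolding dual_iff by (auto intro!: exI[of _ 0])
  then show "csubspace (carr (dual X))" by (simp add: csubspace_def carr_add carr_scl)
  fix \<phi> \<psi> c assume \<phi>: "\<phi> \<in> carr (dual X)"
  show "0 \<le> nrm (dual X) \<phi>" by (rule dual_nrm_nonneg[OF \<phi>])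
  show "nrm (dual X) \<phi> = 0 \<longleftrightarrow> \<phi> = 0"
  proof
    assume 0: "nrm (dual X) \<phi> = 0"
    have "\<phi> x = 0" for x
      using dual_apply_le[OF \<phi>, of x] \<phi> 0 by (cases "x \<in> carr X") (auto simp: dual_iff)
    then show "\<phi> = 0" by (simp add: fun_eq_iff)
  next
    assume "\<phi> = 0"
    then have "nrm (dual X) \<phi> \<le> 0" by (intro dual_nrm_le) auto
    then show "nrm (dual X) \<phi> = 0" using dual_nrm_nonneg[OF \<phi>] by simp
  qed
  have le: "nrm (dual X) (c *\<^sub>C \<phi>) \<le> cmod c * nrm (dual X) \<phi>" if "\<phi> \<in> carr (dual X)" for \<phi> c
    using scl[OF that] dual_nrm_nonneg[OF that] by (intro dual_nrm_le) auto
  show "nrm (dual X) (c *\<^sub>C \<phi>) = cmod c * nrm (dual X) \<phi>"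
  proof (cases "c = 0")
    case True
    then show ?thesis using le[OF \<phi>, of c] dual_nrm_nonneg[OF carr_scl[OF \<phi>, of c]] by simp
  next
    case False
    then have "nrm (dual X) \<phi> \<le> cmod (1 / c) * nrm (dual X) (c *\<^sub>C \<phi>)"
      using le[OF carr_scl[OF \<phi>, of c], of "1 / c"] by (simp add: scaleC_scaleC scaleC_one)
    then show ?thesis using le[OF \<phi>, of c] False by (simp add: norm_divide field_simps)
  qed
  assume \<psi>: "\<psi> \<in> carr (dual X)"
  show "nrm (dual X) (\<phi> + \<psi>) \<le> nrm (dual X) \<phi> + nrm (dual X) \<psi>"
    using add[OF \<phi> \<psi>] dual_nrm_nonneg[OF \<phi>] dual_nrm_nonneg[OF \<psi>] by (intro dual_nrm_le) auto
qed

end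

section \<open>The algebraic tensor product and its dual\<close>

lemma sum_list_fun_apply: "(\<Sum>p\<leftarrow>ps. f p) x = (\<Sum>p\<leftarrow>ps. f p x)"
  by (induction ps) simp_all

lemma sum_fun_apply: "(\<Sum>p\<in>F. f p) x = (\<Sum>p\<in>F. f p x)"
  by (induction F rule: infinite_finite_induct) simp_all

lemma scaleC_fun_apply [simp]: "(c *\<^sub>C f) x = c *\<^sub>C f x"
  by (simp add: scaleC_fun_def)

lemma scaleC_complex [simp]: "c *\<^sub>C (x::complex) = c * x"
  by (simp add: scaleC_complex_def)

lemma alg_tensor_carr:
  "t \<in> carr (alg_tensor X Y) \<longleftrightarrow>
     (\<exists>ps. set ps \<subseteq> carr X \<times> carr Y \<and> t = (\<Sum>(x, y)\<leftarrow>ps. elem_tensor X Y x y))"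
  by (auto simp: alg_tensor_def tensor_reps_def)

lemma elem_tensor_carr:
  "x \<in> carr X \<Longrightarrow> y \<in> carr Y \<Longrightarrow> elem_tensor X Y x y \<in> carr (alg_tensor X Y)"
  unfolding alg_tensor_carr by (intro exI[of _ "[(x, y)]"]) simp

lemma tensor_apply:
  "B \<in> bilinear_forms X Y \<Longrightarrow>
     (\<Sum>(x, y)\<leftarrow>ps. elem_tensor X Y x y) B = (\<Sum>(x, y)\<leftarrow>ps. B x y)"
  by (simp add: sum_list_fun_apply case_prod_unfold elem_tensor_def)

lemma nrm_alg_tensor:
  "nrm (alg_tensor X Y) t = (INF ps\<in>tensor_reps X Y t. \<Sum>(x, y)\<leftarrow>ps. nrm X x * nrm Y y)"
  by (simp add: alg_tensor_def)

lemma tensor_reps_append: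
  "ps \<in> tensor_reps X Y s \<Longrightarrow> qs \<in> tensor_reps X Y t \<Longrightarrow> ps @ qs \<in> tensor_reps X Y (s + t)"
  by (auto simp: tensor_reps_def)

text \<open>Tensors are themselves functionals on bilinear forms, so the linearisation of \<open>B\<close> is
  evaluation at \<open>B\<close>.\<close>

definition form_functional where
  "form_functional X Y B = (\<lambda>t. if t \<in> carr (alg_tensor X Y) then t B else 0)"

locale cnormed_pair = X: cnormed_space X + Y: cnormed_space Y
  for X :: "('a::complex_vector, 'm) nspace_scheme" and Y :: "('b::complex_vector, 'n) nspace_scheme"
begin

abbreviation "W \<equiv> alg_tensor X Y"

lemma elem_tensor_scaleC:
  assumes "x \<in> carr X" "y \<in> carr Y"
  shows "elem_tensor X Y (c *\<^sub>C x) y = c *\<^sub>C elem_tensor X Y x y"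
  using assms by (auto simp: fun_eq_iff elem_tensor_def bilinear_forms_def)

lemma tensor_reps_scaleC:
  assumes "ps \<in> tensor_reps X Y t"
  shows "map (\<lambda>(x, y). (c *\<^sub>C x, y)) ps \<in> tensor_reps X Y (c *\<^sub>C t)"
proof -
  have ps: "set ps \<subseteq> carr X \<times> carr Y" and t: "t = (\<Sum>(x, y)\<leftarrow>ps. elem_tensor X Y x y)"
    using assms by (auto simp: tensor_reps_def)
  have "(\<Sum>(x, y)\<leftarrow>map (\<lambda>(x, y). (c *\<^sub>C x, y)) ps. elem_tensor X Y x y)
      = c *\<^sub>C (\<Sum>(x, y)\<leftarrow>ps. elem_tensor X Y x y)"
    using ps by (induction ps)
      (auto simp: elem_tensor_scaleC scaleC_add_right fun_eq_iff algebra_simps)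
  then show ?thesis
    using ps csubspace_scaleC[OF X.csubspace_carr] unfolding t tensor_reps_def by auto
qed

lemma rep_cost_nonneg:
  "set ps \<subseteq> carr X \<times> carr Y \<Longrightarrow> 0 \<le> (\<Sum>(x, y)\<leftarrow>ps. nrm X x * nrm Y y)"
  by (induction ps) (auto simp: X.nrm_nonneg Y.nrm_nonneg)

lemma rep_cost_bdd_below:
  "bdd_below ((\<lambda>ps. \<Sum>(x, y)\<leftarrow>ps. nrm X x * nrm Y y) ` tensor_reps X Y t)"
  by (rule bdd_belowI2[where m = 0]) (auto simp: tensor_reps_def intro: rep_cost_nonneg)

lemma nrm_alg_tensor_le:
  "ps \<in> tensor_reps X Y t \<Longrightarrow> nrm W t \<le> (\<Sum>(x, y)\<leftarrow>ps. nrm X x * nrm Y y)"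
  unfolding nrm_alg_tensor by (rule cINF_lower[OF rep_cost_bdd_below])

lemma nrm_alg_tensor_greatest:
  assumes "t \<in> carr W"
    and "\<And>ps. ps \<in> tensor_reps X Y t \<Longrightarrow> r \<le> (\<Sum>(x, y)\<leftarrow>ps. nrm X x * nrm Y y)"
  shows "r \<le> nrm W t"
  unfolding nrm_alg_tensor using assms by (intro cINF_greatest) (auto simp: alg_tensor_def)

lemma alg_tensor_scaleC_le:
  assumes "t \<in> carr W"
  shows "nrm W (c *\<^sub>C t) \<le> cmod c * nrm W t"
proof (cases "c = 0")
  case True
  have "[] \<in> tensor_reps X Y 0" by (simp add: tensor_reps_def)
  then show ?thesis using nrm_alg_tensor_le[of "[]" 0] True by simp
next
  case False
  have "nrm W (c *\<^sub>C t) / cmod c \<le> nrm W t"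
  proof (rule nrm_alg_tensor_greatest[OF assms])
    fix ps assume ps: "ps \<in> tensor_reps X Y t"
    then have "set ps \<subseteq> carr X \<times> carr Y" by (simp add: tensor_reps_def)
    then have "(\<Sum>(x, y)\<leftarrow>map (\<lambda>(x, y). (c *\<^sub>C x, y)) ps. nrm X x * nrm Y y)
        = cmod c * (\<Sum>(x, y)\<leftarrow>ps. nrm X x * nrm Y y)"
      by (induction ps) (auto simp: X.nrm_scaleC distrib_left)
    then show "nrm W (c *\<^sub>C t) / cmod c \<le> (\<Sum>(x, y)\<leftarrow>ps. nrm X x * nrm Y y)"
      using nrm_alg_tensor_le[OF tensor_reps_scaleC[OF ps, of c]] False by (simp add: field_simps)
  qed
  then show ?thesis using False by (simp add: field_simps)
qed

lemma alg_tensor_csubspace: "csubspace (carr W)"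
  unfolding csubspace_def
proof (intro conjI ballI allI)
  show "0 \<in> carr W" unfolding alg_tensor_carr by (intro exI[of _ "[]"]) simp
  show "s + t \<in> carr W" if "s \<in> carr W" "t \<in> carr W" for s t
    using that tensor_reps_append[of _ X Y s _ t] unfolding alg_tensor_def by fastforce
  show "c *\<^sub>C t \<in> carr W" if "t \<in> carr W" for c t
    using that tensor_reps_scaleC[of _ t c] unfolding alg_tensor_def by fastforce
qed

text \<open>Representations are concatenated for the triangle inequality and scaled in their first factors
  for homogeneity; the reverse inequality for scalars comes from scaling back.\<close>

lemma alg_tensor_seminormed: "cseminormed_space W"
proof
  show "csubspace (carr W)" by (rule alg_tensor_csubspace)
  fix s t c assume s: "s \<in> carr W"
  show "0 \<le> nrm W s"
    by (rule nrm_alg_tensor_greatest[OF s]) (auto simp: tensor_reps_def intro: rep_cost_nonneg)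
  show "nrm W (c *\<^sub>C s) = cmod c * nrm W s"
  proof (cases "c = 0")
    case True
    then show ?thesis
      using alg_tensor_scaleC_le[OF s, of c]
        nrm_alg_tensor_greatest[OF csubspace_zero[OF alg_tensor_csubspace], of 0] rep_cost_nonneg
      by (fastforce simp: tensor_reps_def)
  next
    case False
    then have "nrm W s \<le> cmod (1 / c) * nrm W (c *\<^sub>C s)"
      using alg_tensor_scaleC_le[OF csubspace_scaleC[OF alg_tensor_csubspace s, of c], of "1 / c"]
      by (simp add: scaleC_scaleC scaleC_one)
    then show ?thesis using alg_tensor_scaleC_le[OF s, of c] False
      by (simp add: norm_divide field_simps)
  qed
  assume t: "t \<in> carr W"
  have "nrm W (s + t) - nrm W t \<le> nrm W s"
  proof (rule nrm_alg_tensor_greatest[OF s])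
    fix ps assume ps: "ps \<in> tensor_reps X Y s"
    have "nrm W (s + t) - (\<Sum>(x, y)\<leftarrow>ps. nrm X x * nrm Y y) \<le> nrm W t"
    proof (rule nrm_alg_tensor_greatest[OF t])
      fix qs assume "qs \<in> tensor_reps X Y t"
      from nrm_alg_tensor_le[OF tensor_reps_append[OF ps this]]
      show "nrm W (s + t) - (\<Sum>(x, y)\<leftarrow>ps. nrm X x * nrm Y y) \<le> (\<Sum>(x, y)\<leftarrow>qs. nrm X x * nrm Y y)"
        by simp
    qed
    then show "nrm W (s + t) - nrm W t \<le> (\<Sum>(x, y)\<leftarrow>ps. nrm X x * nrm Y y)" by simp
  qed
  then show "nrm W (s + t) \<le> nrm W s + nrm W t" by simp
qed

text \<open>The bound for \<open>B\<close> passes from elementary tensors to every representation of a tensor, hence to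
  the infimum over its representations.\<close>

lemma form_functional_bounded:
  assumes B: "B \<in> bilinear_forms X Y"
    and K: "\<And>x y. x \<in> carr X \<Longrightarrow> y \<in> carr Y \<Longrightarrow> cmod (B x y) \<le> K * (nrm X x * nrm Y y)"
    and K0: "0 \<le> K"
  shows "form_functional X Y B \<in> carr (dual W)" and "nrm (dual W) (form_functional X Y B) \<le> K"
proof -
  interpret W: cseminormed_space W by (rule alg_tensor_seminormed)
  have le: "cmod (form_functional X Y B t) \<le> K * nrm W t" if t: "t \<in> carr W" for t
  proof (cases "K = 0")
    case False
    then have pos: "K > 0" using K0 by simp
    have "cmod (t B) / K \<le> nrm W t"
    proof (rule nrm_alg_tensor_greatest[OF t])
      fix ps assume "ps \<in> tensor_reps X Y t"
      then have ps: "set ps \<subseteq> carr X \<times> carr Y" and teq: "t = (\<Sum>(x, y)\<leftarrow>ps. elem_tensor X Y x y)"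
        by (auto simp: tensor_reps_def)
      have "cmod (t B) \<le> K * (\<Sum>(x, y)\<leftarrow>ps. nrm X x * nrm Y y)"
        unfolding teq tensor_apply[OF B] using ps
      proof (induction ps)
        case (Cons p ps)
        obtain x y where p: "p = (x, y)" by (cases p)
        have "cmod (B x y) \<le> K * (nrm X x * nrm Y y)" using Cons.prems p by (intro K) auto
        then show ?case using Cons p
            norm_triangle_ineq[of "B x y" "\<Sum>(x, y)\<leftarrow>ps. B x y"] by (simp add: distrib_left)
      qed simp
      then show "cmod (t B) / K \<le> (\<Sum>(x, y)\<leftarrow>ps. nrm X x * nrm Y y)"
        using pos by (simp add: field_simps)
    qed
    then show ?thesis using pos t by (simp add: form_functional_def field_simps)
  next
    case True
    then have "B x y = 0" if "x \<in> carr X" "y \<in> carr Y" for x y using K[OF that] by simp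
    then have "(\<Sum>(x, y)\<leftarrow>ps. B x y) = 0" if "set ps \<subseteq> carr X \<times> carr Y" for ps
      using that by (induction ps) auto
    then have "t B = 0" using t tensor_apply[OF B] unfolding alg_tensor_carr by metis
    then show ?thesis using True t by (simp add: form_functional_def)
  qed
  then show "nrm (dual W) (form_functional X Y B) \<le> K" by (intro W.dual_nrm_le K0)
  show "form_functional X Y B \<in> carr (dual W)"
    unfolding dual_iff
  proof (intro conjI)
    show "\<exists>K. \<forall>t\<in>carr W. cmod (form_functional X Y B t) \<le> K * nrm W t" using le by blast
  qed (auto simp: form_functional_def csubspace_add[OF alg_tensor_csubspace]
      csubspace_scaleC[OF alg_tensor_csubspace])
qed

end

section \<open>The projective tensor product\<close>

context cnormed_pair
begin

abbreviation "T \<equiv> proj_tensor X Y"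

lemma dual_alg_tensor_cnormed: "cnormed_space (dual W)"
  by (rule cseminormed_space.dual_space_cnormed[OF alg_tensor_seminormed])

lemma bidual_alg_tensor_cnormed: "cnormed_space (dual (dual W))"
  by (rule cnormed_space.dual_cnormed_space[OF dual_alg_tensor_cnormed])

lemma evaluation_bidual:
  assumes t: "t \<in> carr W"
  shows "evaluation (carr (dual W)) t \<in> carr (dual (dual W))"
    and "nrm (dual (dual W)) (evaluation (carr (dual W)) t) \<le> nrm W t"
proof -
  interpret W: cseminormed_space W by (rule alg_tensor_seminormed)
  interpret V: cnormed_space "dual W" by (rule dual_alg_tensor_cnormed)
  have le: "cmod (evaluation (carr (dual W)) t \<Phi>) \<le> nrm W t * nrm (dual W) \<Phi>"
    if "\<Phi> \<in> carr (dual W)" for \<Phi>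
    using W.dual_apply_le[OF that t] that by (simp add: evaluation_def mult.commute)
  show "nrm (dual (dual W)) (evaluation (carr (dual W)) t) \<le> nrm W t"
    by (rule V.dual_nrm_le[OF W.nrm_nonneg[OF t] le])
  show "evaluation (carr (dual W)) t \<in> carr (dual (dual W))"
    unfolding dual_iff[of _ "dual W"]
  proof (intro conjI)
    show "\<exists>K. \<forall>\<Phi>\<in>carr (dual W). cmod (evaluation (carr (dual W)) t \<Phi>) \<le> K * nrm (dual W) \<Phi>"
      using le by blast
  qed (use V.csubspace_carr in \<open>auto simp: evaluation_def csubspace_def\<close>)
qed

text \<open>The form in which the closure in the bidual is used: membership is approximability by
  algebraic tensors.\<close>

lemma proj_tensor_carr:
  "u \<in> carr T \<longleftrightarrow> u \<in> carr (dual (dual W)) \<and>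
     (\<forall>e>0. \<exists>t\<in>carr W. nrm (dual (dual W)) (u - evaluation (carr (dual W)) t) < e)"
proof -
  interpret U: cnormed_space "dual (dual W)" by (rule bidual_alg_tensor_cnormed)
  interpret M: Metric_space "carr (dual (dual W))" "ndist (dual (dual W))"
    by (rule U.Metric_space_ndist)
  show ?thesis
    by (auto simp: proj_tensor_def completion_def norm_topology_def M.metric_closure_of ndist_def
        evaluation_bidual)
qed

lemma nrm_proj_tensor: "nrm T = nrm (dual (dual W))"
  by (simp add: proj_tensor_def completion_def)

lemma evaluation_add:
  "s \<in> carr W \<Longrightarrow> t \<in> carr W \<Longrightarrow>
     evaluation (carr (dual W)) (s + t) = evaluation (carr (dual W)) s + evaluation (carr (dual W)) t"
  by (auto simp: fun_eq_iff evaluation_def dual_iff)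

lemma evaluation_scaleC:
  "t \<in> carr W \<Longrightarrow> evaluation (carr (dual W)) (c *\<^sub>C t) = c *\<^sub>C evaluation (carr (dual W)) t"
  by (auto simp: fun_eq_iff evaluation_def dual_iff)

lemma proj_tensor_cnormed: "cnormed_space T"
proof -
  interpret U: cnormed_space "dual (dual W)" by (rule bidual_alg_tensor_cnormed)
  let ?ev = "evaluation (carr (dual W))"
  have sub: "u \<in> carr (dual (dual W))" if "u \<in> carr T" for u using that proj_tensor_carr by blast
  have evU: "?ev t \<in> carr (dual (dual W))" if "t \<in> carr W" for t by (rule evaluation_bidual[OF that])
  note diff = csubspace_diff[OF U.csubspace_carr]
  have "0 \<in> carr T"
    unfolding proj_tensor_carr
  proof (intro conjI allI impI)
    fix e :: real assume "e > 0"
    have "?ev 0 = 0" using evaluation_scaleC[OF csubspace_zero[OF alg_tensor_csubspace], of 0] by simp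
    then show "\<exists>t\<in>carr W. nrm (dual (dual W)) (0 - ?ev t) < e"
      using \<open>e > 0\<close> by (intro bexI[of _ 0] csubspace_zero alg_tensor_csubspace) (simp add: U.nrm_0)
  qed (rule U.zero_carr)
  moreover have "u + v \<in> carr T" if u: "u \<in> carr T" and v: "v \<in> carr T" for u v
    unfolding proj_tensor_carr
  proof (intro conjI allI impI)
    show "u + v \<in> carr (dual (dual W))" by (rule csubspace_add[OF U.csubspace_carr sub[OF u] sub[OF v]])
    fix e :: real assume "e > 0"
    then have "e / 2 > 0" by simp
    then obtain s t where st: "s \<in> carr W" "nrm (dual (dual W)) (u - ?ev s) < e / 2"
      "t \<in> carr W" "nrm (dual (dual W)) (v - ?ev t) < e / 2"
      using u v unfolding proj_tensor_carr by meson
    have eq: "u + v - ?ev (s + t) = (u - ?ev s) + (v - ?ev t)"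
      using st by (simp add: evaluation_add)
    have "nrm (dual (dual W)) (u + v - ?ev (s + t)) < e"
      unfolding eq
      using U.nrm_triangle[OF diff diff, OF sub[OF u] evU[OF st(1)] sub[OF v] evU[OF st(3)]] st
      by linarith
    then show "\<exists>t\<in>carr W. nrm (dual (dual W)) (u + v - ?ev t) < e"
      using st csubspace_add[OF alg_tensor_csubspace] by blast
  qed
  moreover have "c *\<^sub>C u \<in> carr T" if u: "u \<in> carr T" for c u
    unfolding proj_tensor_carr
  proof (intro conjI allI impI)
    show "c *\<^sub>C u \<in> carr (dual (dual W))" by (rule csubspace_scaleC[OF U.csubspace_carr sub[OF u]])
    fix e :: real assume "e > 0"
    then have "e / (cmod c + 1) > 0" by (simp add: add_nonneg_pos)
    then obtain t where t: "t \<in> carr W" "nrm (dual (dual W)) (u - ?ev t) < e / (cmod c + 1)"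
      using u unfolding proj_tensor_carr by meson
    have "c *\<^sub>C u - ?ev (c *\<^sub>C t) = c *\<^sub>C (u - ?ev t)"
      using t by (simp add: evaluation_scaleC fun_eq_iff right_diff_distrib)
    then have "nrm (dual (dual W)) (c *\<^sub>C u - ?ev (c *\<^sub>C t)) = cmod c * nrm (dual (dual W)) (u - ?ev t)"
      using U.nrm_scaleC[OF diff[OF sub[OF u] evU[OF t(1)]]] by simp
    also have "\<dots> \<le> cmod c * (e / (cmod c + 1))" using t by (intro mult_left_mono) auto
    also have "\<dots> < e" using \<open>e > 0\<close> by (simp add: field_simps add_pos_nonneg)
    finally show "\<exists>t\<in>carr W. nrm (dual (dual W)) (c *\<^sub>C u - ?ev t) < e"
      using t csubspace_scaleC[OF alg_tensor_csubspace] by blast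
  qed
  ultimately have "csubspace (carr T)" by (simp add: csubspace_def)
  then show ?thesis
    by unfold_locales (simp_all add: nrm_proj_tensor sub U.nrm_nonneg U.nrm_eq_0_iff U.nrm_triangle
        U.nrm_scaleC)
qed

lemma ptensor_carr:
  assumes "x \<in> carr X" "y \<in> carr Y"
  shows "ptensor X Y x y \<in> carr T" and "nrm T (ptensor X Y x y) \<le> nrm X x * nrm Y y"
proof -
  interpret U: cnormed_space "dual (dual W)" by (rule bidual_alg_tensor_cnormed)
  have e: "elem_tensor X Y x y \<in> carr W" by (rule elem_tensor_carr[OF assms])
  show "ptensor X Y x y \<in> carr T"
    unfolding proj_tensor_carr ptensor_def
    using evaluation_bidual(1)[OF e] e by (auto intro!: bexI[of _ "elem_tensor X Y x y"] simp: U.nrm_0)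
  have "nrm W (elem_tensor X Y x y) \<le> nrm X x * nrm Y y"
    using nrm_alg_tensor_le[of "[(x, y)]" "elem_tensor X Y x y"] assms by (simp add: tensor_reps_def)
  then show "nrm T (ptensor X Y x y) \<le> nrm X x * nrm Y y"
    using evaluation_bidual(2)[OF e] unfolding nrm_proj_tensor ptensor_def by linarith
qed

lemma evaluation_tensor:
  assumes "set ps \<subseteq> carr X \<times> carr Y"
  shows "evaluation (carr (dual W)) (\<Sum>(x, y)\<leftarrow>ps. elem_tensor X Y x y) = (\<Sum>(x, y)\<leftarrow>ps. ptensor X Y x y)"
  using assms
proof (induction ps)
  case Nil
  then show ?case
    using evaluation_scaleC[OF csubspace_zero[OF alg_tensor_csubspace], of 0]
    by (simp add: zero_fun_def)
next
  case (Cons p ps)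
  obtain x y where p: "p = (x, y)" "x \<in> carr X" "y \<in> carr Y" using Cons.prems by auto
  have ps: "(\<Sum>(x, y)\<leftarrow>ps. elem_tensor X Y x y) \<in> carr W"
    using Cons.prems unfolding alg_tensor_carr by auto
  have "evaluation (carr (dual W)) (elem_tensor X Y x y + (\<Sum>(x, y)\<leftarrow>ps. elem_tensor X Y x y))
      = ptensor X Y x y + (\<Sum>(x, y)\<leftarrow>ps. ptensor X Y x y)"
    using Cons.IH Cons.prems
    by (subst evaluation_add[OF elem_tensor_carr[OF p(2,3)] ps]) (simp flip: ptensor_def)
  then show ?case unfolding p(1) list.map sum_list.Cons prod.case .
qed

lemma ptensor_add_left:
  assumes "x \<in> carr X" "x' \<in> carr X" "y \<in> carr Y"
  shows "ptensor X Y (x + x') y = ptensor X Y x y + ptensor X Y x' y"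
proof -
  have "elem_tensor X Y (x + x') y = elem_tensor X Y x y + elem_tensor X Y x' y"
    using assms by (auto simp: fun_eq_iff elem_tensor_def bilinear_forms_def)
  then show ?thesis by (simp add: ptensor_def evaluation_add elem_tensor_carr assms)
qed

lemma ptensor_add_right:
  assumes "x \<in> carr X" "y \<in> carr Y" "y' \<in> carr Y"
  shows "ptensor X Y x (y + y') = ptensor X Y x y + ptensor X Y x y'"
proof -
  have "elem_tensor X Y x (y + y') = elem_tensor X Y x y + elem_tensor X Y x y'"
    using assms by (auto simp: fun_eq_iff elem_tensor_def bilinear_forms_def)
  then show ?thesis by (simp add: ptensor_def evaluation_add elem_tensor_carr assms)
qed

lemma ptensor_scaleC:
  assumes "x \<in> carr X" "y \<in> carr Y"
  shows "ptensor X Y (c *\<^sub>C x) y = c *\<^sub>C ptensor X Y x y"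
    and "ptensor X Y x (c *\<^sub>C y) = c *\<^sub>C ptensor X Y x y"
proof -
  have "elem_tensor X Y (c *\<^sub>C x) y = c *\<^sub>C elem_tensor X Y x y"
    "elem_tensor X Y x (c *\<^sub>C y) = c *\<^sub>C elem_tensor X Y x y"
    using assms by (auto simp: fun_eq_iff elem_tensor_def bilinear_forms_def)
  then show "ptensor X Y (c *\<^sub>C x) y = c *\<^sub>C ptensor X Y x y"
    "ptensor X Y x (c *\<^sub>C y) = c *\<^sub>C ptensor X Y x y"
    by (simp_all add: ptensor_def evaluation_scaleC elem_tensor_carr assms)
qed

lemma proj_tensor_dense:
  assumes "u \<in> carr T" "e > 0"
  obtains ps where "set ps \<subseteq> carr X \<times> carr Y" "nrm T (u - (\<Sum>(x, y)\<leftarrow>ps. ptensor X Y x y)) < e"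
proof -
  obtain t where "t \<in> carr W" "nrm T (u - evaluation (carr (dual W)) t) < e"
    using assms unfolding proj_tensor_carr nrm_proj_tensor by blast
  then show ?thesis using that evaluation_tensor unfolding alg_tensor_carr by metis
qed

text \<open>Bounded linear maps which agree on elementary tensors agree on their span, which is dense.\<close>

lemma proj_tensor_ext:
  assumes Z: "cnormed_space Z"
    and u: "u \<in> bounded_linear_maps T Z" and v: "v \<in> bounded_linear_maps T Z"
    and eq: "\<And>x y. x \<in> carr X \<Longrightarrow> y \<in> carr Y \<Longrightarrow> u (ptensor X Y x y) = v (ptensor X Y x y)"
  shows "u = v"
proof
  fix t
  interpret T: cnormed_space T by (rule proj_tensor_cnormed)
  interpret Z: cnormed_space Z by (rule Z)
  note uD = bounded_linear_mapsD[OF u] and vD = bounded_linear_mapsD[OF v]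
  show "u t = v t"
  proof (cases "t \<in> carr T")
    case t: True
    obtain K where K: "0 \<le> K" "\<And>x. x \<in> carr T \<Longrightarrow> nrm Z (u x) \<le> K * nrm T x"
      using bounded_linear_maps_bound[OF u T.nrm_nonneg] by blast
    obtain L where L: "0 \<le> L" "\<And>x. x \<in> carr T \<Longrightarrow> nrm Z (v x) \<le> L * nrm T x"
      using bounded_linear_maps_bound[OF v T.nrm_nonneg] by blast
    have "nrm Z (u t - v t) \<le> 0 + e" if e: "e > 0" for e
    proof -
      have KL: "K + L + 1 > 0" using K L by simp
      obtain ps where ps: "set ps \<subseteq> carr X \<times> carr Y"
        and d: "nrm T (t - (\<Sum>(x, y)\<leftarrow>ps. ptensor X Y x y)) < e / (K + L + 1)"
        by (rule proj_tensor_dense[OF t, of "e / (K + L + 1)"]) (use e KL in auto)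
      let ?s = "\<Sum>(x, y)\<leftarrow>ps. ptensor X Y x y"
      have s: "?s \<in> carr T"
        using ps by (intro csubspace_sum_list[OF T.csubspace_carr]) (auto simp: ptensor_carr)
      have r: "t - ?s \<in> carr T" by (rule T.carr_diff[OF t s])
      have "u ?s = (\<Sum>p\<leftarrow>ps. u (case p of (x, y) \<Rightarrow> ptensor X Y x y))"
        using ps by (intro bounded_linear_maps_sum_list[OF u T.csubspace_carr]) (auto simp: ptensor_carr)
      also have "\<dots> = (\<Sum>p\<leftarrow>ps. v (case p of (x, y) \<Rightarrow> ptensor X Y x y))"
        using ps eq by (intro arg_cong[where f = sum_list] map_cong) auto
      also have "\<dots> = v ?s"
        using ps by (intro bounded_linear_maps_sum_list[OF v T.csubspace_carr, symmetric])
          (auto simp: ptensor_carr)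
      finally have "u t - v t = u (t - ?s) + (-1) *\<^sub>C v (t - ?s)"
        unfolding bounded_linear_maps_diff[OF u T.csubspace_carr t s]
          bounded_linear_maps_diff[OF v T.csubspace_carr t s] by (simp add: scaleC_minus1_left)
      then have "nrm Z (u t - v t) \<le> nrm Z (u (t - ?s)) + nrm Z ((-1) *\<^sub>C v (t - ?s))"
        using Z.nrm_triangle[OF uD(2)[OF r] csubspace_scaleC[OF Z.csubspace_carr vD(2)[OF r], of "-1"]]
        by simp
      also have "\<dots> = nrm Z (u (t - ?s)) + nrm Z (v (t - ?s))"
        using Z.nrm_scaleC[OF vD(2)[OF r], of "-1"] by simp
      also have "\<dots> \<le> (K + L) * nrm T (t - ?s)"
        using K(2)[OF r] L(2)[OF r] by (simp add: distrib_right)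
      also have "\<dots> \<le> (K + L) * (e / (K + L + 1))" using d K L by (intro mult_left_mono) auto
      also have "\<dots> \<le> e" using e KL by (simp add: field_simps)
      finally show ?thesis by simp
    qed
    then have "nrm Z (u t - v t) \<le> 0" by (rule field_le_epsilon)
    moreover have c: "u t - v t \<in> carr Z" by (rule Z.carr_diff[OF uD(2)[OF t] vD(2)[OF t]])
    ultimately have "u t - v t = 0" using Z.nrm_eq_0_iff[OF c] Z.nrm_nonneg[OF c] by simp
    then show ?thesis by simp
  qed (simp add: uD(1) vD(1))
qed

lemma proj_lift_eq:
  assumes "cnormed_space Z" and "u \<in> bounded_linear_maps T Z"
    and "\<And>x y. x \<in> carr X \<Longrightarrow> y \<in> carr Y \<Longrightarrow> u (ptensor X Y x y) = \<beta> x y"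
  shows "proj_lift X Y Z \<beta> = u"
  unfolding proj_lift_def
  using assms by (intro the_equality) (auto intro: proj_tensor_ext[OF assms(1)])

text \<open>Composing \<open>\<beta>\<close> with evaluation at \<open>\<psi>\<close> gives a bounded bilinear form and so a functional \<open>\<Phi> \<psi>\<close> on
  the algebraic tensor product, which elements of the projective tensor product, being functionals on
  such functionals, can be applied to.  This gives the lift by a formula instead of by extension from a
  dense subspace.\<close>

lemma proj_lift_dual:
  assumes Q: "cnormed_space Q"
    and closed: "\<And>x y. x \<in> carr X \<Longrightarrow> y \<in> carr Y \<Longrightarrow> \<beta> x y \<in> carr (dual Q)"
    and add_left: "\<And>x x' y. x \<in> carr X \<Longrightarrow> x' \<in> carr X \<Longrightarrow> y \<in> carr Y \<Longrightarrow>
      \<beta> (x + x') y = \<beta> x y + \<beta> x' y"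
    and add_right: "\<And>x y y'. x \<in> carr X \<Longrightarrow> y \<in> carr Y \<Longrightarrow> y' \<in> carr Y \<Longrightarrow>
      \<beta> x (y + y') = \<beta> x y + \<beta> x y'"
    and scaleC: "\<And>c x y. x \<in> carr X \<Longrightarrow> y \<in> carr Y \<Longrightarrow>
      \<beta> (c *\<^sub>C x) y = c *\<^sub>C \<beta> x y \<and> \<beta> x (c *\<^sub>C y) = c *\<^sub>C \<beta> x y"
    and K: "0 \<le> K" "\<And>x y. x \<in> carr X \<Longrightarrow> y \<in> carr Y \<Longrightarrow>
      nrm (dual Q) (\<beta> x y) \<le> K * (nrm X x * nrm Y y)"
  obtains u where "u \<in> bounded_linear_maps T (dual Q)"
    and "\<And>x y. x \<in> carr X \<Longrightarrow> y \<in> carr Y \<Longrightarrow> u (ptensor X Y x y) = \<beta> x y"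
proof -
  interpret Q: cnormed_space Q by (rule Q)
  interpret V: cnormed_space "dual W" by (rule dual_alg_tensor_cnormed)
  interpret T: cnormed_space T by (rule proj_tensor_cnormed)
  define B where "B \<psi> = (\<lambda>x y. if x \<in> carr X \<and> y \<in> carr Y then \<beta> x y \<psi> else 0)" for \<psi>
  define \<Phi> where "\<Phi> \<psi> = form_functional X Y (B \<psi>)" for \<psi>
  have B: "B \<psi> \<in> bilinear_forms X Y" for \<psi>
    unfolding bilinear_forms_def B_def
    by (auto simp: add_left add_right scaleC csubspace_add[OF X.csubspace_carr]
        csubspace_add[OF Y.csubspace_carr] csubspace_scaleC[OF X.csubspace_carr]
        csubspace_scaleC[OF Y.csubspace_carr])
  have Ble: "cmod (B \<psi> x y) \<le> (K * nrm Q \<psi>) * (nrm X x * nrm Y y)"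
    if "\<psi> \<in> carr Q" "x \<in> carr X" "y \<in> carr Y" for \<psi> x y
    using order_trans[OF Q.dual_apply_le[OF closed[OF that(2,3)] that(1)]
        mult_right_mono[OF K(2)[OF that(2,3)] Q.nrm_nonneg[OF that(1)]]] that
    by (simp add: B_def mult_ac)
  have \<Phi>: "\<Phi> \<psi> \<in> carr (dual W)" "nrm (dual W) (\<Phi> \<psi>) \<le> K * nrm Q \<psi>" if "\<psi> \<in> carr Q" for \<psi>
    unfolding \<Phi>_def using form_functional_bounded[OF B Ble[OF that]] K(1) Q.nrm_nonneg[OF that] by simp_all
  have \<Phi>_add: "\<Phi> (\<psi> + \<psi>') = \<Phi> \<psi> + \<Phi> \<psi>'" if \<psi>: "\<psi> \<in> carr Q" "\<psi>' \<in> carr Q" for \<psi> \<psi>'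
  proof
    fix t
    have b: "B (\<psi> + \<psi>') x y = B \<psi> x y + B \<psi>' x y" for x y
      using closed \<psi> by (auto simp: B_def dual_iff)
    show "\<Phi> (\<psi> + \<psi>') t = (\<Phi> \<psi> + \<Phi> \<psi>') t"
      by (auto simp: \<Phi>_def form_functional_def alg_tensor_carr sum_list_fun_apply elem_tensor_def B b
          case_prod_unfold sum_list_addf)
  qed
  have \<Phi>_scaleC: "\<Phi> (c *\<^sub>C \<psi>) = c *\<^sub>C \<Phi> \<psi>" if \<psi>: "\<psi> \<in> carr Q" for \<psi> c
  proof
    fix t
    have b: "B (c *\<^sub>C \<psi>) x y = c * B \<psi> x y" for x y
      using closed \<psi> by (auto simp: B_def dual_iff)
    show "\<Phi> (c *\<^sub>C \<psi>) t = (c *\<^sub>C \<Phi> \<psi>) t"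
      by (auto simp: \<Phi>_def form_functional_def alg_tensor_carr sum_list_fun_apply elem_tensor_def B b
          case_prod_unfold sum_list_const_mult)
  qed
  define u where "u t = (if t \<in> carr T then (\<lambda>\<psi>. if \<psi> \<in> carr Q then t (\<Phi> \<psi>) else 0) else 0)" for t
  have bidual: "t \<in> carr (dual (dual W))" if "t \<in> carr T" for t using that proj_tensor_carr by blast
  have ule: "cmod (u t \<psi>) \<le> K * nrm T t * nrm Q \<psi>" if t: "t \<in> carr T" and \<psi>: "\<psi> \<in> carr Q" for t \<psi>
    using order_trans[OF V.dual_apply_le[OF bidual[OF t] \<Phi>(1)[OF \<psi>]]
        mult_left_mono[OF \<Phi>(2)[OF \<psi>] T.nrm_nonneg[OF t, unfolded nrm_proj_tensor]]] t \<psi>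
    by (simp add: u_def nrm_proj_tensor mult_ac)
  have ucarr: "u t \<in> carr (dual Q)" if t: "t \<in> carr T" for t
    unfolding dual_iff
  proof (intro conjI)
    show "\<exists>K. \<forall>\<psi>\<in>carr Q. cmod (u t \<psi>) \<le> K * nrm Q \<psi>" using ule[OF t] by blast
  qed (use t bidual[OF t] in \<open>auto simp: u_def dual_iff[of _ "dual W"] \<Phi>_add \<Phi>_scaleC \<Phi>
        csubspace_add[OF Q.csubspace_carr] csubspace_scaleC[OF Q.csubspace_carr]\<close>)
  have "u \<in> bounded_linear_maps T (dual Q)"
    unfolding bounded_linear_maps_def
  proof (intro CollectI conjI)
    have "nrm (dual Q) (u t) \<le> K * nrm T t" if "t \<in> carr T" for t
      using ule[OF that] K(1) T.nrm_nonneg[OF that] by (intro Q.dual_nrm_le) auto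
    then show "\<exists>K. \<forall>t\<in>carr T. nrm (dual Q) (u t) \<le> K * nrm T t" by blast
  qed (use ucarr in \<open>auto simp: u_def fun_eq_iff csubspace_add[OF T.csubspace_carr]
        csubspace_scaleC[OF T.csubspace_carr]\<close>)
  moreover have "u (ptensor X Y x y) = \<beta> x y" if xy: "x \<in> carr X" "y \<in> carr Y" for x y
  proof
    fix \<psi>
    show "u (ptensor X Y x y) \<psi> = \<beta> x y \<psi>"
    proof (cases "\<psi> \<in> carr Q")
      case True
      then have "u (ptensor X Y x y) \<psi> = \<Phi> \<psi> (elem_tensor X Y x y)"
        by (simp add: u_def ptensor_carr(1)[OF xy]) (simp add: ptensor_def evaluation_def \<Phi>)
      also have "\<dots> = elem_tensor X Y x y (B \<psi>)"
        using xy by (simp add: \<Phi>_def form_functional_def elem_tensor_carr)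
      also have "\<dots> = B \<psi> x y" by (simp add: elem_tensor_def B)
      also have "\<dots> = \<beta> x y \<psi>" using xy by (simp add: B_def)
      finally show ?thesis .
    next
      case False
      then show ?thesis using xy closed[OF xy] by (simp add: u_def ptensor_carr dual_iff)
    qed
  qed
  ultimately show ?thesis by (rule that)
qed

end

section \<open>Bounded linear maps on the projective tensor product\<close>

lemma bounded_linear_maps_csubspace:
  assumes X: "cnormed_space X" and Z: "cnormed_space Z"
  shows "csubspace (bounded_linear_maps X Z)"
proof -
  interpret X: cnormed_space X by (rule X)
  interpret Z: cnormed_space Z by (rule Z)
  have "0 \<in> bounded_linear_maps X Z"
    unfolding bounded_linear_maps_def
    by (auto simp: Z.zero_carr Z.nrm_0 scaleC_0_right intro!: exI[of _ 0])
  moreover have "u + v \<in> bounded_linear_maps X Z"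
    if u: "u \<in> bounded_linear_maps X Z" and v: "v \<in> bounded_linear_maps X Z" for u v
  proof -
    note uD = bounded_linear_mapsD[OF u] and vD = bounded_linear_mapsD[OF v]
    obtain K where K: "\<And>x. x \<in> carr X \<Longrightarrow> nrm Z (u x) \<le> K * nrm X x"
      using bounded_linear_maps_bound[OF u X.nrm_nonneg] by blast
    obtain L where L: "\<And>x. x \<in> carr X \<Longrightarrow> nrm Z (v x) \<le> L * nrm X x"
      using bounded_linear_maps_bound[OF v X.nrm_nonneg] by blast
    have "nrm Z ((u + v) x) \<le> (K + L) * nrm X x" if x: "x \<in> carr X" for x
      using Z.nrm_triangle[OF uD(2)[OF x] vD(2)[OF x]] K[OF x] L[OF x] by (simp add: distrib_right)
    then have "\<exists>K. \<forall>x\<in>carr X. nrm Z ((u + v) x) \<le> K * nrm X x" by blast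
    then show ?thesis unfolding bounded_linear_maps_def
      by (auto simp: uD vD csubspace_add[OF Z.csubspace_carr] scaleC_add_right)
  qed
  moreover have "c *\<^sub>C u \<in> bounded_linear_maps X Z" if u: "u \<in> bounded_linear_maps X Z" for u c
  proof -
    note uD = bounded_linear_mapsD[OF u]
    obtain K where K: "\<And>x. x \<in> carr X \<Longrightarrow> nrm Z (u x) \<le> K * nrm X x"
      using bounded_linear_maps_bound[OF u X.nrm_nonneg] by blast
    have "nrm Z ((c *\<^sub>C u) x) \<le> cmod c * K * nrm X x" if x: "x \<in> carr X" for x
      using mult_left_mono[OF K[OF x] norm_ge_zero[of c]] by (simp add: Z.nrm_scaleC uD x mult.assoc)
    then have "\<exists>K. \<forall>x\<in>carr X. nrm Z ((c *\<^sub>C u) x) \<le> K * nrm X x" by blast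
    then show ?thesis unfolding bounded_linear_maps_def
      by (auto simp: uD csubspace_scaleC[OF Z.csubspace_carr] scaleC_add_right scaleC_0_right
          scaleC_scaleC mult.commute)
  qed
  ultimately show ?thesis by (simp add: csubspace_def)
qed

text \<open>The lift of a map with values in \<open>T\<close> is a priori only bidual valued.  As \<open>T\<close> is
  closed and contains the images of a dense subspace, it contains all images.\<close>

lemma (in cnormed_pair) bounded_linear_maps_into_proj_tensor:
  assumes u: "u \<in> bounded_linear_maps T (dual (dual W))"
    and ptensor: "\<And>x y. x \<in> carr X \<Longrightarrow> y \<in> carr Y \<Longrightarrow> u (ptensor X Y x y) \<in> carr T"
  shows "u \<in> bounded_linear_maps T T"
proof -
  interpret U: cnormed_space "dual (dual W)" by (rule bidual_alg_tensor_cnormed)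
  interpret T: cnormed_space T by (rule proj_tensor_cnormed)
  note uD = bounded_linear_mapsD[OF u]
  let ?ev = "evaluation (carr (dual W))"
  obtain K where K: "0 \<le> K" "\<And>x. x \<in> carr T \<Longrightarrow> nrm T (u x) \<le> K * nrm T x"
    using bounded_linear_maps_bound[OF u T.nrm_nonneg] unfolding nrm_proj_tensor by blast
  have "u t \<in> carr T" if t: "t \<in> carr T" for t
    unfolding proj_tensor_carr
  proof (intro conjI allI impI)
    show "u t \<in> carr (dual (dual W))" by (rule uD(2)[OF t])
    fix e :: real assume e: "e > 0"
    have K1: "2 * (K + 1) > 0" using K(1) by simp
    obtain ps where ps: "set ps \<subseteq> carr X \<times> carr Y"
      and d: "nrm T (t - (\<Sum>(x, y)\<leftarrow>ps. ptensor X Y x y)) < e / (2 * (K + 1))"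
      by (rule proj_tensor_dense[OF t, of "e / (2 * (K + 1))"]) (use e K1 in auto)
    let ?s = "\<Sum>(x, y)\<leftarrow>ps. ptensor X Y x y"
    have s: "?s \<in> carr T"
      using ps by (intro csubspace_sum_list[OF T.csubspace_carr]) (auto simp: ptensor_carr)
    have r: "t - ?s \<in> carr T" by (rule T.carr_diff[OF t s])
    have "u ?s = (\<Sum>p\<leftarrow>ps. u (case p of (x, y) \<Rightarrow> ptensor X Y x y))"
      using ps by (intro bounded_linear_maps_sum_list[OF u T.csubspace_carr]) (auto simp: ptensor_carr)
    also have "\<dots> \<in> carr T"
      using ps by (intro csubspace_sum_list[OF T.csubspace_carr]) (auto simp: ptensor)
    finally have us: "u ?s \<in> carr T" .
    then obtain w where w: "w \<in> carr W" "nrm T (u ?s - ?ev w) < e / 2"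
      unfolding proj_tensor_carr nrm_proj_tensor using half_gt_zero[OF e] by blast
    have eq: "u t - ?ev w = u (t - ?s) + (u ?s - ?ev w)"
      unfolding bounded_linear_maps_diff[OF u T.csubspace_carr t s] by simp
    have "nrm T (u t - ?ev w) \<le> nrm T (u (t - ?s)) + nrm T (u ?s - ?ev w)"
      unfolding eq nrm_proj_tensor using w
      by (intro U.nrm_triangle uD(2)[OF r] U.carr_diff uD(2)[OF s] evaluation_bidual)
    moreover have "nrm T (u (t - ?s)) \<le> K * (e / (2 * (K + 1)))"
      using K(2)[OF r] mult_left_mono[OF less_imp_le[OF d] K(1)] by linarith
    moreover have "K * (e / (2 * (K + 1))) \<le> e / 2"
      using e K(1) by (simp add: field_simps)
    ultimately have "nrm T (u t - ?ev w) < e" using w(2) by linarith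
    then show "\<exists>w\<in>carr W. nrm (dual (dual W)) (u t - ?ev w) < e"
      using w(1) unfolding nrm_proj_tensor by blast
  qed
  then show ?thesis using u unfolding bounded_linear_maps_def nrm_proj_tensor by auto
qed

text \<open>The map \<open>f \<otimes> g\<close>; both module actions are of this form, with one factor the identity.\<close>

lemma (in cnormed_pair) proj_tensor_map:
  assumes f: "f \<in> bounded_linear_maps X X" and g: "g \<in> bounded_linear_maps Y Y"
  obtains u where "u \<in> bounded_linear_maps T T"
    and "\<And>x y. x \<in> carr X \<Longrightarrow> y \<in> carr Y \<Longrightarrow> u (ptensor X Y x y) = ptensor X Y (f x) (g y)"
proof -
  note fD = bounded_linear_mapsD[OF f] and gD = bounded_linear_mapsD[OF g]
  obtain K where K: "0 \<le> K" "\<And>x. x \<in> carr X \<Longrightarrow> nrm X (f x) \<le> K * nrm X x"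
    using bounded_linear_maps_bound[OF f X.nrm_nonneg] by blast
  obtain L where L: "0 \<le> L" "\<And>y. y \<in> carr Y \<Longrightarrow> nrm Y (g y) \<le> L * nrm Y y"
    using bounded_linear_maps_bound[OF g Y.nrm_nonneg] by blast
  have le: "nrm (dual (dual W)) (ptensor X Y (f x) (g y)) \<le> (K * L) * (nrm X x * nrm Y y)"
    if "x \<in> carr X" "y \<in> carr Y" for x y
  proof -
    have "nrm T (ptensor X Y (f x) (g y)) \<le> nrm X (f x) * nrm Y (g y)"
      using that fD gD by (intro ptensor_carr) auto
    also have "\<dots> \<le> (K * nrm X x) * (L * nrm Y y)"
      using that K L fD gD X.nrm_nonneg Y.nrm_nonneg by (intro mult_mono) auto
    finally show ?thesis by (simp add: nrm_proj_tensor mult_ac)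
  qed
  have bidual: "t \<in> carr (dual (dual W))" if "t \<in> carr T" for t using that proj_tensor_carr by blast
  obtain u where u: "u \<in> bounded_linear_maps T (dual (dual W))"
    and up: "\<And>x y. x \<in> carr X \<Longrightarrow> y \<in> carr Y \<Longrightarrow> u (ptensor X Y x y) = ptensor X Y (f x) (g y)"
    by (rule proj_lift_dual[OF dual_alg_tensor_cnormed, of "\<lambda>x y. ptensor X Y (f x) (g y)" "K * L"])
      (auto simp: fD gD ptensor_add_left ptensor_add_right ptensor_scaleC K L le bidual ptensor_carr)
  show ?thesis
    by (rule that[OF bounded_linear_maps_into_proj_tensor[OF u] up]) (auto simp: up fD gD ptensor_carr)
qed

section \<open>The bimodule structure of the projective tensor square\<close>

lemma dual_cong: "carr X = carr Y \<Longrightarrow> nrm X = nrm Y \<Longrightarrow> dual X = dual Y"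
  by (simp add: dual_def bounded_linear_maps_def)

lemma cnormed_space_cong:
  "carr X = carr Y \<Longrightarrow> nrm X = nrm Y \<Longrightarrow> cnormed_space X \<longleftrightarrow> cnormed_space Y"
  by (simp add: cnormed_space_def)

context cbanach_algebra
begin

sublocale tensor: cnormed_pair A A ..

abbreviation "TB \<equiv> tensor_bimodule A"

lemma carr_tensor_bimodule [simp]: "carr TB = carr tensor.T" "nrm TB = nrm tensor.T"
  by (simp_all add: tensor_bimodule_def)

lemma left_multiplication:
  "a \<in> carr A \<Longrightarrow> (\<lambda>x. if x \<in> carr A then mult A a x else 0) \<in> bounded_linear_maps A A"
  unfolding bounded_linear_maps_def
  by (auto simp: mult_closed mult_add_right mult_scaleC_right csubspace_add[OF csubspace_carr]
      csubspace_scaleC[OF csubspace_carr] intro: nrm_mult)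

lemma right_multiplication:
  "a \<in> carr A \<Longrightarrow> (\<lambda>x. if x \<in> carr A then mult A x a else 0) \<in> bounded_linear_maps A A"
  unfolding bounded_linear_maps_def
  by (auto simp: mult_closed mult_add_left mult_scaleC_left csubspace_add[OF csubspace_carr]
      csubspace_scaleC[OF csubspace_carr] intro!: exI[of _ "nrm A a"] intro: nrm_mult
      simp: mult.commute[of "nrm A a"])

lemma carrier_identity: "(\<lambda>x. if x \<in> carr A then x else 0) \<in> bounded_linear_maps A A"
  unfolding bounded_linear_maps_def
  by (auto simp: csubspace_add[OF csubspace_carr] csubspace_scaleC[OF csubspace_carr]
      intro!: exI[of _ 1])

lemma tensor_lact:
  assumes a: "a \<in> carr A"
  shows "lact TB a \<in> bounded_linear_maps tensor.T tensor.T"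
    and "b \<in> carr A \<Longrightarrow> c \<in> carr A \<Longrightarrow> lact TB a (ptensor A A b c) = ptensor A A (mult A a b) c"
proof -
  obtain u where u: "u \<in> bounded_linear_maps tensor.T tensor.T"
    "\<And>b c. b \<in> carr A \<Longrightarrow> c \<in> carr A \<Longrightarrow> u (ptensor A A b c) = ptensor A A (mult A a b) c"
    using tensor.proj_tensor_map[OF left_multiplication[OF a] carrier_identity] by auto
  have "lact TB a = u"
    using tensor.proj_lift_eq[OF tensor.proj_tensor_cnormed u] by (simp add: tensor_bimodule_def)
  with u show "lact TB a \<in> bounded_linear_maps tensor.T tensor.T"
    and "b \<in> carr A \<Longrightarrow> c \<in> carr A \<Longrightarrow> lact TB a (ptensor A A b c) = ptensor A A (mult A a b) c"
    by simp_all
qed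

lemma tensor_ract:
  assumes a: "a \<in> carr A"
  shows "(\<lambda>t. ract TB t a) \<in> bounded_linear_maps tensor.T tensor.T"
    and "b \<in> carr A \<Longrightarrow> c \<in> carr A \<Longrightarrow> ract TB (ptensor A A b c) a = ptensor A A b (mult A c a)"
proof -
  obtain u where u: "u \<in> bounded_linear_maps tensor.T tensor.T"
    "\<And>b c. b \<in> carr A \<Longrightarrow> c \<in> carr A \<Longrightarrow> u (ptensor A A b c) = ptensor A A b (mult A c a)"
    using tensor.proj_tensor_map[OF carrier_identity right_multiplication[OF a]] by auto
  have eq: "(\<lambda>t. ract TB t a) = u"
    using tensor.proj_lift_eq[OF tensor.proj_tensor_cnormed u] by (simp add: tensor_bimodule_def)
  show "(\<lambda>t. ract TB t a) \<in> bounded_linear_maps tensor.T tensor.T" unfolding eq by (rule u(1))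
  show "ract TB (ptensor A A b c) a = ptensor A A b (mult A c a)" if "b \<in> carr A" "c \<in> carr A"
    using u(2)[OF that] fun_cong[OF eq] by simp
qed

text \<open>Linearity in the algebra variable is not visible in the lift, but both sides are bounded linear
  in \<open>t\<close> and can be compared on elementary tensors.\<close>

lemma tensor_lact_linear:
  assumes a: "a \<in> carr A"
  shows "b \<in> carr A \<Longrightarrow> lact TB (a + b) t = lact TB a t + lact TB b t"
    and "lact TB (c *\<^sub>C a) t = c *\<^sub>C lact TB a t"
proof -
  note sub = bounded_linear_maps_csubspace[OF tensor.proj_tensor_cnormed tensor.proj_tensor_cnormed]
  note cl = csubspace_add[OF csubspace_carr] csubspace_scaleC[OF csubspace_carr]
  have "lact TB (a + b) = lact TB a + lact TB b" if b: "b \<in> carr A"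
    by (rule tensor.proj_tensor_ext[OF tensor.proj_tensor_cnormed])
      (use a b in \<open>auto simp: tensor_lact cl csubspace_add[OF sub] mult_add_left
        tensor.ptensor_add_left mult_closed\<close>)
  then show "lact TB (a + b) t = lact TB a t + lact TB b t" if "b \<in> carr A" using that by simp
  have "lact TB (c *\<^sub>C a) = c *\<^sub>C lact TB a"
    by (rule tensor.proj_tensor_ext[OF tensor.proj_tensor_cnormed])
      (use a in \<open>auto simp: tensor_lact cl csubspace_scaleC[OF sub] mult_scaleC_left
        tensor.ptensor_scaleC mult_closed\<close>)
  then show "lact TB (c *\<^sub>C a) t = c *\<^sub>C lact TB a t" by simp
qed

lemma tensor_ract_linear:
  assumes a: "a \<in> carr A"
  shows "b \<in> carr A \<Longrightarrow> ract TB t (a + b) = ract TB t a + ract TB t b"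
    and "ract TB t (c *\<^sub>C a) = c *\<^sub>C ract TB t a"
proof -
  note sub = bounded_linear_maps_csubspace[OF tensor.proj_tensor_cnormed tensor.proj_tensor_cnormed]
  note cl = csubspace_add[OF csubspace_carr] csubspace_scaleC[OF csubspace_carr]
  have "(\<lambda>t. ract TB t (a + b)) = (\<lambda>t. ract TB t a) + (\<lambda>t. ract TB t b)" if b: "b \<in> carr A"
    by (rule tensor.proj_tensor_ext[OF tensor.proj_tensor_cnormed tensor_ract(1)
          csubspace_add[OF sub tensor_ract(1) tensor_ract(1)]])
      (use a b in \<open>auto simp: tensor_ract(2) cl mult_add_right tensor.ptensor_add_right mult_closed\<close>)
  from fun_cong[OF this, of t] show "ract TB t (a + b) = ract TB t a + ract TB t b" if "b \<in> carr A"
    using that by simp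
  have "(\<lambda>t. ract TB t (c *\<^sub>C a)) = c *\<^sub>C (\<lambda>t. ract TB t a)"
    by (rule tensor.proj_tensor_ext[OF tensor.proj_tensor_cnormed tensor_ract(1)
          csubspace_scaleC[OF sub tensor_ract(1)]])
      (use a in \<open>auto simp: tensor_ract(2) cl mult_scaleC_right tensor.ptensor_scaleC mult_closed\<close>)
  from fun_cong[OF this, of t] show "ract TB t (c *\<^sub>C a) = c *\<^sub>C ract TB t a" by simp
qed

lemma dual_tensor_bimodule: "dual TB = dual tensor.T"
  by (rule dual_cong) simp_all

lemma dual_tensor_lact:
  assumes \<phi>: "\<phi> \<in> carr (dual tensor.T)" and a: "a \<in> carr A"
  shows "lact (dual_bimodule TB) a \<phi> \<in> carr (dual tensor.T)"
    and "ract (dual_bimodule TB) \<phi> a \<in> carr (dual tensor.T)"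
proof -
  interpret T: cnormed_space tensor.T by (rule tensor.proj_tensor_cnormed)
  note comp = bounded_linear_maps_compose[OF _ \<phi>[unfolded dual_def, simplified] T.csubspace_carr
      T.nrm_nonneg T.nrm_nonneg]
  show "lact (dual_bimodule TB) a \<phi> \<in> carr (dual tensor.T)"
    using comp[OF tensor_ract(1)[OF a]] by (simp add: dual_bimodule_def dual_def)
  show "ract (dual_bimodule TB) \<phi> a \<in> carr (dual tensor.T)"
    using comp[OF tensor_lact(1)[OF a]] by (simp add: dual_bimodule_def dual_def)
qed

lemma dual_tensor_linear:
  assumes \<phi>: "\<phi> \<in> carr (dual tensor.T)" and a: "a \<in> carr A"
  shows "b \<in> carr A \<Longrightarrow> lact (dual_bimodule TB) (a + b) \<phi>
      = lact (dual_bimodule TB) a \<phi> + lact (dual_bimodule TB) b \<phi>"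
    and "lact (dual_bimodule TB) (c *\<^sub>C a) \<phi> = c *\<^sub>C lact (dual_bimodule TB) a \<phi>"
    and "b \<in> carr A \<Longrightarrow> ract (dual_bimodule TB) \<phi> (a + b)
      = ract (dual_bimodule TB) \<phi> a + ract (dual_bimodule TB) \<phi> b"
    and "ract (dual_bimodule TB) \<phi> (c *\<^sub>C a) = c *\<^sub>C ract (dual_bimodule TB) \<phi> a"
proof -
  have add: "\<And>s t. s \<in> carr tensor.T \<Longrightarrow> t \<in> carr tensor.T \<Longrightarrow> \<phi> (s + t) = \<phi> s + \<phi> t"
    and scaleC: "\<And>s c. s \<in> carr tensor.T \<Longrightarrow> \<phi> (c *\<^sub>C s) = c * \<phi> s"
    using \<phi> unfolding dual_iff by blast+
  note cl = bounded_linear_mapsD(2)[OF tensor_lact(1)] bounded_linear_mapsD(2)[OF tensor_ract(1)]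
  note simps = dual_bimodule_def[of TB] tensor_lact_linear[OF a] tensor_ract_linear[OF a]
    add scaleC cl a
  show "b \<in> carr A \<Longrightarrow> lact (dual_bimodule TB) (a + b) \<phi>
      = lact (dual_bimodule TB) a \<phi> + lact (dual_bimodule TB) b \<phi>"
    "lact (dual_bimodule TB) (c *\<^sub>C a) \<phi> = c *\<^sub>C lact (dual_bimodule TB) a \<phi>"
    "b \<in> carr A \<Longrightarrow> ract (dual_bimodule TB) \<phi> (a + b)
      = ract (dual_bimodule TB) \<phi> a + ract (dual_bimodule TB) \<phi> b"
    "ract (dual_bimodule TB) \<phi> (c *\<^sub>C a) = c *\<^sub>C ract (dual_bimodule TB) \<phi> a"
    by (rule ext; simp add: simps)+
qed

end

section \<open>Weak continuity\<close>

lemma topspace_sigma_topology: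
  "\<Phi> \<noteq> {} \<Longrightarrow> topspace (sigma_topology S \<Phi>) = S"
  unfolding sigma_topology_def topology_generated_by_topspace by (auto intro: exI[of _ UNIV])

lemma openin_sigma_topology:
  "\<phi> \<in> \<Phi> \<Longrightarrow> open U \<Longrightarrow> openin (sigma_topology S \<Phi>) {x \<in> S. \<phi> x \<in> U}"
  unfolding sigma_topology_def by (rule topology_generated_by_Basis) blast

lemma zero_dual: "0 \<in> carr (dual X)"
  unfolding dual_iff by (auto intro!: exI[of _ 0])

text \<open>Continuity into a weak topology is tested on functionals.  Where these pull back to functionals
  from \<open>P\<close>, the preimages of subbasic sets are themselves subbasic.\<close>

lemma continuous_into_weak_topology:
  assumes P: "P \<noteq> {}" and f: "\<And>a. a \<in> S \<Longrightarrow> f a \<in> carr E"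
    and \<Lambda>: "\<And>\<Lambda>. \<Lambda> \<in> carr (dual E) \<Longrightarrow> \<exists>\<phi>\<in>P. \<forall>a\<in>S. \<Lambda> (f a) = \<phi> a"
  shows "continuous_map (sigma_topology S P) (weak_topology E) f"
  unfolding weak_topology_def sigma_topology_def[of "carr E"] continuous_on_generated_topo_iff
proof (intro conjI allI impI)
  fix V assume "V \<in> {{x \<in> carr E. \<Lambda> x \<in> U} |\<Lambda> U. \<Lambda> \<in> carr (dual E) \<and> open U}"
  then obtain \<Lambda> U where V: "V = {x \<in> carr E. \<Lambda> x \<in> U}" and L: "\<Lambda> \<in> carr (dual E)" and U: "open U"
    by blast
  obtain \<phi> where \<phi>: "\<phi> \<in> P" "\<And>a. a \<in> S \<Longrightarrow> \<Lambda> (f a) = \<phi> a" using \<Lambda>[OF L] by blast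
  have "f -` V \<inter> topspace (sigma_topology S P) = {a \<in> S. \<phi> a \<in> U}"
    using f \<phi>(2) by (auto simp: V topspace_sigma_topology[OF P])
  then show "openin (sigma_topology S P) (f -` V \<inter> topspace (sigma_topology S P))"
    using openin_sigma_topology[OF \<phi>(1) U] by simp
next
  have "carr E \<in> {{x \<in> carr E. \<Lambda> x \<in> U} |\<Lambda> U. \<Lambda> \<in> carr (dual E) \<and> open U}"
    using zero_dual[of E] by (intro CollectI exI[of _ 0] exI[of _ UNIV]) auto
  then show "f ` topspace (sigma_topology S P)
      \<subseteq> \<Union> {{x \<in> carr E. \<Lambda> x \<in> U} |\<Lambda> U. \<Lambda> \<in> carr (dual E) \<and> open U}"
    using f by (auto simp: topspace_sigma_topology[OF P])
qed

section \<open>The multiplication map of a dual Banach algebra\<close>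

context dual_banach_algebra
begin

abbreviation "Q \<equiv> predual_space A P"
abbreviation "AD \<equiv> dual_bimodule (regular_bimodule A)"

lemma dual_regular_bimodule: "carr AD = carr (dual A)" "nrm AD = nrm (dual A)"
proof -
  have "dual (regular_bimodule A) = dual A" by (rule dual_cong) (simp_all add: regular_bimodule_def)
  then show "carr AD = carr (dual A)" "nrm AD = nrm (dual A)" by (simp_all add: dual_bimodule_def)
qed

lemma predual_csubspace: "csubspace P"
  using predual_submodule by (simp add: closed_submodule_def)

lemma predual_dual:
  assumes "\<phi> \<in> P"
  shows "\<phi> \<in> carr (dual A)"
proof -
  interpret AD: cnormed_space AD
    using dual_cnormed_space cnormed_space_cong[OF dual_regular_bimodule] by simp
  interpret M: Metric_space "carr AD" "ndist AD" by (rule AD.Metric_space_ndist)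
  have "P \<subseteq> topspace M.mtopology"
    using predual_submodule closedin_subset unfolding closed_submodule_def norm_topology_def by blast
  then have "\<phi> \<in> topspace M.mtopology" using assms by (rule subsetD)
  then have "\<phi> \<in> carr AD" unfolding M.topspace_mtopology .
  then show ?thesis by (simp only: dual_regular_bimodule(1))
qed

lemma predual_cnormed: "cnormed_space Q"
proof -
  interpret AD: cnormed_space "dual A" by (rule dual_cnormed_space)
  show ?thesis
    by (rule cnormed_space.intro) (simp_all add: predual_csubspace predual_dual AD.nrm_nonneg
        AD.nrm_eq_0_iff AD.nrm_triangle AD.nrm_scaleC)
qed

lemma predual_action:
  assumes \<phi>: "\<phi> \<in> P" and a: "a \<in> carr A"
  shows "lact AD a \<phi> \<in> P" and "ract AD \<phi> a \<in> P"
    and "x \<in> carr A \<Longrightarrow> lact AD a \<phi> x = \<phi> (mult A x a)"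
    and "x \<in> carr A \<Longrightarrow> ract AD \<phi> a x = \<phi> (mult A a x)"
  using predual_submodule assms unfolding closed_submodule_def
  by (blast, blast, simp_all add: dual_bimodule_def regular_bimodule_def)

lemma evaluation_predual:
  assumes "\<Lambda> \<in> carr (dual Q)"
  obtains a where "a \<in> carr A" "evaluation P a = \<Lambda>"
proof -
  have "\<Lambda> \<in> evaluation P ` carr A" using assms predual_bij by (simp add: bij_betw_def)
  then show ?thesis using that by blast
qed

lemma evaluation_predual_dual: "a \<in> carr A \<Longrightarrow> evaluation P a \<in> carr (dual Q)"
  using predual_bij by (rule bij_betw_apply)

lemma inv_evaluation_predual:
  "a \<in> carr A \<Longrightarrow> inv_into (carr A) (evaluation P) (evaluation P a) = a"
  using predual_bij by (auto simp: bij_betw_def)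

lemma evaluation_predual_linear:
  assumes "a \<in> carr A"
  shows "b \<in> carr A \<Longrightarrow> evaluation P (a + b) = evaluation P a + evaluation P b"
    and "evaluation P (c *\<^sub>C a) = c *\<^sub>C evaluation P a"
proof -
  have \<phi>: "\<phi> (a + b) = \<phi> a + \<phi> b" "\<phi> (c *\<^sub>C a) = c * \<phi> a" if "\<phi> \<in> P" "b \<in> carr A" for \<phi> b c
    using predual_dual[OF that(1)] assms that(2) unfolding dual_iff by blast+
  show "evaluation P (a + b) = evaluation P a + evaluation P b" if "b \<in> carr A"
    using \<phi>(1)[OF _ that] by (intro ext) (simp add: evaluation_def)
  show "evaluation P (c *\<^sub>C a) = c *\<^sub>C evaluation P a"
    using \<phi>(2)[OF _ assms] by (intro ext) (simp add: evaluation_def)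
qed

text \<open>The inverse of the isometric isomorphism \<open>A \<rightarrow> P\<^sup>*\<close>, extended by zero.\<close>

lemma predual_identification:
  "(\<lambda>\<Lambda>. if \<Lambda> \<in> carr (dual Q) then inv_into (carr A) (evaluation P) \<Lambda> else 0)
     \<in> bounded_linear_maps (dual Q) A" (is "?\<iota> \<in> _")
proof -
  define \<iota> where "\<iota> = ?\<iota>"
  have ev: "\<iota> (evaluation P a) = a" if "a \<in> carr A" for a
    by (simp add: \<iota>_def that evaluation_predual_dual inv_evaluation_predual)
  note cl = csubspace_add[OF csubspace_carr] csubspace_scaleC[OF csubspace_carr]
  have "\<iota> \<in> bounded_linear_maps (dual Q) A"
    unfolding bounded_linear_maps_def
  proof (intro CollectI conjI ballI allI impI)
    show "\<iota> \<Lambda> = 0" if "\<Lambda> \<notin> carr (dual Q)" for \<Lambda> using that by (simp add: \<iota>_def)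
    have "nrm A (\<iota> \<Lambda>) \<le> 1 * nrm (dual Q) \<Lambda>" if "\<Lambda> \<in> carr (dual Q)" for \<Lambda>
      by (rule evaluation_predual[OF that]) (use ev predual_isometry in force)
    then show "\<exists>K. \<forall>\<Lambda>\<in>carr (dual Q). nrm A (\<iota> \<Lambda>) \<le> K * nrm (dual Q) \<Lambda>" by blast
    fix \<Lambda> c assume "\<Lambda> \<in> carr (dual Q)"
    then obtain a where a: "a \<in> carr A" "evaluation P a = \<Lambda>" by (rule evaluation_predual)
    show "\<iota> \<Lambda> \<in> carr A" unfolding a(2)[symmetric] ev[OF a(1)] by (rule a(1))
    show "\<iota> (c *\<^sub>C \<Lambda>) = c *\<^sub>C \<iota> \<Lambda>"
      unfolding a(2)[symmetric] evaluation_predual_linear(2)[OF a(1), symmetric]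
      by (simp only: ev a(1) cl)
    fix \<Lambda>' assume "\<Lambda>' \<in> carr (dual Q)"
    then obtain b where b: "b \<in> carr A" "evaluation P b = \<Lambda>'" by (rule evaluation_predual)
    show "\<iota> (\<Lambda> + \<Lambda>') = \<iota> \<Lambda> + \<iota> \<Lambda>'"
      unfolding a(2)[symmetric] b(2)[symmetric] evaluation_predual_linear(1)[OF a(1) b(1), symmetric]
      by (simp only: ev a(1) b(1) cl)
  qed
  then show ?thesis by (simp add: \<iota>_def)
qed

text \<open>Multiplication is lifted as a map into \<open>P\<^sup>*\<close> and then carried back to \<open>A\<close>.\<close>

lemma pi_map:
  shows "pi_map A \<in> bounded_linear_maps tensor.T A"
    and "b \<in> carr A \<Longrightarrow> c \<in> carr A \<Longrightarrow> pi_map A (ptensor A A b c) = mult A b c"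
proof -
  interpret T: cnormed_space tensor.T by (rule tensor.proj_tensor_cnormed)
  interpret Q: cnormed_space Q by (rule predual_cnormed)
  obtain u where u: "u \<in> bounded_linear_maps tensor.T (dual Q)"
    and up: "\<And>b c. b \<in> carr A \<Longrightarrow> c \<in> carr A \<Longrightarrow> u (ptensor A A b c) = evaluation P (mult A b c)"
    by (rule tensor.proj_lift_dual[OF predual_cnormed, of "\<lambda>b c. evaluation P (mult A b c)" 1])
      (auto simp: evaluation_predual_dual mult_closed mult_add_left mult_add_right mult_scaleC_left
        mult_scaleC_right evaluation_predual_linear predual_isometry nrm_mult)
  define v where "v = (\<lambda>t. if t \<in> carr tensor.T then
     (\<lambda>\<Lambda>. if \<Lambda> \<in> carr (dual Q) then inv_into (carr A) (evaluation P) \<Lambda> else 0) (u t) else 0)"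
  have v: "v \<in> bounded_linear_maps tensor.T A"
    unfolding v_def
    by (rule bounded_linear_maps_compose[OF u predual_identification T.csubspace_carr T.nrm_nonneg
          Q.dual_nrm_nonneg])
  have vp: "v (ptensor A A b c) = mult A b c" if "b \<in> carr A" "c \<in> carr A" for b c
    using that by (simp add: v_def tensor.ptensor_carr up evaluation_predual_dual mult_closed
        inv_evaluation_predual)
  have "pi_map A = v" unfolding pi_map_def by (rule tensor.proj_lift_eq[OF cnormed_space_axioms v vp])
  then show "pi_map A \<in> bounded_linear_maps tensor.T A"
    and "b \<in> carr A \<Longrightarrow> c \<in> carr A \<Longrightarrow> pi_map A (ptensor A A b c) = mult A b c"
    using v vp by simp_all
qed

lemma pi_map_module:
  assumes a: "a \<in> carr A" and t: "t \<in> carr tensor.T"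
  shows "pi_map A (lact TB a t) = mult A a (pi_map A t)"
    and "pi_map A (ract TB t a) = mult A (pi_map A t) a"
proof -
  interpret T: cnormed_space tensor.T by (rule tensor.proj_tensor_cnormed)
  note D = bounded_linear_mapsD[OF pi_map(1)]
  note compT = bounded_linear_maps_compose[OF _ pi_map(1) T.csubspace_carr T.nrm_nonneg T.nrm_nonneg]
  note compA = bounded_linear_maps_compose[OF pi_map(1) _ T.csubspace_carr T.nrm_nonneg nrm_nonneg]
  show "pi_map A (lact TB a t) = mult A a (pi_map A t)"
    using fun_cong[OF tensor.proj_tensor_ext[OF cnormed_space_axioms compT[OF tensor_lact(1)[OF a]]
          compA[OF left_multiplication[OF a]]], of t] t
    by (simp add: tensor.ptensor_carr pi_map tensor_lact a mult_closed mult_assoc D)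
  show "pi_map A (ract TB t a) = mult A (pi_map A t) a"
    using fun_cong[OF tensor.proj_tensor_ext[OF cnormed_space_axioms compT[OF tensor_ract(1)[OF a]]
          compA[OF right_multiplication[OF a]]], of t] t
    by (simp add: tensor.ptensor_carr pi_map tensor_ract a mult_closed mult_assoc D)
qed

section \<open>The adjoint of the multiplication map\<close>

lemma pi_adjoint_dual:
  assumes "\<phi> \<in> P"
  shows "pi_adjoint A \<phi> \<in> carr (dual tensor.T)"
proof -
  interpret T: cnormed_space tensor.T by (rule tensor.proj_tensor_cnormed)
  have "\<phi> \<in> bounded_linear_maps A complex_nspace" using predual_dual[OF assms] by (simp add: dual_def)
  from bounded_linear_maps_compose[OF pi_map(1) this T.csubspace_carr T.nrm_nonneg nrm_nonneg]
  show ?thesis by (simp add: pi_adjoint_def[abs_def] dual_def)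
qed

lemma pi_adjoint_bounded_linear:
  assumes E: "carr E \<subseteq> carr (dual tensor.T)" "nrm E = nrm (dual tensor.T)"
    and into: "\<And>\<phi>. \<phi> \<in> P \<Longrightarrow> pi_adjoint A \<phi> \<in> carr E"
  shows "(\<lambda>\<phi>. if \<phi> \<in> P then pi_adjoint A \<phi> else 0) \<in> bounded_linear_maps Q E" (is "?u \<in> _")
  unfolding bounded_linear_maps_def
proof (intro CollectI conjI ballI allI impI)
  interpret T: cnormed_space tensor.T by (rule tensor.proj_tensor_cnormed)
  interpret AD: cnormed_space "dual A" by (rule dual_cnormed_space)
  obtain K where K: "0 \<le> K" "\<And>t. t \<in> carr tensor.T \<Longrightarrow> nrm A (pi_map A t) \<le> K * nrm tensor.T t"
    using bounded_linear_maps_bound[OF pi_map(1) T.nrm_nonneg] by blast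
  have "nrm (dual tensor.T) (pi_adjoint A \<phi>) \<le> K * nrm (dual A) \<phi>" if "\<phi> \<in> P" for \<phi>
  proof (rule T.dual_nrm_le)
    show "0 \<le> K * nrm (dual A) \<phi>" using K(1) AD.nrm_nonneg[OF predual_dual[OF that]] by simp
    fix t assume t: "t \<in> carr tensor.T"
    have "cmod (\<phi> (pi_map A t)) \<le> nrm (dual A) \<phi> * nrm A (pi_map A t)"
      by (rule dual_apply_le[OF predual_dual[OF that] bounded_linear_mapsD(2)[OF pi_map(1) t]])
    also have "\<dots> \<le> nrm (dual A) \<phi> * (K * nrm tensor.T t)"
      by (intro mult_left_mono K(2)[OF t] AD.nrm_nonneg predual_dual that)
    finally show "cmod (pi_adjoint A \<phi> t) \<le> K * nrm (dual A) \<phi> * nrm tensor.T t"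
      using t by (simp add: pi_adjoint_def mult_ac)
  qed
  then show "\<exists>K. \<forall>\<phi>\<in>carr Q. nrm E (?u \<phi>) \<le> K * nrm Q \<phi>" by (auto simp: E)
  show "?u \<phi> \<in> carr E" if "\<phi> \<in> carr Q" for \<phi> using that into by simp
  show "?u (\<phi> + \<psi>) = ?u \<phi> + ?u \<psi>" if "\<phi> \<in> carr Q" "\<psi> \<in> carr Q" for \<phi> \<psi>
    using that csubspace_add[OF predual_csubspace] by (auto simp: pi_adjoint_def fun_eq_iff)
  show "?u (c *\<^sub>C \<phi>) = c *\<^sub>C ?u \<phi>" if "\<phi> \<in> carr Q" for c \<phi>
    using that csubspace_scaleC[OF predual_csubspace] by (auto simp: pi_adjoint_def fun_eq_iff)
qed simp

text \<open>The duality \<open>P\<^sup>* = A\<close> applied to \<open>\<Lambda> \<circ> \<pi>\<^sup>*\<close>.  The space \<open>E\<close> is the dual of the tensor product when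
  the continuity of the actions is shown, and its \<open>\<sigma>wc\<close> part when \<open>\<pi>\<^sub>\<sigma>\<^sub>w\<^sub>c\<close> is studied.\<close>

lemma functional_pi_adjoint:
  assumes E: "carr E \<subseteq> carr (dual tensor.T)" "nrm E = nrm (dual tensor.T)"
    and into: "\<And>\<phi>. \<phi> \<in> P \<Longrightarrow> pi_adjoint A \<phi> \<in> carr E"
    and \<Lambda>: "\<Lambda> \<in> carr (dual E)"
  obtains z where "z \<in> carr A"
    and "(\<lambda>\<phi>. if \<phi> \<in> P then \<Lambda> (pi_adjoint A \<phi>) else 0) = evaluation P z"
proof -
  interpret Q: cnormed_space Q by (rule predual_cnormed)
  interpret T: cnormed_space tensor.T by (rule tensor.proj_tensor_cnormed)
  have "\<Lambda> \<in> bounded_linear_maps E complex_nspace" using \<Lambda> by (simp add: dual_def)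
  from bounded_linear_maps_compose[OF pi_adjoint_bounded_linear[OF E into] this Q.csubspace_carr
      Q.nrm_nonneg] T.dual_nrm_nonneg E
  have "(\<lambda>\<phi>. if \<phi> \<in> P then \<Lambda> (if \<phi> \<in> P then pi_adjoint A \<phi> else 0) else 0) \<in> carr (dual Q)"
    by (auto simp: dual_def)
  also have "(\<lambda>\<phi>. if \<phi> \<in> P then \<Lambda> (if \<phi> \<in> P then pi_adjoint A \<phi> else 0) else 0)
      = (\<lambda>\<phi>. if \<phi> \<in> P then \<Lambda> (pi_adjoint A \<phi>) else 0)" by auto
  finally obtain z where "z \<in> carr A"
      "evaluation P z = (\<lambda>\<phi>. if \<phi> \<in> P then \<Lambda> (pi_adjoint A \<phi>) else 0)"
    by (rule evaluation_predual)
  then show ?thesis using that by metis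
qed

lemma pi_adjoint_module:
  assumes \<phi>: "\<phi> \<in> P" and a: "a \<in> carr A"
  shows "lact (dual_bimodule TB) a (pi_adjoint A \<phi>) = pi_adjoint A (lact AD a \<phi>)"
    and "ract (dual_bimodule TB) (pi_adjoint A \<phi>) a = pi_adjoint A (ract AD \<phi> a)"
proof -
  note cl = bounded_linear_mapsD(2)[OF tensor_lact(1)[OF a]] bounded_linear_mapsD(2)[OF tensor_ract(1)[OF a]]
    bounded_linear_mapsD(2)[OF pi_map(1)]
  have "lact (dual_bimodule TB) a (pi_adjoint A \<phi>) t = pi_adjoint A (lact AD a \<phi>) t"
    "ract (dual_bimodule TB) (pi_adjoint A \<phi>) a t = pi_adjoint A (ract AD \<phi> a) t" for t
    by (cases "t \<in> carr tensor.T";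
        simp add: dual_bimodule_def[of TB] pi_adjoint_def pi_map_module a cl predual_action(3,4)[OF \<phi> a])+
  then show "lact (dual_bimodule TB) a (pi_adjoint A \<phi>) = pi_adjoint A (lact AD a \<phi>)"
    and "ract (dual_bimodule TB) (pi_adjoint A \<phi>) a = pi_adjoint A (ract AD \<phi> a)"
    by (intro ext; blast)+
qed

lemma carr_dual_tensor_bimodule:
  "carr (dual_bimodule TB) = carr (dual tensor.T)" "nrm (dual_bimodule TB) = nrm (dual tensor.T)"
  by (simp_all add: dual_bimodule_def[of TB] dual_tensor_bimodule)

lemma carr_sigma_wc_tensor: "carr (sigma_wc_tensor A P) \<subseteq> carr (dual tensor.T)"
  and nrm_sigma_wc_tensor: "nrm (sigma_wc_tensor A P) = nrm (dual tensor.T)"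
  by (auto simp: sigma_wc_def carr_dual_tensor_bimodule)

text \<open>If \<open>\<Lambda> \<circ> \<pi>\<^sup>*\<close> is evaluation at \<open>z\<close>, then \<open>\<Lambda>(a \<cdot> \<pi>\<^sup>*\<phi>) = \<Lambda>(\<pi>\<^sup>*(a \<cdot> \<phi>)) = (a \<cdot> \<phi>)(z) = \<phi>(z a)\<close>, which is
  the value at \<open>a\<close> of \<open>\<phi> \<cdot> z \<in> P\<close>; similarly on the other side.\<close>

theorem pi_adjoint_sigma_wc:
  assumes \<phi>: "\<phi> \<in> P"
  shows "pi_adjoint A \<phi> \<in> carr (sigma_wc_tensor A P)"
proof -
  let ?D = "dual_bimodule TB"
  have ne: "P \<noteq> {}" using \<phi> by blast
  have D: "carr ?D \<subseteq> carr (dual tensor.T)" "nrm ?D = nrm (dual tensor.T)"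
    by (simp_all add: carr_dual_tensor_bimodule)
  have z: "\<exists>z\<in>carr A. \<forall>\<psi>\<in>P. \<Lambda> (pi_adjoint A \<psi>) = \<psi> z" if L: "\<Lambda> \<in> carr (dual ?D)" for \<Lambda>
  proof -
    obtain z where "z \<in> carr A"
      and z: "(\<lambda>\<phi>. if \<phi> \<in> P then \<Lambda> (pi_adjoint A \<phi>) else 0) = evaluation P z"
      by (rule functional_pi_adjoint[OF D _ L]) (use pi_adjoint_dual carr_dual_tensor_bimodule in auto)
    moreover have "\<Lambda> (pi_adjoint A \<psi>) = \<psi> z" if "\<psi> \<in> P" for \<psi>
      using fun_cong[OF z, of \<psi>] that by (simp add: evaluation_def)
    ultimately show ?thesis by blast
  qed
  have "continuous_map (sigma_topology (carr A) P) (weak_topology ?D) (\<lambda>a. lact ?D a (pi_adjoint A \<phi>))"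
  proof (rule continuous_into_weak_topology[OF ne])
    show "lact ?D a (pi_adjoint A \<phi>) \<in> carr ?D" if "a \<in> carr A" for a
      using dual_tensor_lact(1)[OF pi_adjoint_dual[OF \<phi>] that] carr_dual_tensor_bimodule by simp
    fix \<Lambda> assume "\<Lambda> \<in> carr (dual ?D)"
    then obtain z where "z \<in> carr A" "\<And>\<psi>. \<psi> \<in> P \<Longrightarrow> \<Lambda> (pi_adjoint A \<psi>) = \<psi> z" using z by blast
    then show "\<exists>\<psi>\<in>P. \<forall>a\<in>carr A. \<Lambda> (lact ?D a (pi_adjoint A \<phi>)) = \<psi> a"
      using \<phi> by (intro bexI[of _ "ract AD \<phi> z"]) (simp_all add: pi_adjoint_module predual_action)
  qed
  moreover have
    "continuous_map (sigma_topology (carr A) P) (weak_topology ?D) (\<lambda>a. ract ?D (pi_adjoint A \<phi>) a)"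
  proof (rule continuous_into_weak_topology[OF ne])
    show "ract ?D (pi_adjoint A \<phi>) a \<in> carr ?D" if "a \<in> carr A" for a
      using dual_tensor_lact(2)[OF pi_adjoint_dual[OF \<phi>] that] carr_dual_tensor_bimodule by simp
    fix \<Lambda> assume "\<Lambda> \<in> carr (dual ?D)"
    then obtain z where "z \<in> carr A" "\<And>\<psi>. \<psi> \<in> P \<Longrightarrow> \<Lambda> (pi_adjoint A \<psi>) = \<psi> z" using z by blast
    then show "\<exists>\<psi>\<in>P. \<forall>a\<in>carr A. \<Lambda> (ract ?D (pi_adjoint A \<phi>) a) = \<psi> a"
      using \<phi> by (intro bexI[of _ "lact AD z \<phi>"]) (simp_all add: pi_adjoint_module predual_action)
  qed
  ultimately show ?thesis
    using pi_adjoint_dual[OF \<phi>] by (simp add: sigma_wc_def carr_dual_tensor_bimodule)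
qed

text \<open>\<open>pi_sigma_wc\<close> is a choice from a fibre of \<open>A \<rightarrow> P\<^sup>*\<close>.  It is meaningful only because the fibre is
  non-empty, that is, because \<open>m \<circ> \<pi>\<^sup>*\<close> is a bounded functional on \<open>P\<close>.\<close>

lemma pi_sigma_wc_carr:
  assumes "m \<in> carr (dual_bimodule (sigma_wc_tensor A P))"
  shows "pi_sigma_wc A P m \<in> carr A"
proof -
  have m: "m \<in> carr (dual (sigma_wc_tensor A P))" using assms by (simp add: dual_bimodule_def)
  obtain z where "z \<in> carr A"
    "(\<lambda>\<phi>. if \<phi> \<in> P then m (pi_adjoint A \<phi>) else 0) = evaluation P z"
    by (rule functional_pi_adjoint[OF carr_sigma_wc_tensor nrm_sigma_wc_tensor pi_adjoint_sigma_wc m])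
  then show ?thesis by (simp add: pi_sigma_wc_def inv_evaluation_predual)
qed

lemma pi_sigma_wc_evaluation:
  assumes t: "t \<in> carr tensor.T"
  shows "pi_sigma_wc A P (evaluation (carr (sigma_wc_tensor A P)) t) = pi_map A t"
proof -
  have "(if \<phi> \<in> P then evaluation (carr (sigma_wc_tensor A P)) t (pi_adjoint A \<phi>) else 0)
      = evaluation P (pi_map A t) \<phi>" for \<phi>
    using t pi_adjoint_sigma_wc by (simp add: evaluation_def pi_adjoint_def)
  then show ?thesis
    unfolding pi_sigma_wc_def
    by (simp add: inv_evaluation_predual bounded_linear_mapsD(2)[OF pi_map(1) t])
qed

end

section \<open>Matrix units\<close>

lemma matrix_unit_mult:
  "j \<in> I \<Longrightarrow> mult (matrix_algebra I) (matrix_unit i j) x k l = (if k = i then x j l else 0)"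
  "i \<in> I \<Longrightarrow> mult (matrix_algebra I) x (matrix_unit i j) k l = (if l = j then x k i else 0)"
proof -
  assume j: "j \<in> I"
  have "mult (matrix_algebra I) (matrix_unit i j) x k l = infsum (\<lambda>q. if k = i then x j l else 0) {j}"
    unfolding matrix_mult using j by (intro infsum_cong_neutral) (auto simp: matrix_unit_def)
  then show "mult (matrix_algebra I) (matrix_unit i j) x k l = (if k = i then x j l else 0)" by simp
next
  assume i: "i \<in> I"
  have "mult (matrix_algebra I) x (matrix_unit i j) k l = infsum (\<lambda>q. if l = j then x k i else 0) {i}"
    unfolding matrix_mult using i by (intro infsum_cong_neutral) (auto simp: matrix_unit_def)
  then show "mult (matrix_algebra I) x (matrix_unit i j) k l = (if l = j then x k i else 0)" by simp
qed

lemma matrix_unit_mult_unit: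
  "j \<in> I \<Longrightarrow> mult (matrix_algebra I) (matrix_unit i j) (matrix_unit k l)
     = (if j = k then matrix_unit i l else 0)"
  by (intro ext) (auto simp: matrix_unit_mult(1), auto simp: matrix_unit_def)

lemma matrix_decomposition:
  assumes I: "finite I" and a: "a \<in> carr (matrix_algebra I)"
  shows "a = (\<Sum>p\<in>I \<times> I. a (fst p) (snd p) *\<^sub>C matrix_unit (fst p) (snd p))"
proof (intro ext)
  fix k l
  have "(\<Sum>p\<in>I \<times> I. a (fst p) (snd p) *\<^sub>C matrix_unit (fst p) (snd p)) k l
      = (\<Sum>p\<in>I \<times> I. if p = (k, l) then a k l else 0)"
    unfolding sum_fun_apply by (intro sum.cong) (auto simp: matrix_unit_def)
  also have "\<dots> = a k l" using I a by (auto simp: carr_matrix_iff)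
  finally show "a k l = (\<Sum>p\<in>I \<times> I. a (fst p) (snd p) *\<^sub>C matrix_unit (fst p) (snd p)) k l" by simp
qed

lemma matrix_linear_expansion:
  assumes I: "finite I" and a: "a \<in> carr (matrix_algebra I)"
    and add: "\<And>x y. x \<in> carr (matrix_algebra I) \<Longrightarrow> y \<in> carr (matrix_algebra I) \<Longrightarrow> f (x + y) = f x + f y"
    and scaleC: "\<And>c x. x \<in> carr (matrix_algebra I) \<Longrightarrow> f (c *\<^sub>C x) = c *\<^sub>C f x"
  shows "f a = (\<Sum>p\<in>I \<times> I. a (fst p) (snd p) *\<^sub>C f (matrix_unit (fst p) (snd p)))"
proof -
  interpret cnormed_space "matrix_algebra I" by (rule matrix_cnormed_space)
  have "f a = f (\<Sum>p\<in>I \<times> I. a (fst p) (snd p) *\<^sub>C matrix_unit (fst p) (snd p))"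
    using matrix_decomposition[OF I a] by (rule arg_cong)
  also have "\<dots> = (\<Sum>p\<in>I \<times> I. f (a (fst p) (snd p) *\<^sub>C matrix_unit (fst p) (snd p)))"
    by (rule carrier_linear_sum[where f = f, OF csubspace_carr add scaleC])
      (auto intro!: csubspace_scaleC[OF csubspace_carr] matrix_unit_carr)
  also have "\<dots> = (\<Sum>p\<in>I \<times> I. a (fst p) (snd p) *\<^sub>C f (matrix_unit (fst p) (snd p)))"
    by (intro sum.cong refl scaleC matrix_unit_carr) auto
  finally show ?thesis .
qed

text \<open>Over a finite index set the functional is the pairing with the matrix of its values at the
  matrix units, and every finitely supported matrix lies in \<open>c\<^sub>0\<close>.\<close>

lemma matrix_functional_predual:
  fixes f :: "('i \<Rightarrow> 'i \<Rightarrow> complex) \<Rightarrow> complex"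
  assumes I: "finite I"
    and add: "\<And>x y. x \<in> carr (matrix_algebra I) \<Longrightarrow> y \<in> carr (matrix_algebra I) \<Longrightarrow> f (x + y) = f x + f y"
    and scaleC: "\<And>c x. x \<in> carr (matrix_algebra I) \<Longrightarrow> f (c *\<^sub>C x) = c *\<^sub>C f x"
  shows "\<exists>\<phi>\<in>matrix_predual I. \<forall>a\<in>carr (matrix_algebra I). f a = \<phi> a"
proof
  let ?g = "\<lambda>i j. if (i, j) \<in> I \<times> I then f (matrix_unit i j) else 0"
  show "matrix_pairing I ?g \<in> matrix_predual I"
    unfolding matrix_predual_def using I by (intro imageI c0_finite) auto
  show "\<forall>a\<in>carr (matrix_algebra I). f a = matrix_pairing I ?g a"
  proof
    fix a assume a: "a \<in> carr (matrix_algebra I)"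
    have "f a = (\<Sum>p\<in>I \<times> I. a (fst p) (snd p) *\<^sub>C f (matrix_unit (fst p) (snd p)))"
      by (rule matrix_linear_expansion[where f = f, OF I a add scaleC])
    also have "\<dots> = (\<Sum>p\<in>I \<times> I. a (fst p) (snd p) * ?g (fst p) (snd p))"
      by (intro sum.cong) auto
    also have "\<dots> = matrix_pairing I ?g a"
      unfolding matrix_pairing_apply[OF a] using I by (intro infsum_finite[symmetric]) simp
    finally show "f a = matrix_pairing I ?g a" .
  qed
qed

text \<open>The sums of \<open>n\<close> equal diagonal entries are bounded by the norm, for every \<open>n\<close>.\<close>

lemma central_diagonal_zero:
  assumes x: "x \<in> carr (matrix_algebra I)" and I: "infinite I" and i: "i \<in> I"
    and diag: "\<And>j. j \<in> I \<Longrightarrow> x j j = x i i"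
  shows "x i i = 0"
proof (rule ccontr)
  assume "x i i \<noteq> 0"
  then have "cmod (x i i) > 0" by simp
  then obtain n where n: "nrm (matrix_algebra I) x < of_nat n * cmod (x i i)"
    using reals_Archimedean3 by blast
  obtain F where F: "F \<subseteq> I" "finite F" "card F = n" using infinite_arbitrarily_large[OF I] by blast
  have "of_nat n * cmod (x i i) = (\<Sum>p\<in>(\<lambda>j. (j, j)) ` F. cmod (x (fst p) (snd p)))"
    using F diag by (subst sum.reindex) (auto simp: inj_on_def subset_iff)
  also have "\<dots> \<le> nrm (matrix_algebra I) x" using F by (intro matrix_sum_le[OF x]) auto
  finally show False using n by simp
qed

section \<open>Infinite index sets\<close>

text \<open>Over an infinite index set all \<open>(i, i)\<close> entries of \<open>e\<^sub>i\<^sub>i z\<^sub>\<alpha>\<close> vanish, so the net stays outside a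
  weak-star neighbourhood of \<open>e\<^sub>i\<^sub>i\<close>.\<close>

lemma spca_net_finite:
  assumes I: "I \<noteq> {}" and net: "spca_net (matrix_algebra I) (matrix_predual I) D le m"
  shows "finite I"
proof (rule ccontr)
  assume inf: "infinite I"
  let ?A = "matrix_algebra I" let ?P = "matrix_predual I"
  interpret dual_banach_algebra ?A ?P by (rule matrix_dual_banach_algebra)
  define z where "z \<alpha> = pi_sigma_wc ?A ?P (m \<alpha>)" for \<alpha>
  have dir: "directed_preorder D le" using net by (simp add: spca_net_def Let_def)
  have z: "z \<alpha> \<in> carr ?A" if "\<alpha> \<in> D" for \<alpha>
    unfolding z_def using net that by (intro pi_sigma_wc_carr) (simp add: spca_net_def Let_def)
  have central: "mult ?A a (z \<alpha>) = mult ?A (z \<alpha>) a" if "\<alpha> \<in> D" "a \<in> carr ?A" for \<alpha> a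
    using net that by (simp add: spca_net_def Let_def z_def)
  obtain i where i: "i \<in> I" using I by blast
  have z0: "z \<alpha> i i = 0" if \<alpha>: "\<alpha> \<in> D" for \<alpha>
  proof (rule central_diagonal_zero[OF z[OF \<alpha>] inf i])
    fix j assume j: "j \<in> I"
    show "z \<alpha> j j = z \<alpha> i i"
      \<comment> \<open>the \<open>(i, j)\<close> entries of \<open>e\<^sub>i\<^sub>j z = z e\<^sub>i\<^sub>j\<close>\<close>
      using fun_cong[OF fun_cong[OF central[OF \<alpha> matrix_unit_carr(1)[OF i j]], of i], of j] i j
      by (simp add: matrix_unit_mult)
  qed
  let ?e = "matrix_unit i i" let ?\<phi> = "matrix_pairing I (matrix_unit i i)"
  have e: "?e \<in> carr ?A" by (rule matrix_unit_carr(1)[OF i i])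
  have \<phi>: "?\<phi> \<in> ?P" unfolding matrix_predual_def by (intro imageI matrix_unit_c0 i)
  have lim: "limitin (sigma_topology (carr ?A) ?P) (\<lambda>\<alpha>. mult ?A ?e (z \<alpha>)) ?e (net_filter D le)"
    using net e by (simp add: spca_net_def Let_def z_def)
  \<comment> \<open>a neighbourhood of \<open>e\<^sub>i\<^sub>i\<close> that contains no matrix with \<open>(i, i)\<close> entry \<open>0\<close>\<close>
  let ?U = "{x \<in> carr ?A. ?\<phi> x \<in> - {0}}"
  have "openin (sigma_topology (carr ?A) ?P) ?U" by (rule openin_sigma_topology[OF \<phi>]) auto
  moreover have "?e \<in> ?U" using e matrix_pairing_unit(2)[OF i i e] by (simp add: matrix_unit_def)
  ultimately have "eventually (\<lambda>\<alpha>. mult ?A ?e (z \<alpha>) \<in> ?U) (net_filter D le)"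
    using lim unfolding limitin_def by blast
  then obtain \<alpha> where \<alpha>: "\<alpha> \<in> D" "\<And>\<beta>. \<beta> \<in> D \<Longrightarrow> le \<alpha> \<beta> \<Longrightarrow> mult ?A ?e (z \<beta>) \<in> ?U"
    unfolding eventually_net_filter[OF dir] by blast
  have "mult ?A ?e (z \<alpha>) \<in> ?U" using \<alpha>(2)[OF \<alpha>(1) directed_preorderD(2)[OF dir \<alpha>(1)]] .
  moreover have "?\<phi> (mult ?A ?e (z \<alpha>)) = 0"
    using matrix_pairing_unit(2)[OF i i mult_closed[OF e z[OF \<alpha>(1)]]] z0[OF \<alpha>(1)]
    by (simp add: matrix_unit_mult(1)[OF i])
  ultimately show False by simp
qed

section \<open>Finite index sets\<close>

text \<open>Composing any functional with \<open>a \<mapsto> a \<cdot> \<phi>\<close> gives a linear functional on \<open>A\<close>, and these all come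
  from the predual.\<close>

lemma sigma_wc_tensor_finite:
  assumes I: "finite I"
  shows "carr (sigma_wc_tensor (matrix_algebra I) (matrix_predual I))
    = carr (dual (proj_tensor (matrix_algebra I) (matrix_algebra I)))"
proof -
  let ?A = "matrix_algebra I" let ?P = "matrix_predual I"
  interpret dual_banach_algebra ?A ?P by (rule matrix_dual_banach_algebra)
  let ?D = "dual_bimodule TB"
  have ne: "?P \<noteq> {}" using csubspace_zero[OF predual_csubspace] by blast
  have "continuous_map (sigma_topology (carr ?A) ?P) (weak_topology ?D) (\<lambda>a. lact ?D a \<phi>)"
    "continuous_map (sigma_topology (carr ?A) ?P) (weak_topology ?D) (\<lambda>a. ract ?D \<phi> a)"
    if \<phi>: "\<phi> \<in> carr (dual tensor.T)" for \<phi>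
  proof -
    note cl = dual_tensor_lact[OF \<phi>] and lin = dual_tensor_linear[OF \<phi>]
    have \<Lambda>: "\<psi> \<in> carr (dual tensor.T) \<Longrightarrow> \<eta> \<in> carr (dual tensor.T) \<Longrightarrow> \<Lambda> (\<psi> + \<eta>) = \<Lambda> \<psi> + \<Lambda> \<eta>"
      "\<psi> \<in> carr (dual tensor.T) \<Longrightarrow> \<Lambda> (c *\<^sub>C \<psi>) = c * \<Lambda> \<psi>"
      if "\<Lambda> \<in> carr (dual ?D)" for \<Lambda> \<psi> \<eta> c
      using that unfolding dual_iff[of _ ?D] carr_dual_tensor_bimodule by blast+
    show "continuous_map (sigma_topology (carr ?A) ?P) (weak_topology ?D) (\<lambda>a. lact ?D a \<phi>)"
      by (intro continuous_into_weak_topology[OF ne] matrix_functional_predual[OF I])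
        (simp_all add: carr_dual_tensor_bimodule cl lin \<Lambda>)
    show "continuous_map (sigma_topology (carr ?A) ?P) (weak_topology ?D) (\<lambda>a. ract ?D \<phi> a)"
      by (intro continuous_into_weak_topology[OF ne] matrix_functional_predual[OF I])
        (simp_all add: carr_dual_tensor_bimodule cl lin \<Lambda>)
  qed
  then show ?thesis by (auto simp: sigma_wc_def carr_dual_tensor_bimodule)
qed

text \<open>A diagonal for the full matrix algebra.  The usual one is the average of these over \<open>r\<close>; a single
  \<open>r\<close> avoids the division by the size of \<open>I\<close>.\<close>

definition matrix_diagonal where
  "matrix_diagonal I r = (\<Sum>i\<in>I. ptensor (matrix_algebra I) (matrix_algebra I) (matrix_unit i r) (matrix_unit r i))"

text \<open>By linearity in \<open>a\<close> it is enough to commute with matrix units: both \<open>e\<^sub>k\<^sub>l \<cdot> t\<close> and \<open>t \<cdot> e\<^sub>k\<^sub>l\<close> reduce to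
  the single term \<open>e\<^sub>k\<^sub>r \<otimes> e\<^sub>r\<^sub>l\<close>.\<close>

lemma matrix_diagonal:
  assumes I: "finite I" and r: "r \<in> I"
  defines "A \<equiv> matrix_algebra I" and "t \<equiv> matrix_diagonal I r"
  shows "t \<in> carr (proj_tensor A A)"
    and "a \<in> carr A \<Longrightarrow> lact (tensor_bimodule A) a t = ract (tensor_bimodule A) t a"
    and "a \<in> carr A \<Longrightarrow> mult A a (pi_map A t) = a"
    and "a \<in> carr A \<Longrightarrow> mult A (pi_map A t) a = a"
proof -
  interpret dual_banach_algebra A "matrix_predual I" unfolding A_def by (rule matrix_dual_banach_algebra)
  interpret T: cnormed_space tensor.T by (rule tensor.proj_tensor_cnormed)
  have u: "matrix_unit i j \<in> carr A" if "i \<in> I" "j \<in> I" for i j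
    unfolding A_def by (rule matrix_unit_carr(1)[OF that])
  have uu: "mult A (matrix_unit i j) (matrix_unit k l) = (if j = k then matrix_unit i l else 0)"
    if "j \<in> I" for i j k l
    unfolding A_def by (rule matrix_unit_mult_unit[OF that])
  let ?d = "\<lambda>i. ptensor A A (matrix_unit i r) (matrix_unit r i)"
  have p: "ptensor A A (matrix_unit i r) (matrix_unit r i) \<in> carr tensor.T" if "i \<in> I" for i
    using that r by (intro tensor.ptensor_carr u)
  have t: "t = (\<Sum>i\<in>I. ptensor A A (matrix_unit i r) (matrix_unit r i))"
    by (simp add: t_def matrix_diagonal_def A_def)
  show tT: "t \<in> carr (proj_tensor A A)" unfolding t by (rule csubspace_sum[OF T.csubspace_carr p])
  have z: "ptensor A A 0 x = 0" "ptensor A A x 0 = 0" if "x \<in> carr A" for x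
    using tensor.ptensor_scaleC[OF zero_carr that, of 0] tensor.ptensor_scaleC[OF that zero_carr, of 0]
    by simp_all
  have unit: "lact TB (matrix_unit k l) t = ract TB t (matrix_unit k l)" if kl: "k \<in> I" "l \<in> I" for k l
  proof -
    have "lact TB (matrix_unit k l) t = (\<Sum>i\<in>I. lact TB (matrix_unit k l) (?d i))"
      unfolding t by (rule bounded_linear_maps_sum[OF tensor_lact(1)[OF u[OF kl]] T.csubspace_carr p])
    also have "\<dots>
        = (\<Sum>i\<in>I. ptensor A A (mult A (matrix_unit k l) (matrix_unit i r)) (matrix_unit r i))"
      using r by (intro sum.cong refl tensor_lact u kl)
    also have "\<dots> = (\<Sum>i\<in>I. if i = l then ptensor A A (matrix_unit k r) (matrix_unit r l) else 0)"
      using r kl by (intro sum.cong refl) (auto simp: uu z u)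
    also have "\<dots> = (\<Sum>i\<in>I. if i = k then ptensor A A (matrix_unit k r) (matrix_unit r l) else 0)"
      using I kl by simp
    also have "\<dots> = (\<Sum>i\<in>I. ptensor A A (matrix_unit i r) (mult A (matrix_unit r i) (matrix_unit k l)))"
      using r kl by (intro sum.cong refl) (auto simp: uu z u)
    also have "\<dots> = (\<Sum>i\<in>I. ract TB (?d i) (matrix_unit k l))"
      using r by (intro sum.cong refl tensor_ract(2)[symmetric] u kl)
    also have "\<dots> = ract TB t (matrix_unit k l)"
      unfolding t
      by (rule bounded_linear_maps_sum[OF tensor_ract(1)[OF u[OF kl]] T.csubspace_carr p, symmetric])
    finally show ?thesis .
  qed
  show "lact TB a t = ract TB t a" if a: "a \<in> carr A" for a
  proof -
    note expand = matrix_linear_expansion[OF I, folded A_def]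
    have "lact TB a t = (\<Sum>p\<in>I \<times> I. a (fst p) (snd p) *\<^sub>C lact TB (matrix_unit (fst p) (snd p)) t)"
      by (rule expand[where f = "\<lambda>a. lact TB a t", OF a tensor_lact_linear])
    also have "\<dots> = (\<Sum>p\<in>I \<times> I. a (fst p) (snd p) *\<^sub>C ract TB t (matrix_unit (fst p) (snd p)))"
      by (intro sum.cong refl) (auto simp: unit)
    also have "\<dots> = ract TB t a"
      by (rule expand[where f = "\<lambda>a. ract TB t a", OF a tensor_ract_linear, symmetric])
    finally show ?thesis .
  qed
  have "pi_map A t = (\<Sum>i\<in>I. pi_map A (?d i))"
    unfolding t by (rule bounded_linear_maps_sum[OF pi_map(1) T.csubspace_carr p])
  also have "\<dots> = (\<Sum>i\<in>I. matrix_unit i i)"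
    using r by (intro sum.cong refl) (simp add: pi_map u uu)
  finally have sum: "pi_map A t = (\<Sum>i\<in>I. matrix_unit i i)" .
  have "pi_map A t k l = (\<Sum>i\<in>I. if i = k then if k = l then 1 else 0 else 0)" for k l
    unfolding sum sum_fun_apply by (intro sum.cong) (auto simp: matrix_unit_def)
  then have pi: "pi_map A t k l = (if k = l \<and> k \<in> I then 1 else 0)" for k l
    using I by simp
  have out: "a k l = 0" if "a \<in> carr A" "k \<notin> I \<or> l \<notin> I" for a k l
    using that by (auto simp: A_def carr_matrix_iff)
  show "mult A a (pi_map A t) = a" if a: "a \<in> carr A" for a
  proof (intro ext)
    fix k l
    have "mult A a (pi_map A t) k l = (\<Sum>j\<in>I. if j = l then a k l else 0)"
      unfolding A_def matrix_mult infsum_finite[OF I] unfolding A_def[symmetric]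
      by (intro sum.cong refl) (auto simp: pi)
    then show "mult A a (pi_map A t) k l = a k l" using I out[OF a] by auto
  qed
  show "mult A (pi_map A t) a = a" if a: "a \<in> carr A" for a
  proof (intro ext)
    fix k l
    have "mult A (pi_map A t) a k l = (\<Sum>j\<in>I. if j = k then a k l else 0)"
      unfolding A_def matrix_mult infsum_finite[OF I] unfolding A_def[symmetric]
      by (intro sum.cong refl) (auto simp: pi)
    then show "mult A (pi_map A t) a k l = a k l" using I out[OF a] by auto
  qed
qed

text \<open>The net is constant, indexed by a single point: evaluation at the diagonal is a commuting
  element which \<open>\<pi>\<^sub>\<sigma>\<^sub>w\<^sub>c\<close> maps to the identity.\<close>

lemma finite_strong_pseudo_Connes_amenable:
  assumes I: "finite I" "I \<noteq> {}"
  shows "strong_pseudo_Connes_amenable (matrix_algebra I) (matrix_predual I)"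
proof -
  let ?A = "matrix_algebra I" let ?P = "matrix_predual I"
  interpret dual_banach_algebra ?A ?P by (rule matrix_dual_banach_algebra)
  interpret T: cnormed_space tensor.T by (rule tensor.proj_tensor_cnormed)
  interpret DT: cnormed_space "dual tensor.T" by (rule T.dual_cnormed_space)
  obtain r where r: "r \<in> I" using I by blast
  let ?t = "matrix_diagonal I r" let ?S = "sigma_wc_tensor ?A ?P"
  note t = matrix_diagonal[OF I(1) r]
  note S = sigma_wc_tensor_finite[OF I(1)]
  define m where "m = evaluation (carr ?S) ?t"
  have m: "m \<in> carr (dual ?S)"
    unfolding dual_iff
  proof (intro conjI)
    have "cmod (m \<phi>) \<le> nrm tensor.T ?t * nrm ?S \<phi>" if "\<phi> \<in> carr ?S" for \<phi>
      using T.dual_apply_le[OF that[unfolded S] t(1)] that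
      by (simp add: m_def evaluation_def nrm_sigma_wc_tensor mult.commute)
    then show "\<exists>K. \<forall>\<phi>\<in>carr ?S. cmod (m \<phi>) \<le> K * nrm ?S \<phi>" by blast
  qed (auto simp: m_def evaluation_def S csubspace_add[OF DT.csubspace_carr]
      csubspace_scaleC[OF DT.csubspace_carr])
  have act: "lact ?S = lact (dual_bimodule TB)" "ract ?S = ract (dual_bimodule TB)"
    by (simp_all add: sigma_wc_def)
  have comm: "lact (dual_bimodule ?S) a m - ract (dual_bimodule ?S) m a = 0" if a: "a \<in> carr ?A" for a
  proof
    fix \<phi>
    show "(lact (dual_bimodule ?S) a m - ract (dual_bimodule ?S) m a) \<phi> = 0 \<phi>"
    proof (cases "\<phi> \<in> carr ?S")
      case True
      then have \<phi>: "\<phi> \<in> carr (dual tensor.T)" using S by simp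
      have "m (lact (dual_bimodule TB) a \<phi>) = \<phi> (ract TB ?t a)"
        "m (ract (dual_bimodule TB) \<phi> a) = \<phi> (lact TB a ?t)"
        using dual_tensor_lact[OF \<phi> a] t(1)
        by (simp_all add: m_def evaluation_def S, simp_all add: dual_bimodule_def[of TB])
      then show ?thesis using True t(2)[OF a] by (simp add: dual_bimodule_def[of ?S] act)
    qed (simp add: dual_bimodule_def[of ?S])
  qed
  have pi: "pi_sigma_wc ?A ?P m = pi_map ?A ?t" unfolding m_def by (rule pi_sigma_wc_evaluation[OF t(1)])
  have "spca_net ?A ?P {()} (\<lambda>_ _. True) (\<lambda>_. m)"
    unfolding spca_net_def Let_def
  proof (intro conjI ballI)
    show "directed_preorder {()} (\<lambda>_ _. True)" by (simp add: directed_preorder_def)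
    show "m \<in> carr (dual_bimodule ?S)" using m by (simp add: dual_bimodule_def)
    fix a assume a: "a \<in> carr ?A"
    have "0 \<in> topspace (weak_star_topology ?S)"
      unfolding weak_star_topology_def
      by (subst topspace_sigma_topology) (auto simp: S zero_dual intro: DT.zero_carr)
    then show "limitin (weak_star_topology ?S)
        (\<lambda>_. lact (dual_bimodule ?S) a m - ract (dual_bimodule ?S) m a) 0 (net_filter {()} (\<lambda>_ _. True))"
      unfolding comm[OF a] by simp
    show "mult ?A a (pi_sigma_wc ?A ?P m) = mult ?A (pi_sigma_wc ?A ?P m) a"
      unfolding pi t(3)[OF a] t(4)[OF a] ..
    have "a \<in> topspace (sigma_topology (carr ?A) ?P)"
      using a csubspace_zero[OF predual_csubspace] by (subst topspace_sigma_topology) auto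
    then show "limitin (sigma_topology (carr ?A) ?P) (\<lambda>_. mult ?A a (pi_sigma_wc ?A ?P m)) a
        (net_filter {()} (\<lambda>_ _. True))"
      unfolding pi t(3)[OF a] by simp
  qed
  then show ?thesis by (rule strong_pseudo_Connes_amenableI)
qed

theorem theorem3p1:
  fixes I :: "'i set"
  assumes "I \<noteq> {}"
  shows "strong_pseudo_Connes_amenable (matrix_algebra I) (matrix_predual I) \<longleftrightarrow> finite I"
proof
  assume "strong_pseudo_Connes_amenable (matrix_algebra I) (matrix_predual I)"
  then show "finite I"
    unfolding strong_pseudo_Connes_amenable_def using spca_net_finite[OF assms] by blast
next
  assume "finite I"
  then show "strong_pseudo_Connes_amenable (matrix_algebra I) (matrix_predual I)"
    using assms by (rule finite_strong_pseudo_Connes_amenable)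
qed

end
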